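(* Consider a diffusion model with forward SDE $\mathrm{d}X_t=f_t(X_t)\mathrm{d}t+\sigma_t\overrightarrow{\mathrm{d}W_t}$, marginal densities $p_t$, and its time-reversal $\mathrm{d}X_t=(f_t(X_t)-\sigma_t^2\nabla\log p_t(X_t))\mathrm{d}t+\sigma_t\overleftarrow{\mathrm{d}W_t}$, $t\in[0,1]$. Put $\mu_t=f_t$, $\nu_t=f_t-\sigma_t^2\nabla\log p_t$, and let $Y$ be the solution of any backward It\^o process with diffusion coefficient $\sigma_t$. Then the density estimator $p_t(Y_t)=p_1(Y_1)\,R^\nu_\mu(Y_{[t,1]})$ is equivalent, in continuous time, to the It\^o density estimator $$\mathrm{d}\log p_t(Y_t)=-\Big(\nabla\cdot f_t(Y_t)+\nabla\log p_t(Y_t)\cdot\big(f_t(Y_t)-\tfrac{\sigma_t^2}{2}\nabla\log p_t(Y_t)\big)\Big)\mathrm{d}t+\nabla\log p_t(Y_t)\cdot\overleftarrow{\mathrm{d}Y_t},$$ that is, $$\log R^\nu_\mu(Y_{[t,1]})=-\int_t^1\nabla\log p_s(Y_s)\cdot\overleftarrow{\mathrm{d}Y_s}+\int_t^1\Big(\nabla\cdot f_s(Y_s)+\nabla\log p_s(Y_s)\cdot\big(f_s(Y_s)-\tfrac{\sigma_s^2}{2}\nabla\log p_s(Y_s)\big)\Big)\mathrm{d}s.$$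
   Context: Notation. $\overrightarrow{\mathrm{d}W_t}$, $\overrightarrow{\mathrm{d}Y_t}$: forward It\^o SDE/integral (left-endpoint evaluation). $\overleftarrow{\mathrm{d}W_t}$, $\overleftarrow{\mathrm{d}Y_t}$: backward SDE/integral (run from time $1$ downwards, right-endpoint evaluation). Differentials $\mathrm{d}\log p_t(Y_t)$ are with respect to increasing $t$, i.e. the relation means $\log p_1(Y_1)-\log p_t(Y_t)$ equals the integral over $[t,1]$ of the right-hand side. For a forward drift $\mu$, backward drift $\nu$ and diffusion coefficient $\sigma_t>0$, $$R^\nu_\mu(Y_{[t,1]})=\exp\Big(\int_t^1\tfrac1{\sigma_s^2}\nu_s\cdot\overleftarrow{\mathrm{d}Y_s}-\int_t^1\tfrac1{\sigma_s^2}\mu_s\cdot\overrightarrow{\mathrm{d}Y_s}+\tfrac12\int_t^1\tfrac1{\sigma_s^2}(\|\mu_s\|^2-\|\nu_s\|^2)\mathrm{d}s\Big),$$ drifts evaluated along $Y_s$ (this is the limit of ratios of products of backward and forward Euler–Maruyama Gaussian kernels). Drifts are assumed sufficiently regular. *)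

theory Defs
  imports "HOL-Probability.Probability"
begin

section \<open>Vector calculus\<close>

definition grad :: "('v::euclidean_space \<Rightarrow> real) \<Rightarrow> 'v \<Rightarrow> 'v" where
  "grad \<phi> x = (\<Sum>e\<in>Basis. frechet_derivative \<phi> (at x) e *\<^sub>R e)"

definition divergence :: "('v::euclidean_space \<Rightarrow> 'v) \<Rightarrow> 'v \<Rightarrow> real" where
  "divergence F x = (\<Sum>e\<in>Basis. frechet_derivative F (at x) e \<bullet> e)"

definition score :: "(real \<Rightarrow> 'v::euclidean_space \<Rightarrow> real) \<Rightarrow> real \<Rightarrow> 'v \<Rightarrow> 'v" where
  "score p t x = grad (\<lambda>y. ln (p t y)) x"

definition reverse_drift ::
  "(real \<Rightarrow> 'v::euclidean_space \<Rightarrow> 'v) \<Rightarrow> (real \<Rightarrow> real) \<Rightarrow> (real \<Rightarrow> 'v \<Rightarrow> real) \<Rightarrow> real \<Rightarrow> 'v \<Rightarrow> 'v" where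
  "reverse_drift f \<sigma> p t x = f t x - (\<sigma> t)\<^sup>2 *\<^sub>R score p t x"

section \<open>Forward and backward stochastic integrals\<close>

text \<open>
  The integrals are limits in probability of Riemann sums along deterministic partitions as the
  mesh tends to zero. The bilinear operation \<open>B\<close> is the inner product for real-valued integrals
  of vector fields, and scalar multiplication for the noise term of an SDE.
  No adaptedness is built in: the left-endpoint integral is also needed for a backward Ito
  process, which is not adapted to an increasing filtration.
\<close>

definition partition_on_interval :: "real \<Rightarrow> real \<Rightarrow> nat \<Rightarrow> (nat \<Rightarrow> real) \<Rightarrow> bool" where
  "partition_on_interval a b n \<tau> \<longleftrightarrow> \<tau> 0 = a \<and> \<tau> n = b \<and> (\<forall>i<n. \<tau> i \<le> \<tau> (Suc i))"

definition left_sum ::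
  "('h \<Rightarrow> 'v::euclidean_space \<Rightarrow> 'c::euclidean_space) \<Rightarrow> (real \<Rightarrow> 'w \<Rightarrow> 'h) \<Rightarrow> (real \<Rightarrow> 'w \<Rightarrow> 'v)
    \<Rightarrow> nat \<Rightarrow> (nat \<Rightarrow> real) \<Rightarrow> 'w \<Rightarrow> 'c" where
  "left_sum B H Y n \<tau> \<omega> = (\<Sum>i<n. B (H (\<tau> i) \<omega>) (Y (\<tau> (Suc i)) \<omega> - Y (\<tau> i) \<omega>))"

definition right_sum ::
  "('h \<Rightarrow> 'v::euclidean_space \<Rightarrow> 'c::euclidean_space) \<Rightarrow> (real \<Rightarrow> 'w \<Rightarrow> 'h) \<Rightarrow> (real \<Rightarrow> 'w \<Rightarrow> 'v)
    \<Rightarrow> nat \<Rightarrow> (nat \<Rightarrow> real) \<Rightarrow> 'w \<Rightarrow> 'c" where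
  "right_sum B H Y n \<tau> \<omega> = (\<Sum>i<n. B (H (\<tau> (Suc i)) \<omega>) (Y (\<tau> (Suc i)) \<omega> - Y (\<tau> i) \<omega>))"

definition mesh_limit_in_prob ::
  "'w measure \<Rightarrow> real \<Rightarrow> real \<Rightarrow> (nat \<Rightarrow> (nat \<Rightarrow> real) \<Rightarrow> 'w \<Rightarrow> 'c::euclidean_space) \<Rightarrow> ('w \<Rightarrow> 'c) \<Rightarrow> bool" where
  "mesh_limit_in_prob M a b S I \<longleftrightarrow>
     I \<in> borel_measurable M \<and>
     (\<forall>\<epsilon>>0. \<exists>\<delta>>0. \<forall>n \<tau>.
        partition_on_interval a b n \<tau> \<and> (\<forall>i<n. \<tau> (Suc i) - \<tau> i < \<delta>) \<longrightarrow>
        S n \<tau> \<in> borel_measurable M \<and>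
        measure M {\<omega> \<in> space M. dist (S n \<tau> \<omega>) (I \<omega>) > \<epsilon>} < \<epsilon>)"

definition has_fwd_integral ::
  "('h \<Rightarrow> 'v::euclidean_space \<Rightarrow> 'c::euclidean_space) \<Rightarrow> 'w measure \<Rightarrow> (real \<Rightarrow> 'w \<Rightarrow> 'h)
    \<Rightarrow> (real \<Rightarrow> 'w \<Rightarrow> 'v) \<Rightarrow> real \<Rightarrow> real \<Rightarrow> ('w \<Rightarrow> 'c) \<Rightarrow> bool" where
  "has_fwd_integral B M H Y a b I \<longleftrightarrow> mesh_limit_in_prob M a b (left_sum B H Y) I"

definition has_bwd_integral ::
  "('h \<Rightarrow> 'v::euclidean_space \<Rightarrow> 'c::euclidean_space) \<Rightarrow> 'w measure \<Rightarrow> (real \<Rightarrow> 'w \<Rightarrow> 'h)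
    \<Rightarrow> (real \<Rightarrow> 'w \<Rightarrow> 'v) \<Rightarrow> real \<Rightarrow> real \<Rightarrow> ('w \<Rightarrow> 'c) \<Rightarrow> bool" where
  "has_bwd_integral B M H Y a b I \<longleftrightarrow> mesh_limit_in_prob M a b (right_sum B H Y) I"

definition fwd_integrable where
  "fwd_integrable B M H Y a b \<longleftrightarrow> (\<exists>I. has_fwd_integral B M H Y a b I)"

definition bwd_integrable where
  "bwd_integrable B M H Y a b \<longleftrightarrow> (\<exists>I. has_bwd_integral B M H Y a b I)"

text \<open>A version of the integral; it is determined up to almost sure equality.\<close>

definition fwd_integral where
  "fwd_integral B M H Y a b = (SOME I. has_fwd_integral B M H Y a b I)"

definition bwd_integral where
  "bwd_integral B M H Y a b = (SOME I. has_bwd_integral B M H Y a b I)"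

section \<open>Brownian motion and Ito processes on the time interval from 0 to 1\<close>

definition brownian_motion ::
  "'w measure \<Rightarrow> (real \<Rightarrow> 'w measure) \<Rightarrow> (real \<Rightarrow> 'w \<Rightarrow> 'v::euclidean_space) \<Rightarrow> bool" where
  "brownian_motion M F W \<longleftrightarrow>
     prob_space M \<and> filtration (space M) F \<and> (\<forall>t. subalgebra M (F t)) \<and>
     (\<forall>t\<in>{0..1}. W t \<in> borel_measurable (F t)) \<and>
     (AE \<omega> in M. W 0 \<omega> = 0) \<and>
     (AE \<omega> in M. continuous_on {0..1} (\<lambda>t. W t \<omega>)) \<and>
     (\<forall>s\<in>{0..1}. \<forall>t\<in>{0..1}. s < t \<longrightarrow>
        prob_space.indep_set M
          {(\<lambda>\<omega>. W t \<omega> - W s \<omega>) -` A \<inter> space M | A. A \<in> sets borel} (sets (F s)) \<and>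
        distributed M lborel (\<lambda>\<omega>. W t \<omega> - W s \<omega>)
          (\<lambda>x. ennreal (\<Prod>e\<in>Basis. normal_density 0 (sqrt (t - s)) (x \<bullet> e))))"

text \<open>
  A backward Brownian motion starts from 0 at time 1, and \<open>G\<close> is decreasing in time: \<open>G t\<close>
  is the information available when running down from time 1 to time \<open>t\<close>.
\<close>

definition backward_brownian_motion ::
  "'w measure \<Rightarrow> (real \<Rightarrow> 'w measure) \<Rightarrow> (real \<Rightarrow> 'w \<Rightarrow> 'v::euclidean_space) \<Rightarrow> bool" where
  "backward_brownian_motion M G W \<longleftrightarrow> brownian_motion M (\<lambda>t. G (1 - t)) (\<lambda>t. W (1 - t))"

definition prog_measurable ::
  "(real \<Rightarrow> 'w measure) \<Rightarrow> (real \<Rightarrow> 'w \<Rightarrow> 'v::euclidean_space) \<Rightarrow> bool" where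
  "prog_measurable F b \<longleftrightarrow>
     (\<forall>t\<in>{0..1}. (\<lambda>(s, \<omega>). b s \<omega>) \<in> borel_measurable (restrict_space borel {0..t} \<Otimes>\<^sub>M F t))"

definition ito_process ::
  "'w measure \<Rightarrow> (real \<Rightarrow> 'w measure) \<Rightarrow> (real \<Rightarrow> 'w \<Rightarrow> 'v::euclidean_space) \<Rightarrow> (real \<Rightarrow> 'w \<Rightarrow> 'v)
    \<Rightarrow> (real \<Rightarrow> real) \<Rightarrow> (real \<Rightarrow> 'w \<Rightarrow> 'v) \<Rightarrow> bool" where
  "ito_process M F W b \<sigma> X \<longleftrightarrow>
     brownian_motion M F W \<and>
     (\<forall>t\<in>{0..1}. X t \<in> borel_measurable (F t)) \<and>
     (AE \<omega> in M. continuous_on {0..1} (\<lambda>t. X t \<omega>)) \<and>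
     prog_measurable F b \<and>
     (AE \<omega> in M. set_integrable lborel {0..1} (\<lambda>s. b s \<omega>)) \<and>
     (\<forall>s\<in>{0..1}. \<forall>t\<in>{0..1}. s \<le> t \<longrightarrow>
        (\<exists>I. has_fwd_integral (*\<^sub>R) M (\<lambda>r _. \<sigma> r) W s t I \<and>
          (AE \<omega> in M. X t \<omega> - X s \<omega> = (LINT r:{s..t}|lborel. b r \<omega>) + I \<omega>)))"

definition backward_ito_process ::
  "'w measure \<Rightarrow> (real \<Rightarrow> 'w measure) \<Rightarrow> (real \<Rightarrow> 'w \<Rightarrow> 'v::euclidean_space) \<Rightarrow> (real \<Rightarrow> 'w \<Rightarrow> 'v)
    \<Rightarrow> (real \<Rightarrow> real) \<Rightarrow> (real \<Rightarrow> 'w \<Rightarrow> 'v) \<Rightarrow> bool" where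
  "backward_ito_process M G W b \<sigma> Y \<longleftrightarrow>
     backward_brownian_motion M G W \<and>
     (\<forall>t\<in>{0..1}. Y t \<in> borel_measurable (G t)) \<and>
     (AE \<omega> in M. continuous_on {0..1} (\<lambda>t. Y t \<omega>)) \<and>
     prog_measurable (\<lambda>t. G (1 - t)) (\<lambda>t. b (1 - t)) \<and>
     (AE \<omega> in M. set_integrable lborel {0..1} (\<lambda>s. b s \<omega>)) \<and>
     (\<forall>s\<in>{0..1}. \<forall>t\<in>{0..1}. s \<le> t \<longrightarrow>
        (\<exists>I. has_bwd_integral (*\<^sub>R) M (\<lambda>r _. \<sigma> r) W s t I \<and>
          (AE \<omega> in M. Y t \<omega> - Y s \<omega> = (LINT r:{s..t}|lborel. b r \<omega>) + I \<omega>)))"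

definition solves_forward_sde where
  "solves_forward_sde M F W f \<sigma> X \<longleftrightarrow> ito_process M F W (\<lambda>s \<omega>. f s (X s \<omega>)) \<sigma> X"

definition solves_backward_sde where
  "solves_backward_sde M G W f \<sigma> X \<longleftrightarrow> backward_ito_process M G W (\<lambda>s \<omega>. f s (X s \<omega>)) \<sigma> X"

section \<open>Regularity\<close>

definition regular_drift :: "(real \<Rightarrow> 'v::euclidean_space \<Rightarrow> 'v) \<Rightarrow> bool" where
  "regular_drift f \<longleftrightarrow>
     continuous_on ({0..1} \<times> UNIV) (\<lambda>(t, x). f t x) \<and>
     (\<forall>t\<in>{0..1}. \<forall>x. f t differentiable (at x)) \<and>
     (\<forall>v. continuous_on ({0..1} \<times> UNIV) (\<lambda>(t, x). frechet_derivative (f t) (at x) v))"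

definition regular_density :: "(real \<Rightarrow> 'v::euclidean_space \<Rightarrow> real) \<Rightarrow> bool" where
  "regular_density p \<longleftrightarrow>
     (\<forall>t\<in>{0..1}. \<forall>x. 0 < p t x \<and> p t differentiable (at x)) \<and>
     continuous_on ({0..1} \<times> UNIV) (\<lambda>(t, x). score p t x)"

section \<open>The path density ratio\<close>

definition path_ratio ::
  "'w measure \<Rightarrow> (real \<Rightarrow> real) \<Rightarrow> (real \<Rightarrow> 'v::euclidean_space \<Rightarrow> 'v) \<Rightarrow> (real \<Rightarrow> 'v \<Rightarrow> 'v)
    \<Rightarrow> (real \<Rightarrow> 'w \<Rightarrow> 'v) \<Rightarrow> real \<Rightarrow> 'w \<Rightarrow> real" where
  "path_ratio M \<sigma> \<mu> \<nu> Y t \<omega> = exp (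
       bwd_integral (\<bullet>) M (\<lambda>s \<omega>. (1 / (\<sigma> s)\<^sup>2) *\<^sub>R \<nu> s (Y s \<omega>)) Y t 1 \<omega>
     - fwd_integral (\<bullet>) M (\<lambda>s \<omega>. (1 / (\<sigma> s)\<^sup>2) *\<^sub>R \<mu> s (Y s \<omega>)) Y t 1 \<omega>
     + 1 / 2 * (LINT s:{t..1}|lborel.
         1 / (\<sigma> s)\<^sup>2 * ((norm (\<mu> s (Y s \<omega>)))\<^sup>2 - (norm (\<nu> s (Y s \<omega>)))\<^sup>2)))"

end

theory Submission
  imports Defs
begin

text \<open>
  Running time backwards turns \<open>Y\<close> into a forward Ito process \<open>X\<close>. Such an \<open>X\<close> is a good
  integrator (uniformly small adapted simple integrands have integrals that are small in
  probability), so left-endpoint sums of a continuous adapted integrand are Cauchy in probability.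
  The backward minus the forward integral of \<open>g = f / \<sigma>\<^sup>2\<close> against \<open>Y\<close> becomes the
  limit of the sums of \<open>(g(\<tau>\<^sub>i\<^sub>+\<^sub>1, X\<^sub>i\<^sub>+\<^sub>1) - g(\<tau>\<^sub>i, X\<^sub>i)) \<bullet> \<Delta>X\<^sub>i\<close>.
  No regularity of \<open>g\<close> in time beyond continuity is available, but
  \<open>g(\<tau>\<^sub>i\<^sub>+\<^sub>1, X\<^sub>i) - g(\<tau>\<^sub>i, X\<^sub>i)\<close> is adapted and small, hence negligible by the good integrator
  property. The remaining space increment is \<open>Dg(\<Delta>X\<^sub>i) \<bullet> \<Delta>X\<^sub>i\<close> up to a negligible error, and the
  quadratic variation of \<open>X\<close> turns it into the integral of \<open>\<sigma>\<^sup>2 \<nabla>\<cdot>g = \<nabla>\<cdot>f\<close>. The rest is the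
  algebraic identity \<open>(|f|\<^sup>2 - |\<nu>|\<^sup>2) / (2 \<sigma>\<^sup>2) = s \<bullet> (f - \<sigma>\<^sup>2 s / 2)\<close> for \<open>\<nu> = f - \<sigma>\<^sup>2 s\<close>.
\<close>

section \<open>Bounds in probability\<close>

text \<open>Two features of the definitions shape the estimates. The left-endpoint integral of a
  function of \<open>Y\<close> is anticipating for the decreasing filtration of a backward process,
  so no isometry yields its existence; it is obtained as a backward integral, which is adapted after
  reversal, minus the covariation limit. Moreover the drift \<open>b\<close> is only pathwise
  integrable, so \<open>Y\<close> need not have any moments. Second moment estimates are therefore
  applied only to Gaussian increments with bounded weights, unbounded weights are cut off outside an
  event of small probability, and all statements are uniform over fine partitions instead of
  following one sequence. Only one field has to be differentiated. Dividing the reverse drift by the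
  squared diffusion coefficient gives \<open>f\<close> divided by that square, minus the score. The
  score thus enters the integrals only through a backward one, for which continuity is enough, while
  the passage from right to left endpoints concerns \<open>f\<close> alone.\<close>

context prob_space
begin

text \<open>Nothing is assumed about measurability of \<open>Z\<close>: the exceptional event only has to contain
  \<open>{|Z| > K}\<close>. This allows pathwise integrals whose measurability is not known.\<close>

definition prob_bound :: "real \<Rightarrow> real \<Rightarrow> ('a \<Rightarrow> real) \<Rightarrow> bool" where
  "prob_bound \<epsilon> K Z \<longleftrightarrow> (\<exists>A\<in>events. prob A < \<epsilon> \<and> (\<forall>\<omega>\<in>space M - A. \<bar>Z \<omega>\<bar> \<le> K))"

lemma prob_boundI:
  "A \<in> events \<Longrightarrow> prob A < \<epsilon> \<Longrightarrow> (\<And>\<omega>. \<omega> \<in> space M \<Longrightarrow> \<omega> \<notin> A \<Longrightarrow> \<bar>Z \<omega>\<bar> \<le> K) \<Longrightarrow> prob_bound \<epsilon> K Z"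
  unfolding prob_bound_def by blast

lemma prob_boundE:
  assumes "prob_bound \<epsilon> K Z"
  obtains A where "A \<in> events" "prob A < \<epsilon>" "\<And>\<omega>. \<omega> \<in> space M \<Longrightarrow> \<omega> \<notin> A \<Longrightarrow> \<bar>Z \<omega>\<bar> \<le> K"
  using assms unfolding prob_bound_def by blast

lemma prob_union_less:
  assumes "A \<in> events" "B \<in> events" "prob A < a" "prob B < b"
  shows "prob (A \<union> B) < a + b"
  using measure_Un_le[of A M B] assms by linarith

lemma AE_null_eventE:
  assumes "AE \<omega> in M. P \<omega>"
  obtains A where "A \<in> events" "prob A = 0" "\<And>\<omega>. \<omega> \<in> space M \<Longrightarrow> \<omega> \<notin> A \<Longrightarrow> P \<omega>"
proof -
  from AE_E[OF assms] obtain A where "{x \<in> space M. \<not> P x} \<subseteq> A" "emeasure M A = 0" "A \<in> events"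
    by blast
  then show ?thesis
    by (intro that[of A]) (auto simp: measure_def)
qed

lemma prob_bound_AE_mono:
  assumes "prob_bound \<epsilon> K Z" "\<epsilon> \<le> \<epsilon>'" "K \<le> K'" "AE \<omega> in M. \<bar>Z' \<omega>\<bar> \<le> \<bar>Z \<omega>\<bar>"
  shows "prob_bound \<epsilon>' K' Z'"
proof -
  obtain A where A: "A \<in> events" "prob A < \<epsilon>" "\<And>\<omega>. \<omega> \<in> space M \<Longrightarrow> \<omega> \<notin> A \<Longrightarrow> \<bar>Z \<omega>\<bar> \<le> K"
    using prob_boundE[OF assms(1)] by blast
  obtain B where B: "B \<in> events" "prob B = 0"
    "\<And>\<omega>. \<omega> \<in> space M \<Longrightarrow> \<omega> \<notin> B \<Longrightarrow> \<bar>Z' \<omega>\<bar> \<le> \<bar>Z \<omega>\<bar>"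
    using AE_null_eventE[OF assms(4)] by blast
  show ?thesis
  proof (rule prob_boundI[of "A \<union> B"])
    show "prob (A \<union> B) < \<epsilon>'"
      using measure_Un_le[of A M B] A B assms(2) by simp
    show "\<bar>Z' \<omega>\<bar> \<le> K'" if "\<omega> \<in> space M" "\<omega> \<notin> A \<union> B" for \<omega>
      using A(3)[of \<omega>] B(3)[of \<omega>] that assms(3) by auto
  qed (use A B in auto)
qed

lemma prob_bound_mono:
  assumes "prob_bound \<epsilon> K Z" "\<epsilon> \<le> \<epsilon>'" "K \<le> K'"
  shows "prob_bound \<epsilon>' K' Z"
  by (rule prob_bound_AE_mono[OF assms]) simp

text \<open>Pays for truncation: a truncated quantity agrees with the original one off an event of
  small probability, and that probability is added to the budget.\<close>

lemma prob_bound_localize: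
  assumes "prob_bound \<epsilon> K Z" "A \<in> events" "prob A < a"
    and "\<And>\<omega>. \<omega> \<in> space M \<Longrightarrow> \<omega> \<notin> A \<Longrightarrow> \<bar>Z' \<omega>\<bar> \<le> \<bar>Z \<omega>\<bar>"
  shows "prob_bound (a + \<epsilon>) K Z'"
proof -
  obtain B where B: "B \<in> events" "prob B < \<epsilon>" "\<And>\<omega>. \<omega> \<in> space M \<Longrightarrow> \<omega> \<notin> B \<Longrightarrow> \<bar>Z \<omega>\<bar> \<le> K"
    using prob_boundE[OF assms(1)] by blast
  show ?thesis
  proof (rule prob_boundI[of "A \<union> B"])
    show "\<bar>Z' \<omega>\<bar> \<le> K" if "\<omega> \<in> space M" "\<omega> \<notin> A \<union> B" for \<omega>
      using assms(4)[of \<omega>] B(3)[of \<omega>] that by auto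
  qed (use assms B prob_union_less in auto)
qed

lemma prob_bound_add:
  assumes "prob_bound \<epsilon> K Z" "prob_bound \<epsilon>' K' Z'"
  shows "prob_bound (\<epsilon> + \<epsilon>') (K + K') (\<lambda>\<omega>. Z \<omega> + Z' \<omega>)"
proof -
  obtain A where A: "A \<in> events" "prob A < \<epsilon>" "\<And>\<omega>. \<omega> \<in> space M \<Longrightarrow> \<omega> \<notin> A \<Longrightarrow> \<bar>Z \<omega>\<bar> \<le> K"
    using prob_boundE[OF assms(1)] by blast
  obtain B where B: "B \<in> events" "prob B < \<epsilon>'" "\<And>\<omega>. \<omega> \<in> space M \<Longrightarrow> \<omega> \<notin> B \<Longrightarrow> \<bar>Z' \<omega>\<bar> \<le> K'"
    using prob_boundE[OF assms(2)] by blast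
  show ?thesis
  proof (rule prob_boundI[of "A \<union> B"])
    show "\<bar>Z \<omega> + Z' \<omega>\<bar> \<le> K + K'" if "\<omega> \<in> space M" "\<omega> \<notin> A \<union> B" for \<omega>
      using A(3)[of \<omega>] B(3)[of \<omega>] that by auto
  qed (use A B prob_union_less in auto)
qed

lemma prob_bound_mult:
  assumes "prob_bound \<epsilon> K Z" "prob_bound \<epsilon>' K' Z'"
  shows "prob_bound (\<epsilon> + \<epsilon>') (K * K') (\<lambda>\<omega>. Z \<omega> * Z' \<omega>)"
proof -
  obtain A where A: "A \<in> events" "prob A < \<epsilon>" "\<And>\<omega>. \<omega> \<in> space M \<Longrightarrow> \<omega> \<notin> A \<Longrightarrow> \<bar>Z \<omega>\<bar> \<le> K"
    using prob_boundE[OF assms(1)] by blast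
  obtain B where B: "B \<in> events" "prob B < \<epsilon>'" "\<And>\<omega>. \<omega> \<in> space M \<Longrightarrow> \<omega> \<notin> B \<Longrightarrow> \<bar>Z' \<omega>\<bar> \<le> K'"
    using prob_boundE[OF assms(2)] by blast
  show ?thesis
  proof (rule prob_boundI[of "A \<union> B"])
    show "\<bar>Z \<omega> * Z' \<omega>\<bar> \<le> K * K'" if "\<omega> \<in> space M" "\<omega> \<notin> A \<union> B" for \<omega>
      using A(3)[of \<omega>] B(3)[of \<omega>] that mult_mono[of "\<bar>Z \<omega>\<bar>" K "\<bar>Z' \<omega>\<bar>" K'] by (auto simp: abs_mult)
  qed (use A B prob_union_less in auto)
qed

lemma prob_bound_zero: "0 < \<epsilon> \<Longrightarrow> 0 \<le> K \<Longrightarrow> prob_bound \<epsilon> K (\<lambda>_. 0)"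
  by (rule prob_boundI[of "{}"]) auto

text \<open>One spare \<open>\<epsilon>\<close> beyond the \<open>card I\<close> summands is kept
  because \<open>prob_bound\<close> asks for a strict inequality, which the empty sum must also
  satisfy.\<close>

lemma prob_bound_sum:
  assumes "finite I" "\<epsilon> > 0" "\<And>i. i \<in> I \<Longrightarrow> prob_bound \<epsilon> K (Z i)"
  shows "prob_bound (real (card I + 1) * \<epsilon>) (real (card I) * K) (\<lambda>\<omega>. \<Sum>i\<in>I. Z i \<omega>)"
  using assms(1,3)
proof (induction I rule: finite_induct)
  case empty
  then show ?case
    using prob_bound_zero[OF \<open>0 < \<epsilon>\<close>, of 0] by simp
next
  case (insert i I)
  have "prob_bound (\<epsilon> + real (card I + 1) * \<epsilon>) (K + real (card I) * K) (\<lambda>\<omega>. Z i \<omega> + (\<Sum>i\<in>I. Z i \<omega>))"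
    by (intro prob_bound_add insert) (use insert in auto)
  then show ?case
    using insert(1,2) by (simp add: algebra_simps)
qed

text \<open>Chebyshev's inequality. The hypothesis is strict since \<open>prob_bound\<close> is, so
  later constants are chosen with a factor 2 to spare.\<close>

lemma prob_bound_second_moment:
  assumes [measurable]: "Z \<in> borel_measurable M" and "integrable M (\<lambda>\<omega>. (Z \<omega>)\<^sup>2)"
    and "expectation (\<lambda>\<omega>. (Z \<omega>)\<^sup>2) < \<epsilon> * K\<^sup>2" "K > 0"
  shows "prob_bound \<epsilon> K Z"
proof (rule prob_boundI[of "{\<omega> \<in> space M. K \<le> \<bar>Z \<omega>\<bar>}"])
  have "{\<omega> \<in> space M. K \<le> \<bar>Z \<omega>\<bar>} = {\<omega> \<in> space M. K\<^sup>2 \<le> (Z \<omega>)\<^sup>2}"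
    using \<open>K > 0\<close> by (auto simp: abs_le_square_iff[symmetric])
  then have "prob {\<omega> \<in> space M. K \<le> \<bar>Z \<omega>\<bar>} \<le> expectation (\<lambda>\<omega>. (Z \<omega>)\<^sup>2) / K\<^sup>2"
    using integral_Markov_inequality_measure[OF assms(2), of "space M" "K\<^sup>2"] \<open>K > 0\<close> by simp
  also have "\<dots> < \<epsilon>"
    using assms(3,4) by (simp add: field_simps)
  finally show "prob {\<omega> \<in> space M. K \<le> \<bar>Z \<omega>\<bar>} < \<epsilon>" .
qed auto

lemma prob_bound_first_moment:
  assumes [measurable]: "Z \<in> borel_measurable M" and "integrable M Z" "AE \<omega> in M. 0 \<le> Z \<omega>"
    and "expectation Z < \<epsilon> * K" "K > 0"
  shows "prob_bound \<epsilon> K Z"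
proof -
  \<comment> \<open>\<open>Z\<close> is nonnegative only almost surely, so Markov's inequality is
    used for the positive part and the null set is absorbed afterwards.\<close>
  have "prob_bound \<epsilon> K (\<lambda>\<omega>. max 0 (Z \<omega>))"
  proof (rule prob_boundI[of "{\<omega> \<in> space M. K \<le> Z \<omega>}"])
    have "prob {\<omega> \<in> space M. K \<le> Z \<omega>} \<le> expectation Z / K"
      using integral_Markov_inequality_measure[OF assms(2), of "space M" "K"] assms(3) \<open>K > 0\<close> by simp
    also have "\<dots> < \<epsilon>"
      using assms(4,5) by (simp add: field_simps)
    finally show "prob {\<omega> \<in> space M. K \<le> Z \<omega>} < \<epsilon>" .
  qed (use \<open>K > 0\<close> in auto)
  then show ?thesis
    by (rule prob_bound_AE_mono) (use assms(3) in auto)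
qed

text \<open>Continuity of the measure from above: an almost sure statement with an unspecified
  random \<open>m\<close> becomes one with a fixed \<open>m\<close> and a small exceptional event.
  Tightness and moduli of continuity both come from it.\<close>

lemma AE_eventually_out_prob_small:
  assumes "\<And>m::nat. B m \<in> events" "\<And>m. B (Suc m) \<subseteq> B m" "AE \<omega> in M. \<exists>m. \<omega> \<notin> B m" "\<epsilon> > 0"
  shows "\<exists>m. prob (B m) < \<epsilon>"
proof -
  have "(\<lambda>m. prob (B m)) \<longlonglongrightarrow> prob (\<Inter>m. B m)"
    by (rule finite_Lim_measure_decseq) (use assms in \<open>auto intro!: decseq_SucI\<close>)
  moreover have "prob (\<Inter>m. B m) = 0"
  proof -
    have "AE \<omega> in M. \<omega> \<notin> (\<Inter>m. B m)"
      using assms(3) by auto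
    then have "emeasure M (\<Inter>m. B m) = 0"
      using assms(1) sets.sets_into_space[OF assms(1)] by (subst (asm) AE_iff_measurable[of "\<Inter>m. B m"]) blast+
    then show ?thesis by (simp add: measure_def)
  qed
  ultimately have "eventually (\<lambda>m. prob (B m) < \<epsilon>) sequentially"
    using order_tendstoD(2) \<open>\<epsilon> > 0\<close> by fastforce
  then show ?thesis
    by (auto simp: eventually_sequentially)
qed

text \<open>As \<open>Z\<close> may fail to be measurable, the set where it is large is not measured
  directly; it is enclosed in events of arbitrarily small probability, whose intersection is
  null.\<close>

lemma prob_bound_all_imp_AE_zero:
  assumes "\<And>\<epsilon>. \<epsilon> > 0 \<Longrightarrow> prob_bound \<epsilon> \<epsilon> Z"
  shows "AE \<omega> in M. Z \<omega> = 0"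
proof -
  have "AE \<omega> in M. \<bar>Z \<omega>\<bar> \<le> inverse (real (Suc k))" for k
  proof -
    have "\<forall>m. \<exists>A\<in>events. prob A < inverse (real (Suc m)) \<and> (\<forall>\<omega>\<in>space M - A. \<bar>Z \<omega>\<bar> \<le> inverse (real (Suc k)))"
    proof
      fix m
      \<comment> \<open>The hypothesis couples probability and size in one
        \<open>\<epsilon>\<close>; the minimum of the two inverses lets the level \<open>k\<close>
        stay fixed while the probability index \<open>m\<close> varies.\<close>
      have "prob_bound (min (inverse (real (Suc m))) (inverse (real (Suc k)))) (min (inverse (real (Suc m))) (inverse (real (Suc k)))) Z"
        by (intro assms) auto
      then have "prob_bound (inverse (real (Suc m))) (inverse (real (Suc k))) Z"
        by (rule prob_bound_mono) auto
      then show "\<exists>A\<in>events. prob A < inverse (real (Suc m)) \<and> (\<forall>\<omega>\<in>space M - A. \<bar>Z \<omega>\<bar> \<le> inverse (real (Suc k)))"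
        unfolding prob_bound_def .
    qed
    then obtain A where A: "\<And>m. A m \<in> events" "\<And>m. prob (A m) < inverse (real (Suc m))"
      "\<And>m \<omega>. \<omega> \<in> space M \<Longrightarrow> \<omega> \<notin> A m \<Longrightarrow> \<bar>Z \<omega>\<bar> \<le> inverse (real (Suc k))"
      by (metis DiffI)
    have "prob (\<Inter>m. A m) = 0"
    proof (rule ccontr)
      assume "prob (\<Inter>m. A m) \<noteq> 0"
      then have "prob (\<Inter>m. A m) > 0"
        using measure_nonneg[of M "\<Inter>m. A m"] by linarith
      then obtain m where "inverse (real (Suc m)) < prob (\<Inter>m. A m)"
        using reals_Archimedean by blast
      moreover have "prob (\<Inter>m. A m) \<le> prob (A m)"
        using A(1) by (intro finite_measure_mono) auto
      ultimately show False
        using A(2)[of m] by linarith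
    qed
    then have "(\<Inter>m. A m) \<in> null_sets M"
      using A(1) by (intro null_setsI) (auto simp: emeasure_eq_measure)
    then show ?thesis
      by (rule AE_I') (use A(3) in auto)
  qed
  then have "AE \<omega> in M. \<forall>k. \<bar>Z \<omega>\<bar> \<le> inverse (real (Suc k))"
    by (simp add: AE_all_countable)
  then show ?thesis
    by eventually_elim (metis reals_Archimedean not_less zero_less_abs_iff)
qed

section \<open>Tightness and moduli of continuity\<close>

lemma random_variable_tight:
  assumes [measurable]: "Z \<in> borel_measurable M" and "\<epsilon> > 0"
  shows "\<exists>K>0. prob_bound \<epsilon> K Z"
proof -
  have "\<exists>m. prob {\<omega> \<in> space M. real m < \<bar>Z \<omega>\<bar>} < \<epsilon>"
  proof (rule AE_eventually_out_prob_small)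
    show "AE \<omega> in M. \<exists>m. \<omega> \<notin> {\<omega> \<in> space M. real m < \<bar>Z \<omega>\<bar>}"
      by (rule AE_I2) (auto simp: not_less intro: real_arch_simple)
  qed (use \<open>\<epsilon> > 0\<close> in auto)
  then obtain m where m: "prob {\<omega> \<in> space M. real m < \<bar>Z \<omega>\<bar>} < \<epsilon>" by blast
  have "prob_bound \<epsilon> (real m + 1) Z"
    by (rule prob_boundI[OF _ m]) auto
  then show ?thesis
    by (intro exI[of _ "real m + 1"]) auto
qed

text \<open>The supremum over all pairs of times is replaced by a countable union over rational
  pairs, which is an event; path continuity then extends the bound to real times.\<close>

lemma process_modulus:
  fixes Z :: "real \<Rightarrow> 'a \<Rightarrow> 'c::euclidean_space"
  assumes [measurable]: "\<And>t. t \<in> {0..1} \<Longrightarrow> Z t \<in> borel_measurable M"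
    and cont: "AE \<omega> in M. continuous_on {0..1} (\<lambda>t. Z t \<omega>)" and "\<epsilon> > 0" "\<kappa> > 0"
  shows "\<exists>\<delta>>0. \<exists>A\<in>events. prob A < \<epsilon> \<and>
    (\<forall>\<omega>\<in>space M - A. \<forall>s\<in>{0..1}. \<forall>t\<in>{0..1}. \<bar>s - t\<bar> < \<delta> \<longrightarrow> dist (Z s \<omega>) (Z t \<omega>) \<le> \<kappa>)"
proof -
  let ?Q = "\<rat> \<inter> {0..1::real}"
  define B where "B m = (\<Union>s\<in>?Q. \<Union>t\<in>?Q \<inter> {t. \<bar>s - t\<bar> < inverse (real (Suc m))}.
    {\<omega> \<in> space M. \<kappa> < dist (Z s \<omega>) (Z t \<omega>)})" for m
  have count: "countable (?Q \<inter> S)" for S :: "real set"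
    by (meson Int_lower1 countable_rat countable_subset)
  obtain C where C: "C \<in> events" "prob C = 0"
    "\<And>\<omega>. \<omega> \<in> space M \<Longrightarrow> \<omega> \<notin> C \<Longrightarrow> continuous_on {0..1} (\<lambda>t. Z t \<omega>)"
    using AE_null_eventE[OF cont] by blast
  have "\<exists>m. prob (B m) < \<epsilon>"
  proof (rule AE_eventually_out_prob_small)
    show "B m \<in> events" for m
      unfolding B_def using count count[of UNIV] by (intro sets.countable_UN') auto
    show "B (Suc m) \<subseteq> B m" for m
    proof -
      have "inverse (real (Suc (Suc m))) \<le> inverse (real (Suc m))"
        by (simp add: field_simps)
      then show ?thesis
        unfolding B_def by (intro UN_mono Int_mono order_refl Collect_mono) (metis less_le_trans)
    qed
    show "AE \<omega> in M. \<exists>m. \<omega> \<notin> B m"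
      using cont
    proof eventually_elim
      case (elim \<omega>)
      then have "uniformly_continuous_on {0..1} (\<lambda>t. Z t \<omega>)"
        by (intro compact_uniformly_continuous) auto
      then obtain d where d: "d > 0" "\<And>s t. s \<in> {0..1} \<Longrightarrow> t \<in> {0..1} \<Longrightarrow> dist t s < d \<Longrightarrow> dist (Z t \<omega>) (Z s \<omega>) < \<kappa>"
        using \<open>\<kappa> > 0\<close> unfolding uniformly_continuous_on_def by meson
      obtain m where "inverse (real (Suc m)) < d"
        using reals_Archimedean[OF d(1)] by auto
      then have "\<omega> \<notin> B m"
        unfolding B_def using d(2) by (force simp: dist_real_def)
      then show ?case ..
    qed
  qed fact
  then obtain m where m: "prob (B m) < \<epsilon>" by blast
  have Bm: "B m \<in> events"
    unfolding B_def using count count[of UNIV] by (intro sets.countable_UN') auto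
  show ?thesis
  proof (intro exI[of _ "inverse (real (Suc m))"] conjI bexI[of _ "B m \<union> C"] ballI impI)
    show "prob (B m \<union> C) < \<epsilon>"
      using measure_Un_le[of "B m" M C] Bm C m by simp
    fix \<omega> s t assume \<omega>: "\<omega> \<in> space M - (B m \<union> C)"
      and st: "s \<in> {0..1::real}" "t \<in> {0..1::real}" "\<bar>s - t\<bar> < inverse (real (Suc m))"
    define S where "S = {(s, t). \<bar>s - t\<bar> < inverse (real (Suc m)) \<and> s \<in> {0..1::real} \<and> t \<in> {0..1}}"
    have approx: "\<exists>q. (\<forall>n::nat. q n \<in> ?Q) \<and> q \<longlonglongrightarrow> x" if "x \<in> {0..1}" for x
    proof -
      have "x \<in> closure ?Q"
      proof -
        have "closure ({0<..<1} \<inter> \<rat>) = closure {0<..<1::real}"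
          by (rule closure_open_Int_superset) (auto simp: Rats_closure_real)
        then have "{0..1::real} \<subseteq> closure ({0<..<1} \<inter> \<rat>)"
          by simp
        also have "\<dots> \<subseteq> closure ?Q"
          by (intro closure_mono) auto
        finally show ?thesis using that by blast
      qed
      then show ?thesis
        unfolding closure_sequential by blast
    qed
    obtain q r where q: "\<And>n. q n \<in> ?Q" "q \<longlonglongrightarrow> s" and r: "\<And>n. r n \<in> ?Q" "r \<longlonglongrightarrow> t"
      using approx st by meson
    have c: "continuous_on {0..1} (\<lambda>t. Z t \<omega>)"
      using C \<omega> by auto
    have "(\<lambda>n. dist (Z (q n) \<omega>) (Z (r n) \<omega>)) \<longlonglongrightarrow> dist (Z s \<omega>) (Z t \<omega>)"
      by (intro tendsto_dist continuous_on_tendsto_compose[OF c]) (use q r st in auto)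
    \<comment> \<open>The strict inequality between the times is inherited by close rational
      approximants, while the weak bound by \<open>\<kappa>\<close> passes to the limit.\<close>
    moreover have "eventually (\<lambda>n. \<bar>q n - r n\<bar> < inverse (real (Suc m))) sequentially"
      by (rule order_tendstoD(2)[of _ "\<bar>s - t\<bar>"]) (use q r st in \<open>auto intro!: tendsto_intros\<close>)
    then have "eventually (\<lambda>n. dist (Z (q n) \<omega>) (Z (r n) \<omega>) \<le> \<kappa>) sequentially"
      by eventually_elim (use \<omega> q r in \<open>auto simp: B_def not_less\<close>)
    ultimately show "dist (Z s \<omega>) (Z t \<omega>) \<le> \<kappa>"
      by (intro tendsto_upperbound) auto
  qed (use Bm C in auto)
qed

text \<open>Chaining from time 0: the first value is tight, and the path reaches time
  \<open>t\<close> in \<open>N\<close> steps shorter than \<open>\<delta>\<close>, each changing the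
  norm by at most 1 off the exceptional event. Hence the bound \<open>K + real N\<close>.\<close>

lemma process_tight:
  fixes Z :: "real \<Rightarrow> 'a \<Rightarrow> 'c::euclidean_space"
  assumes meas: "\<And>t. t \<in> {0..1} \<Longrightarrow> Z t \<in> borel_measurable M"
    and cont: "AE \<omega> in M. continuous_on {0..1} (\<lambda>t. Z t \<omega>)" and "\<epsilon> > 0"
  shows "\<exists>K>0. \<exists>A\<in>events. prob A < \<epsilon> \<and> (\<forall>\<omega>\<in>space M - A. \<forall>t\<in>{0..1}. norm (Z t \<omega>) \<le> K)"
proof -
  obtain \<delta> A where \<delta>: "\<delta> > 0" and A: "A \<in> events" "prob A < \<epsilon>/2"
    "\<forall>\<omega>\<in>space M - A. \<forall>s\<in>{0..1}. \<forall>t\<in>{0..1}. \<bar>s - t\<bar> < \<delta> \<longrightarrow> dist (Z s \<omega>) (Z t \<omega>) \<le> 1"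
    using process_modulus[OF meas cont, of "\<epsilon>/2" 1] \<open>\<epsilon> > 0\<close> by auto
  have [measurable]: "Z 0 \<in> borel_measurable M"
    using meas[of 0] by simp
  obtain K where K: "K > 0" "prob_bound (\<epsilon>/2) K (\<lambda>\<omega>. norm (Z 0 \<omega>))"
    using random_variable_tight[of "\<lambda>\<omega>. norm (Z 0 \<omega>)" "\<epsilon>/2"] \<open>\<epsilon> > 0\<close> by auto
  obtain B where B: "B \<in> events" "prob B < \<epsilon>/2" "\<And>\<omega>. \<omega> \<in> space M \<Longrightarrow> \<omega> \<notin> B \<Longrightarrow> \<bar>norm (Z 0 \<omega>)\<bar> \<le> K"
    using prob_boundE[OF K(2)] by blast
  obtain N where N: "N > 0" "inverse (real N) < \<delta>"
    using ex_inverse_of_nat_less[OF \<delta>] by auto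
  have "norm (Z t \<omega>) \<le> K + real N" if "\<omega> \<in> space M - (A \<union> B)" "t \<in> {0..1}" for \<omega> t
  proof -
    have "norm (Z (t * real k / real N) \<omega>) \<le> K + real k" if "k \<le> N" for k
      using that
    proof (induction k)
      case 0
      then show ?case using B(3)[of \<omega>] \<open>\<omega> \<in> space M - (A \<union> B)\<close> by simp
    next
      case (Suc k)
      have le: "t * real j / real N \<in> {0..1}" if "j \<le> N" for j
        using that N(1) \<open>t \<in> {0..1}\<close> mult_mono[of t 1 "real j" "real N"] by simp
      have "\<bar>t * real (Suc k) / real N - t * real k / real N\<bar> = t * inverse (real N)"
        using \<open>t \<in> {0..1}\<close> N(1) by (simp add: field_simps)
      also have "\<dots> \<le> inverse (real N)"
        using \<open>t \<in> {0..1}\<close> N(1) by (simp add: field_simps)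
      finally have "\<bar>t * real (Suc k) / real N - t * real k / real N\<bar> < \<delta>"
        using N(2) by simp
      then have "dist (Z (t * real (Suc k) / real N) \<omega>) (Z (t * real k / real N) \<omega>) \<le> 1"
        using A(3) \<open>\<omega> \<in> space M - (A \<union> B)\<close> le[of k] le[of "Suc k"] Suc.prems by auto
      moreover have "norm (Z (t * real (Suc k) / real N) \<omega>) \<le> norm (Z (t * real k / real N) \<omega>) +
          dist (Z (t * real (Suc k) / real N) \<omega>) (Z (t * real k / real N) \<omega>)"
        by (metis dist_norm norm_triangle_sub)
      ultimately show ?case
        using Suc by simp
    qed
    from this[of N] show ?thesis using N(1) by simp
  qed
  moreover have "prob (A \<union> B) < \<epsilon>"
    using prob_union_less[OF A(1) B(1) A(2) B(2)] by simp
  ultimately show ?thesis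
    using A(1) B(1) K(1) by (intro exI[of _ "K + real N"] conjI bexI[of _ "A \<union> B"]) auto
qed

end

section \<open>Riemann sums along partitions\<close>

definition fine_partition :: "real \<Rightarrow> real \<Rightarrow> real \<Rightarrow> nat \<Rightarrow> (nat \<Rightarrow> real) \<Rightarrow> bool" where
  "fine_partition a b \<delta> n \<tau> \<longleftrightarrow> partition_on_interval a b n \<tau> \<and> (\<forall>i<n. \<tau> (Suc i) - \<tau> i < \<delta>)"

lemma fine_partition_mono: "fine_partition a b \<delta> n \<tau> \<Longrightarrow> \<delta> \<le> \<delta>' \<Longrightarrow> fine_partition a b \<delta>' n \<tau>"
  unfolding fine_partition_def by (meson less_le_trans)

lemma partition_mono:
  assumes "partition_on_interval a b n \<tau>" "i \<le> j" "j \<le> n"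
  shows "\<tau> i \<le> \<tau> j"
  using assms(2,3)
proof (induction j rule: dec_induct)
  case (step j)
  then have "\<tau> j \<le> \<tau> (Suc j)"
    using assms(1) by (auto simp: partition_on_interval_def)
  then show ?case using step by simp
qed simp

lemma partition_in_interval:
  assumes "partition_on_interval a b n \<tau>" "i \<le> n"
  shows "\<tau> i \<in> {a..b}"
  using partition_mono[OF assms(1), of 0 i] partition_mono[OF assms(1), of i n] assms
  by (auto simp: partition_on_interval_def)

lemma partition_unit:
  assumes "partition_on_interval u v n \<tau>" "0 \<le> u" "v \<le> 1" "i < n"
  shows "\<tau> i \<in> {0..1}" "\<tau> (Suc i) \<in> {0..1}" "\<tau> i \<le> \<tau> (Suc i)"
  using partition_in_interval[OF assms(1), of i] partition_in_interval[OF assms(1), of "Suc i"] assms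
  by (auto simp: partition_on_interval_def)

lemma fine_partition_unit:
  assumes "fine_partition u v \<delta> n \<tau>" "0 \<le> u" "v \<le> 1" "i < n"
  shows "\<tau> i \<in> {0..1}" "\<tau> (Suc i) \<in> {0..1}" "\<tau> i \<le> \<tau> (Suc i)" "\<tau> (Suc i) - \<tau> i < \<delta>"
  using assms partition_unit[of u v n \<tau> i] by (auto simp: fine_partition_def)

lemma partition_le: "partition_on_interval a b n \<tau> \<Longrightarrow> a \<le> b"
  using partition_in_interval[of a b n \<tau> 0] by simp

lemma sum_partition_telescope:
  fixes x :: "real \<Rightarrow> 'c::ab_group_add"
  assumes "partition_on_interval a b n \<tau>"
  shows "(\<Sum>i<n. x (\<tau> (Suc i)) - x (\<tau> i)) = x b - x a"
  using sum_lessThan_telescope[of "\<lambda>i. x (\<tau> i)" n] assms by (simp add: partition_on_interval_def)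

lemma ex_fine_partition:
  assumes "a \<le> b" "\<delta> > 0"
  shows "\<exists>n \<tau>. fine_partition a b \<delta> n \<tau>"
proof -
  obtain N where N: "(b - a) / \<delta> < real N" "N > 0"
    using reals_Archimedean2[of "(b - a) / \<delta>"] assms
    by (metis divide_nonneg_pos diff_ge_0_iff_ge of_nat_0_less_iff order_le_less_trans)
  have "(b - a) * real (Suc i) / real N - (b - a) * real i / real N = (b - a) / real N" for i
    by (simp add: algebra_simps add_divide_distrib diff_divide_distrib)
  moreover have "(b - a) / real N < \<delta>"
    using N assms by (simp add: field_simps)
  ultimately show ?thesis
    unfolding fine_partition_def partition_on_interval_def using N assms
    by (intro exI[of _ N] exI[of _ "\<lambda>i. a + (b - a) * real i / real N"])
       (auto intro!: divide_right_mono mult_left_mono)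
qed

section \<open>Common refinements of two partitions\<close>

lemma subpartition_index:
  fixes \<rho> :: "nat \<Rightarrow> real"
  assumes \<rho>: "\<And>j k. j < k \<Longrightarrow> k \<le> m \<Longrightarrow> \<rho> j < \<rho> k" "\<rho> ` {..m} \<subseteq> {a..b}"
    and \<tau>: "partition_on_interval a b n \<tau>" "\<tau> ` {..n} \<subseteq> \<rho> ` {..m}"
  shows "\<exists>p. p 0 = 0 \<and> p n = m \<and> (\<forall>i<n. p i \<le> p (Suc i)) \<and> (\<forall>i\<le>n. \<rho> (p i) = \<tau> i)"
proof -
  have "\<forall>i. \<exists>j. i \<le> n \<longrightarrow> j \<le> m \<and> \<rho> j = \<tau> i"
    using \<tau>(2) by (metis atMost_iff image_eqI image_iff subsetD)
  then obtain p where p: "\<And>i. i \<le> n \<Longrightarrow> p i \<le> m" "\<And>i. i \<le> n \<Longrightarrow> \<rho> (p i) = \<tau> i"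
    by metis
  \<comment> \<open>Strict monotonicity of \<open>\<rho>\<close> carries the order of the points
    back to their positions; \<open>\<tau>\<close> may repeat points, so the inequality is
    weak.\<close>
  have "p i \<le> p (Suc i)" if "i < n" for i
  proof (rule ccontr)
    assume "\<not> p i \<le> p (Suc i)"
    then have "\<tau> (Suc i) < \<tau> i"
      using \<rho>(1)[of "p (Suc i)" "p i"] p[of i] p[of "Suc i"] that by auto
    then show False
      using \<tau>(1) that by (auto simp: partition_on_interval_def not_le[symmetric])
  qed
  moreover have "p 0 = 0"
  proof (rule ccontr)
    assume "p 0 \<noteq> 0"
    then have "\<rho> 0 < \<tau> 0"
      using \<rho>(1)[of 0 "p 0"] p[of 0] by auto
    moreover have "\<rho> 0 \<in> {a..b}"
      using \<rho>(2) by auto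
    ultimately show False
      using \<tau>(1) by (simp add: partition_on_interval_def)
  qed
  moreover have "p n = m"
  proof (rule ccontr)
    assume "p n \<noteq> m"
    then have "\<tau> n < \<rho> m"
      using \<rho>(1)[of "p n" m] p[of n] by auto
    moreover have "\<rho> m \<in> {a..b}"
      using \<rho>(2) by auto
    ultimately show False
      using \<tau>(1) by (simp add: partition_on_interval_def)
  qed
  ultimately show ?thesis
    using p by blast
qed

text \<open>\<open>c k\<close> is the coarse cell that contains the fine step \<open>k\<close>.
  Empty blocks \<open>p i = p (Suc i)\<close> are never selected, because the least index with
  \<open>k < p (Suc i)\<close> also satisfies \<open>p i \<le> k\<close>. Within a block the weight
  is constant and the increments telescope.\<close>

lemma sum_regroup:
  fixes x y :: "nat \<Rightarrow> 'v::real_inner"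
  assumes "p 0 = 0" "\<And>i. i < n \<Longrightarrow> p i \<le> p (Suc i)"
  defines "c \<equiv> \<lambda>k. LEAST i. k < p (Suc i)"
  shows "(\<Sum>i<n. y i \<bullet> (x (p (Suc i)) - x (p i))) = (\<Sum>k<p n. y (c k) \<bullet> (x (Suc k) - x k))" (is ?A)
    and "\<And>k. k < p n \<Longrightarrow> c k < n \<and> p (c k) \<le> k \<and> k < p (Suc (c k))" (is "PROP ?B")
proof -
  have cell: "c k = i" if "i < n" "p i \<le> k" "k < p (Suc i)" for i k
    unfolding c_def
  proof (rule Least_equality)
    fix j assume j: "k < p (Suc j)"
    show "i \<le> j"
    proof (rule ccontr)
      assume "\<not> i \<le> j"
      then have "Suc j \<le> i" by simp
      then have "p (Suc j) \<le> p i"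
        using \<open>i < n\<close>
      proof (induction i rule: dec_induct)
        case (step l)
        then show ?case using assms(2)[of l] by simp
      qed simp
      then show False using j that by simp
    qed
  qed fact
  have "(\<Sum>i<l. y i \<bullet> (x (p (Suc i)) - x (p i))) = (\<Sum>k<p l. y (c k) \<bullet> (x (Suc k) - x k))"
    if "l \<le> n" for l
    using that
  proof (induction l)
    case 0
    then show ?case using assms(1) by simp
  next
    case (Suc l)
    have le: "p l \<le> p (Suc l)"
      using assms(2) Suc.prems by simp
    have "{..<p (Suc l)} = {..<p l} \<union> {p l..<p (Suc l)}"
      using le by auto
    then have "(\<Sum>k<p (Suc l). y (c k) \<bullet> (x (Suc k) - x k)) =
      (\<Sum>k<p l. y (c k) \<bullet> (x (Suc k) - x k)) + (\<Sum>k=p l..<p (Suc l). y (c k) \<bullet> (x (Suc k) - x k))"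
      by (simp add: sum.union_disjoint[symmetric] ivl_disj_int)
    also have "(\<Sum>k=p l..<p (Suc l). y (c k) \<bullet> (x (Suc k) - x k)) = (\<Sum>k=p l..<p (Suc l). y l \<bullet> (x (Suc k) - x k))"
      by (intro sum.cong refl) (use cell[of l] Suc.prems in simp)
    also have "\<dots> = y l \<bullet> (x (p (Suc l)) - x (p l))"
      using le by (simp add: inner_sum_right[symmetric] sum_Suc_diff')
    finally show ?case
      using Suc by simp
  qed
  from this[of n] show ?A by simp
  have "\<forall>k<p l. \<exists>i<l. p i \<le> k \<and> k < p (Suc i)" if "l \<le> n" for l
    using that
  proof (induction l)
    case 0
    then show ?case using assms(1) by simp
  next
    case (Suc l)
    then show ?case
      by (metis Suc_leD less_Suc_eq not_less)
  qed
  from this[of n] show "PROP ?B"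
    using cell by (metis order_refl)
qed

text \<open>Besides rewriting both sums on one partition, the conclusion locates each coarse point:
  it does not exceed \<open>\<rho> k\<close>, so an adapted process evaluated there is known at time
  \<open>\<rho> k\<close>, and it is less than \<open>\<delta>\<close> away. The functions
  \<open>h\<close> and \<open>x\<close> are quantified after the partition, so that one refinement
  serves every sample point.\<close>

lemma common_refinement:
  fixes \<tau> \<tau>' :: "nat \<Rightarrow> real"
  assumes \<tau>: "fine_partition a b \<delta> n \<tau>" and \<tau>': "fine_partition a b \<delta> n' \<tau>'"
  shows "\<exists>m \<rho> c c'. partition_on_interval a b m \<rho> \<and>
    (\<forall>k<m. c k < n \<and> \<tau> (c k) \<le> \<rho> k \<and> \<rho> k < \<tau> (c k) + \<delta>) \<and>
    (\<forall>k<m. c' k < n' \<and> \<tau>' (c' k) \<le> \<rho> k \<and> \<rho> k < \<tau>' (c' k) + \<delta>) \<and>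
    (\<forall>h x. (\<Sum>i<n. h (\<tau> i) \<bullet> (x (\<tau> (Suc i)) - x (\<tau> i))) =
       (\<Sum>k<m. h (\<tau> (c k)) \<bullet> (x (\<rho> (Suc k)) - (x (\<rho> k) :: 'v::real_inner)))) \<and>
    (\<forall>h x. (\<Sum>i<n'. h (\<tau>' i) \<bullet> (x (\<tau>' (Suc i)) - x (\<tau>' i))) =
       (\<Sum>k<m. h (\<tau>' (c' k)) \<bullet> (x (\<rho> (Suc k)) - (x (\<rho> k) :: 'v::real_inner))))"
proof -
  define T where "T = \<tau> ` {..n} \<union> \<tau>' ` {..n'}"
  \<comment> \<open>Sorting the set of points removes repetitions, so \<open>\<rho>\<close> is
    strictly increasing even if \<open>\<tau>\<close> or \<open>\<tau>'\<close> has cells of length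
    zero.\<close>
  define L where "L = sorted_list_of_set T"
  define m where "m = length L - 1"
  define \<rho> where "\<rho> k = L ! k" for k
  have part: "partition_on_interval a b n \<tau>" "partition_on_interval a b n' \<tau>'"
    using \<tau> \<tau>' by (auto simp: fine_partition_def)
  have "finite T" "T \<noteq> {}"
    by (auto simp: T_def)
  then have L: "set L = T" "sorted_wrt (<) L" "L \<noteq> []"
    by (auto simp: L_def)
  have len: "length L = Suc m"
    using L(3) by (cases L) (auto simp: m_def)
  have img: "\<rho> ` {..m} = T"
    unfolding L(1)[symmetric] \<rho>_def set_conv_nth len by (auto simp: less_Suc_eq_le)
  have strict: "\<rho> j < \<rho> k" if "j < k" "k \<le> m" for j k
    unfolding \<rho>_def using sorted_wrt_nth_less[OF L(2), of j k] that len by auto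
  have T: "T \<subseteq> {a..b}"
    using partition_in_interval[OF part(1)] partition_in_interval[OF part(2)] by (auto simp: T_def)
  have single: "\<exists>c. (\<forall>k<m. c k < n \<and> \<tau> (c k) \<le> \<rho> k \<and> \<rho> k < \<tau> (c k) + \<delta>) \<and> (\<rho> 0 = a \<and> \<rho> m = b) \<and>
    (\<forall>h x. (\<Sum>i<n. h (\<tau> i) \<bullet> (x (\<tau> (Suc i)) - x (\<tau> i))) =
       (\<Sum>k<m. h (\<tau> (c k)) \<bullet> (x (\<rho> (Suc k)) - (x (\<rho> k) :: 'v::real_inner))))"
    if fp: "fine_partition a b \<delta> n \<tau>" and sub: "\<tau> ` {..n} \<subseteq> T" for n \<tau>
  proof -
    have pt: "partition_on_interval a b n \<tau>" and mesh: "\<And>i. i < n \<Longrightarrow> \<tau> (Suc i) - \<tau> i < \<delta>"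
      using fp by (auto simp: fine_partition_def)
    obtain p where p: "p 0 = 0" "p n = m" "\<And>i. i < n \<Longrightarrow> p i \<le> p (Suc i)" "\<And>i. i \<le> n \<Longrightarrow> \<rho> (p i) = \<tau> i"
      using subpartition_index[of m \<rho> a b n \<tau>, OF strict _ pt] img T sub by auto
    define c where "c k = (LEAST i. k < p (Suc i))" for k
    have c: "c k < n" "p (c k) \<le> k" "k < p (Suc (c k))" if "k < m" for k
      using sum_regroup(2)[of p n k, folded c_def] p(1,2,3) that by auto
    have "\<tau> (c k) \<le> \<rho> k \<and> \<rho> k < \<tau> (c k) + \<delta>" if "k < m" for k
    proof -
      have "p j \<le> p n" if "j \<le> n" for j
        using that
      proof (induction rule: inc_induct)
        case (step l)
        then show ?case using p(3)[of l] by simp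
      qed simp
      then have pm: "p (Suc (c k)) \<le> m"
        using p(2) c(1)[OF that] by auto
      have "\<rho> (p (c k)) \<le> \<rho> k"
        using strict[of "p (c k)" k] c(2)[OF that] that by (cases "p (c k) = k") auto
      moreover have "\<rho> k < \<rho> (p (Suc (c k)))"
        using strict[OF c(3)[OF that] pm] .
      ultimately show ?thesis
        using p(4)[of "c k"] p(4)[of "Suc (c k)"] c(1)[OF that] mesh[of "c k"] by auto
    qed
    moreover have "(\<Sum>i<n. h (\<tau> i) \<bullet> (x (\<tau> (Suc i)) - x (\<tau> i))) =
       (\<Sum>k<m. h (\<tau> (c k)) \<bullet> (x (\<rho> (Suc k)) - (x (\<rho> k) :: 'v)))" for h x
    proof -
      have "(\<Sum>i<n. h (\<tau> i) \<bullet> (x (\<tau> (Suc i)) - x (\<tau> i))) =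
          (\<Sum>i<n. h (\<tau> i) \<bullet> (x (\<rho> (p (Suc i))) - x (\<rho> (p i))))"
        by (intro sum.cong refl) (simp add: p(4))
      also have "\<dots> = (\<Sum>k<m. h (\<tau> (c k)) \<bullet> (x (\<rho> (Suc k)) - x (\<rho> k)))"
        using sum_regroup(1)[of p n "\<lambda>i. h (\<tau> i)" "\<lambda>k. x (\<rho> k)", folded c_def] p(1,2,3) by simp
      finally show ?thesis .
    qed
    moreover have "\<rho> 0 = a \<and> \<rho> m = b"
      using p(1,2) p(4)[of 0] p(4)[of n] pt by (auto simp: partition_on_interval_def)
    ultimately show ?thesis
      using c(1) by (intro exI[of _ c]) auto
  qed
  obtain c where c: "\<forall>k<m. c k < n \<and> \<tau> (c k) \<le> \<rho> k \<and> \<rho> k < \<tau> (c k) + \<delta>" "\<rho> 0 = a \<and> \<rho> m = b"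
    "\<forall>h x. (\<Sum>i<n. h (\<tau> i) \<bullet> (x (\<tau> (Suc i)) - x (\<tau> i))) =
       (\<Sum>k<m. h (\<tau> (c k)) \<bullet> (x (\<rho> (Suc k)) - (x (\<rho> k) :: 'v)))"
    using single[OF \<tau>] by (auto simp: T_def)
  obtain c' where c': "\<forall>k<m. c' k < n' \<and> \<tau>' (c' k) \<le> \<rho> k \<and> \<rho> k < \<tau>' (c' k) + \<delta>"
    "\<forall>h x. (\<Sum>i<n'. h (\<tau>' i) \<bullet> (x (\<tau>' (Suc i)) - x (\<tau>' i))) =
       (\<Sum>k<m. h (\<tau>' (c' k)) \<bullet> (x (\<rho> (Suc k)) - (x (\<rho> k) :: 'v)))"
    using single[OF \<tau>'] by (auto simp: T_def)
  have "partition_on_interval a b m \<rho>"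
    using c(2) strict by (auto simp: partition_on_interval_def intro: less_imp_le)
  then show ?thesis
    using c(1,3) c' by - (rule exI[of _ m], rule exI[of _ \<rho>], rule exI[of _ c], rule exI[of _ c'], intro conjI)
qed

section \<open>Limits in probability along partitions\<close>

context prob_space
begin

text \<open>Convergence to 0 in probability along the net of partitions. Measurability of
  \<open>Z\<close> is left out so that \<open>Z\<close> may contain pathwise Lebesgue
  integrals.\<close>

definition mesh_small :: "real \<Rightarrow> real \<Rightarrow> (nat \<Rightarrow> (nat \<Rightarrow> real) \<Rightarrow> 'a \<Rightarrow> real) \<Rightarrow> bool" where
  "mesh_small a b Z \<longleftrightarrow> (\<forall>\<epsilon>>0. \<exists>\<delta>>0. \<forall>n \<tau>. fine_partition a b \<delta> n \<tau> \<longrightarrow> prob_bound \<epsilon> \<epsilon> (Z n \<tau>))"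

text \<open>Boundedness in probability, uniformly over fine partitions; its purpose is that a tight
  family times a small one is small.\<close>

definition mesh_tight :: "real \<Rightarrow> real \<Rightarrow> (nat \<Rightarrow> (nat \<Rightarrow> real) \<Rightarrow> 'a \<Rightarrow> real) \<Rightarrow> bool" where
  "mesh_tight a b Z \<longleftrightarrow> (\<forall>\<epsilon>>0. \<exists>K>0. \<exists>\<delta>>0. \<forall>n \<tau>. fine_partition a b \<delta> n \<tau> \<longrightarrow> prob_bound \<epsilon> K (Z n \<tau>))"

lemma mesh_small_AE_mono:
  assumes "mesh_small a b Z"
    and "\<And>n \<tau>. partition_on_interval a b n \<tau> \<Longrightarrow> AE \<omega> in M. \<bar>Z' n \<tau> \<omega>\<bar> \<le> \<bar>Z n \<tau> \<omega>\<bar>"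
  shows "mesh_small a b Z'"
  unfolding mesh_small_def
proof (intro allI impI)
  fix \<epsilon> :: real assume "\<epsilon> > 0"
  then obtain d where d: "d > 0" "\<And>n \<tau>. fine_partition a b d n \<tau> \<Longrightarrow> prob_bound \<epsilon> \<epsilon> (Z n \<tau>)"
    using assms(1) unfolding mesh_small_def by meson
  have "prob_bound \<epsilon> \<epsilon> (Z' n \<tau>)" if "fine_partition a b d n \<tau>" for n \<tau>
    by (rule prob_bound_AE_mono[OF d(2)[OF that] order_refl order_refl assms(2)])
       (use that in \<open>simp add: fine_partition_def\<close>)
  then show "\<exists>\<delta>>0. \<forall>n \<tau>. fine_partition a b \<delta> n \<tau> \<longrightarrow> prob_bound \<epsilon> \<epsilon> (Z' n \<tau>)"
    using d(1) by blast
qed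

lemma mesh_small_mono:
  assumes "mesh_small a b Z"
    and "\<And>n \<tau> \<omega>. partition_on_interval a b n \<tau> \<Longrightarrow> \<bar>Z' n \<tau> \<omega>\<bar> \<le> \<bar>Z n \<tau> \<omega>\<bar>"
  shows "mesh_small a b Z'"
  by (rule mesh_small_AE_mono[OF assms(1)]) (use assms(2) in auto)

lemma mesh_small_add:
  assumes "mesh_small a b Z" "mesh_small a b Z'"
  shows "mesh_small a b (\<lambda>n \<tau> \<omega>. Z n \<tau> \<omega> + Z' n \<tau> \<omega>)"
  unfolding mesh_small_def
proof (intro allI impI)
  fix \<epsilon> :: real assume "\<epsilon> > 0"
  then have "\<epsilon> / 2 > 0" by simp
  obtain d1 where d1: "d1 > 0" "\<And>n \<tau>. fine_partition a b d1 n \<tau> \<Longrightarrow> prob_bound (\<epsilon>/2) (\<epsilon>/2) (Z n \<tau>)"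
    using assms(1) \<open>\<epsilon> / 2 > 0\<close> unfolding mesh_small_def by meson
  obtain d2 where d2: "d2 > 0" "\<And>n \<tau>. fine_partition a b d2 n \<tau> \<Longrightarrow> prob_bound (\<epsilon>/2) (\<epsilon>/2) (Z' n \<tau>)"
    using assms(2) \<open>\<epsilon> / 2 > 0\<close> unfolding mesh_small_def by meson
  have "prob_bound \<epsilon> \<epsilon> (\<lambda>\<omega>. Z n \<tau> \<omega> + Z' n \<tau> \<omega>)" if "fine_partition a b (min d1 d2) n \<tau>" for n \<tau>
    using prob_bound_add[OF d1(2) d2(2), of n \<tau> n \<tau>] fine_partition_mono[OF that] by simp
  then show "\<exists>\<delta>>0. \<forall>n \<tau>. fine_partition a b \<delta> n \<tau> \<longrightarrow> prob_bound \<epsilon> \<epsilon> (\<lambda>\<omega>. Z n \<tau> \<omega> + Z' n \<tau> \<omega>)"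
    using d1(1) d2(1) by (intro exI[of _ "min d1 d2"]) auto
qed

lemma mesh_small_zero: "mesh_small a b (\<lambda>_ _ _. 0)"
  unfolding mesh_small_def by (auto intro!: prob_bound_zero exI[of _ 1])

lemma mesh_small_sum:
  assumes "finite I" "\<And>i. i \<in> I \<Longrightarrow> mesh_small a b (Z i)"
  shows "mesh_small a b (\<lambda>n \<tau> \<omega>. \<Sum>i\<in>I. Z i n \<tau> \<omega>)"
  using assms by (induction I rule: finite_induct) (auto intro: mesh_small_zero mesh_small_add)

text \<open>The dominating family \<open>Z'\<close> may depend on \<open>\<epsilon>\<close>:
  typically its weights are cut off at a level that the path exceeds only with probability below
  \<open>\<epsilon>\<close>.\<close>

lemma mesh_small_localize:
  assumes "\<And>\<epsilon>. \<epsilon> > 0 \<Longrightarrow> \<exists>A\<in>events. \<exists>Z'. prob A < \<epsilon> \<and> mesh_small a b Z' \<and>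
    (\<forall>n \<tau>. partition_on_interval a b n \<tau> \<longrightarrow> (\<forall>\<omega>\<in>space M - A. \<bar>Z n \<tau> \<omega>\<bar> \<le> \<bar>Z' n \<tau> \<omega>\<bar>))"
  shows "mesh_small a b Z"
  unfolding mesh_small_def
proof (intro allI impI)
  fix \<epsilon> :: real assume "\<epsilon> > 0"
  then have "\<epsilon> / 2 > 0" by simp
  obtain A Z' where A: "A \<in> events" "prob A < \<epsilon> / 2" "mesh_small a b Z'"
    "\<And>n \<tau> \<omega>. partition_on_interval a b n \<tau> \<Longrightarrow> \<omega> \<in> space M \<Longrightarrow> \<omega> \<notin> A \<Longrightarrow> \<bar>Z n \<tau> \<omega>\<bar> \<le> \<bar>Z' n \<tau> \<omega>\<bar>"
    using assms[OF \<open>\<epsilon> / 2 > 0\<close>] by (meson DiffI)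
  obtain d where d: "d > 0" "\<And>n \<tau>. fine_partition a b d n \<tau> \<Longrightarrow> prob_bound (\<epsilon>/2) (\<epsilon>/2) (Z' n \<tau>)"
    using A(3) \<open>\<epsilon> / 2 > 0\<close> unfolding mesh_small_def by meson
  have "prob_bound \<epsilon> \<epsilon> (Z n \<tau>)" if "fine_partition a b d n \<tau>" for n \<tau>
  proof -
    have "prob_bound (\<epsilon>/2 + \<epsilon>/2) (\<epsilon>/2) (Z n \<tau>)"
      using that by (intro prob_bound_localize[OF d(2)[OF that] A(1,2)] A(4)) (simp_all add: fine_partition_def)
    then show ?thesis
      by (rule prob_bound_mono) (use \<open>\<epsilon> > 0\<close> in auto)
  qed
  then show "\<exists>\<delta>>0. \<forall>n \<tau>. fine_partition a b \<delta> n \<tau> \<longrightarrow> prob_bound \<epsilon> \<epsilon> (Z n \<tau>)"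
    using d(1) by blast
qed

lemma mesh_tight_mult_small:
  assumes "mesh_tight a b Z" "mesh_small a b Z'"
  shows "mesh_small a b (\<lambda>n \<tau> \<omega>. Z n \<tau> \<omega> * Z' n \<tau> \<omega>)"
  unfolding mesh_small_def
proof (intro allI impI)
  fix \<epsilon> :: real assume "\<epsilon> > 0"
  then have "\<epsilon> / 2 > 0" by simp
  obtain K d1 where d1: "K > 0" "d1 > 0" "\<And>n \<tau>. fine_partition a b d1 n \<tau> \<Longrightarrow> prob_bound (\<epsilon>/2) K (Z n \<tau>)"
    using assms(1) \<open>\<epsilon> / 2 > 0\<close> unfolding mesh_tight_def by meson
  \<comment> \<open>The first entry controls the probabilities, the second gives
    \<open>K * e \<le> \<epsilon>\<close> for the size of the product.\<close>
  define e where "e = min (\<epsilon> / 2) (\<epsilon> / K)"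
  have e: "e > 0" "e \<le> \<epsilon> / 2" "e \<le> \<epsilon> / K"
    using min.cobounded1[of "\<epsilon> / 2" "\<epsilon> / K", folded e_def] \<open>\<epsilon> > 0\<close> d1(1)
    by (simp_all add: e_def)
  then have Ke: "K * e \<le> \<epsilon>"
    using d1(1) by (simp add: field_simps)
  obtain d2 where d2: "d2 > 0" "\<And>n \<tau>. fine_partition a b d2 n \<tau> \<Longrightarrow> prob_bound e e (Z' n \<tau>)"
    using assms(2) e(1) unfolding mesh_small_def by meson
  have "prob_bound \<epsilon> \<epsilon> (\<lambda>\<omega>. Z n \<tau> \<omega> * Z' n \<tau> \<omega>)" if "fine_partition a b (min d1 d2) n \<tau>" for n \<tau>
    by (rule prob_bound_mono[OF prob_bound_mult[OF d1(3) d2(2)]])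
       (use fine_partition_mono[OF that] e Ke in auto)
  then show "\<exists>\<delta>>0. \<forall>n \<tau>. fine_partition a b \<delta> n \<tau> \<longrightarrow> prob_bound \<epsilon> \<epsilon> (\<lambda>\<omega>. Z n \<tau> \<omega> * Z' n \<tau> \<omega>)"
    using d1(2) d2(1) by (intro exI[of _ "min d1 d2"]) auto
qed

lemma mesh_small_imp_tight:
  assumes "mesh_small a b Z"
  shows "mesh_tight a b Z"
  using assms unfolding mesh_small_def mesh_tight_def by blast

lemma mesh_tight_const:
  assumes "\<And>n \<tau>. Z n \<tau> = Y" "Y \<in> borel_measurable M"
  shows "mesh_tight a b Z"
  using random_variable_tight[OF assms(2)] assms(1) unfolding mesh_tight_def by (metis zero_less_one)

lemma mesh_small_scale:
  assumes "mesh_small a b Z"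
  shows "mesh_small a b (\<lambda>n \<tau> \<omega>. c * Z n \<tau> \<omega>)"
  by (rule mesh_tight_mult_small[OF mesh_tight_const assms, of _ "\<lambda>_. c"]) auto

lemma mesh_tight_add:
  assumes "mesh_tight a b Z" "mesh_tight a b Z'"
  shows "mesh_tight a b (\<lambda>n \<tau> \<omega>. Z n \<tau> \<omega> + Z' n \<tau> \<omega>)"
  unfolding mesh_tight_def
proof (intro allI impI)
  fix \<epsilon> :: real assume "\<epsilon> > 0"
  then have "\<epsilon> / 2 > 0" by simp
  obtain K1 d1 where d1: "K1 > 0" "d1 > 0" "\<And>n \<tau>. fine_partition a b d1 n \<tau> \<Longrightarrow> prob_bound (\<epsilon>/2) K1 (Z n \<tau>)"
    using assms(1) \<open>\<epsilon> / 2 > 0\<close> unfolding mesh_tight_def by meson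
  obtain K2 d2 where d2: "K2 > 0" "d2 > 0" "\<And>n \<tau>. fine_partition a b d2 n \<tau> \<Longrightarrow> prob_bound (\<epsilon>/2) K2 (Z' n \<tau>)"
    using assms(2) \<open>\<epsilon> / 2 > 0\<close> unfolding mesh_tight_def by meson
  have "prob_bound \<epsilon> (K1 + K2) (\<lambda>\<omega>. Z n \<tau> \<omega> + Z' n \<tau> \<omega>)" if "fine_partition a b (min d1 d2) n \<tau>" for n \<tau>
    using prob_bound_add[OF d1(3) d2(3), of n \<tau> n \<tau>] fine_partition_mono[OF that] by simp
  then show "\<exists>K>0. \<exists>\<delta>>0. \<forall>n \<tau>. fine_partition a b \<delta> n \<tau> \<longrightarrow> prob_bound \<epsilon> K (\<lambda>\<omega>. Z n \<tau> \<omega> + Z' n \<tau> \<omega>)"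
    using d1(1,2) d2(1,2) by (intro exI[of _ "K1 + K2"] exI[of _ "min d1 d2"] conjI) auto
qed

lemma mesh_tight_mono:
  assumes "mesh_tight a b Z"
    and "\<And>n \<tau> \<omega>. partition_on_interval a b n \<tau> \<Longrightarrow> \<bar>Z' n \<tau> \<omega>\<bar> \<le> c * \<bar>Z n \<tau> \<omega>\<bar>" "c > 0"
  shows "mesh_tight a b Z'"
  unfolding mesh_tight_def
proof (intro allI impI)
  fix \<epsilon> :: real assume "\<epsilon> > 0"
  then obtain K d where d: "K > 0" "d > 0" "\<And>n \<tau>. fine_partition a b d n \<tau> \<Longrightarrow> prob_bound \<epsilon> K (Z n \<tau>)"
    using assms(1) unfolding mesh_tight_def by meson
  have "prob_bound \<epsilon> (c * K) (Z' n \<tau>)" if fp: "fine_partition a b d n \<tau>" for n \<tau>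
  proof -
    obtain A where A: "A \<in> events" "prob A < \<epsilon>" "\<And>\<omega>. \<omega> \<in> space M \<Longrightarrow> \<omega> \<notin> A \<Longrightarrow> \<bar>Z n \<tau> \<omega>\<bar> \<le> K"
      using prob_boundE[OF d(3)[OF fp]] by blast
    show ?thesis
    proof (rule prob_boundI[OF A(1,2)])
      fix \<omega> assume "\<omega> \<in> space M" "\<omega> \<notin> A"
      then have "c * \<bar>Z n \<tau> \<omega>\<bar> \<le> c * K"
        using A(3) assms(3) by (intro mult_left_mono) auto
      then show "\<bar>Z' n \<tau> \<omega>\<bar> \<le> c * K"
        using assms(2)[of n \<tau> \<omega>] fp by (simp add: fine_partition_def)
    qed
  qed
  then show "\<exists>K>0. \<exists>\<delta>>0. \<forall>n \<tau>. fine_partition a b \<delta> n \<tau> \<longrightarrow> prob_bound \<epsilon> K (Z' n \<tau>)"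
    using d(1,2) assms(3) by (intro exI[of _ "c * K"] exI[of _ d] conjI) auto
qed

section \<open>Limits along partitions: uniqueness, linearity, reversal, completeness\<close>

lemma mesh_limitI:
  assumes "I \<in> borel_measurable M"
    and "\<And>n \<tau>. partition_on_interval a b n \<tau> \<Longrightarrow> S n \<tau> \<in> borel_measurable M"
    and "mesh_small a b (\<lambda>n \<tau> \<omega>. dist (S n \<tau> \<omega>) (I \<omega>))"
  shows "mesh_limit_in_prob M a b S I"
  unfolding mesh_limit_in_prob_def
proof (intro conjI allI impI assms(1))
  fix \<epsilon> :: real assume "\<epsilon> > 0"
  then obtain \<delta> where \<delta>: "\<delta> > 0" "\<And>n \<tau>. fine_partition a b \<delta> n \<tau> \<Longrightarrow> prob_bound \<epsilon> \<epsilon> (\<lambda>\<omega>. dist (S n \<tau> \<omega>) (I \<omega>))"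
    using assms(3) unfolding mesh_small_def by meson
  show "\<exists>\<delta>>0. \<forall>n \<tau>. partition_on_interval a b n \<tau> \<and> (\<forall>i<n. \<tau> (Suc i) - \<tau> i < \<delta>) \<longrightarrow>
    S n \<tau> \<in> borel_measurable M \<and> prob {\<omega> \<in> space M. \<epsilon> < dist (S n \<tau> \<omega>) (I \<omega>)} < \<epsilon>"
  proof (intro exI[of _ \<delta>] conjI allI impI \<delta>(1))
    fix n \<tau> assume *: "partition_on_interval a b n \<tau> \<and> (\<forall>i<n. \<tau> (Suc i) - \<tau> i < \<delta>)"
    then show "S n \<tau> \<in> borel_measurable M"
      using assms(2) by blast
    obtain A where A: "A \<in> events" "prob A < \<epsilon>"
      "\<And>\<omega>. \<omega> \<in> space M \<Longrightarrow> \<omega> \<notin> A \<Longrightarrow> \<bar>dist (S n \<tau> \<omega>) (I \<omega>)\<bar> \<le> \<epsilon>"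
      using prob_boundE[OF \<delta>(2)] * by (metis fine_partition_def)
    have "{\<omega> \<in> space M. \<epsilon> < dist (S n \<tau> \<omega>) (I \<omega>)} \<subseteq> A"
      using A(3) by force
    from finite_measure_mono[OF this A(1)] A(2)
    show "prob {\<omega> \<in> space M. \<epsilon> < dist (S n \<tau> \<omega>) (I \<omega>)} < \<epsilon>" by simp
  qed
qed

lemma mesh_limitD:
  assumes "mesh_limit_in_prob M a b S I"
  shows "mesh_small a b (\<lambda>n \<tau> \<omega>. dist (S n \<tau> \<omega>) (I \<omega>))"
  unfolding mesh_small_def
proof (intro allI impI)
  fix \<epsilon> :: real assume "\<epsilon> > 0"
  then obtain \<delta> where \<delta>: "\<delta> > 0" "\<And>n \<tau>. fine_partition a b \<delta> n \<tau> \<Longrightarrow>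
      S n \<tau> \<in> borel_measurable M \<and> prob {\<omega> \<in> space M. dist (S n \<tau> \<omega>) (I \<omega>) > \<epsilon>} < \<epsilon>"
    using assms unfolding mesh_limit_in_prob_def fine_partition_def by blast
  have [measurable]: "I \<in> borel_measurable M"
    using assms by (auto simp: mesh_limit_in_prob_def)
  have "prob_bound \<epsilon> \<epsilon> (\<lambda>\<omega>. dist (S n \<tau> \<omega>) (I \<omega>))" if "fine_partition a b \<delta> n \<tau>" for n \<tau>
  proof (rule prob_boundI)
    have [measurable]: "S n \<tau> \<in> borel_measurable M"
      using \<delta>(2)[OF that] by simp
    show "{\<omega> \<in> space M. dist (S n \<tau> \<omega>) (I \<omega>) > \<epsilon>} \<in> events"
      by measurable
  qed (use \<delta>(2)[OF that] in auto)
  then show "\<exists>\<delta>>0. \<forall>n \<tau>. fine_partition a b \<delta> n \<tau> \<longrightarrow> prob_bound \<epsilon> \<epsilon> (\<lambda>\<omega>. dist (S n \<tau> \<omega>) (I \<omega>))"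
    using \<delta>(1) by blast
qed

text \<open>\<open>J\<close> need not be measurable, which allows a limit to be identified with a
  pathwise integral. The condition \<open>a \<le> b\<close> guarantees that fine partitions exist,
  so that smallness is not vacuous.\<close>

lemma mesh_limit_AE_eq:
  assumes I: "mesh_limit_in_prob M a b S I" and "a \<le> b"
    and J: "mesh_small a b (\<lambda>n \<tau> \<omega>. dist (S n \<tau> \<omega>) (J \<omega>))"
  shows "AE \<omega> in M. I \<omega> = J \<omega>"
proof -
  have small: "mesh_small a b (\<lambda>n \<tau> \<omega>. dist (I \<omega>) (J \<omega>))"
    by (rule mesh_small_mono[OF mesh_small_add[OF mesh_limitD[OF I] J]]) (simp add: dist_triangle3)
  have "prob_bound \<epsilon> \<epsilon> (\<lambda>\<omega>. dist (I \<omega>) (J \<omega>))" if "\<epsilon> > 0" for \<epsilon>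
    using small ex_fine_partition[OF \<open>a \<le> b\<close>] that unfolding mesh_small_def by meson
  then have "AE \<omega> in M. dist (I \<omega>) (J \<omega>) = 0"
    by (rule prob_bound_all_imp_AE_zero)
  then show ?thesis by simp
qed

lemma mesh_limit_unique:
  assumes "mesh_limit_in_prob M a b S I" "mesh_limit_in_prob M a b S J" "a \<le> b"
  shows "AE \<omega> in M. I \<omega> = J \<omega>"
  by (rule mesh_limit_AE_eq[OF assms(1,3) mesh_limitD[OF assms(2)]])

text \<open>Measurability of \<open>U\<close> is a separate hypothesis because the limits supply it
  for \<open>S\<close> and \<open>T\<close> on fine partitions only.\<close>

lemma mesh_limit_add_scale:
  fixes S T :: "nat \<Rightarrow> (nat \<Rightarrow> real) \<Rightarrow> 'a \<Rightarrow> real"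
  assumes S: "mesh_limit_in_prob M a b S I" and T: "mesh_limit_in_prob M a b T J"
    and meas: "\<And>n \<tau>. partition_on_interval a b n \<tau> \<Longrightarrow> U n \<tau> \<in> borel_measurable M"
    and U: "\<And>n \<tau> \<omega>. partition_on_interval a b n \<tau> \<Longrightarrow> U n \<tau> \<omega> = S n \<tau> \<omega> + c * T n \<tau> \<omega>"
  shows "mesh_limit_in_prob M a b U (\<lambda>\<omega>. I \<omega> + c * J \<omega>)"
proof (rule mesh_limitI[OF _ meas])
  show "(\<lambda>\<omega>. I \<omega> + c * J \<omega>) \<in> borel_measurable M"
    using S T by (auto simp: mesh_limit_in_prob_def)
  have "mesh_small a b (\<lambda>n \<tau> \<omega>. dist (S n \<tau> \<omega>) (I \<omega>) + \<bar>c\<bar> * dist (T n \<tau> \<omega>) (J \<omega>))"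
    by (intro mesh_small_add mesh_small_scale mesh_limitD S T)
  then show "mesh_small a b (\<lambda>n \<tau> \<omega>. dist (U n \<tau> \<omega>) (I \<omega> + c * J \<omega>))"
  proof (rule mesh_small_mono)
    fix n \<tau> \<omega> assume "partition_on_interval a b n \<tau>"
    then have "U n \<tau> \<omega> - (I \<omega> + c * J \<omega>) = (S n \<tau> \<omega> - I \<omega>) + c * (T n \<tau> \<omega> - J \<omega>)"
      using U by (simp add: algebra_simps)
    then show "\<bar>dist (U n \<tau> \<omega>) (I \<omega> + c * J \<omega>)\<bar> \<le> \<bar>dist (S n \<tau> \<omega>) (I \<omega>) + \<bar>c\<bar> * dist (T n \<tau> \<omega>) (J \<omega>)\<bar>"
      using abs_triangle_ineq[of "S n \<tau> \<omega> - I \<omega>" "c * (T n \<tau> \<omega> - J \<omega>)"]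
      by (simp add: dist_real_def abs_mult)
  qed
qed

lemma mesh_limit_cong:
  assumes "mesh_limit_in_prob M a b S I"
    and "\<And>n \<tau> \<omega>. partition_on_interval a b n \<tau> \<Longrightarrow> T n \<tau> \<omega> = S n \<tau> \<omega>"
  shows "mesh_limit_in_prob M a b T I"
proof -
  have "T n \<tau> = S n \<tau>" if "partition_on_interval a b n \<tau>" for n \<tau>
    using assms(2)[OF that] by blast
  then show ?thesis
    using assms(1) unfolding mesh_limit_in_prob_def by simp
qed

lemma mesh_limit_reverse:
  assumes "mesh_limit_in_prob M a b S I"
  shows "mesh_limit_in_prob M (1 - b) (1 - a) (\<lambda>n \<tau>. S n (\<lambda>j. 1 - \<tau> (n - j))) I"
  unfolding mesh_limit_in_prob_def
proof (intro conjI allI impI)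
  show "I \<in> borel_measurable M"
    using assms by (simp add: mesh_limit_in_prob_def)
  fix \<epsilon> :: real assume "\<epsilon> > 0"
  then obtain \<delta> where \<delta>: "\<delta> > 0" "\<And>n \<tau>. partition_on_interval a b n \<tau> \<and> (\<forall>i<n. \<tau> (Suc i) - \<tau> i < \<delta>) \<Longrightarrow>
      S n \<tau> \<in> borel_measurable M \<and> prob {\<omega> \<in> space M. dist (S n \<tau> \<omega>) (I \<omega>) > \<epsilon>} < \<epsilon>"
    using assms unfolding mesh_limit_in_prob_def by blast
  have "S n (\<lambda>j. 1 - \<tau> (n - j)) \<in> borel_measurable M \<and>
      prob {\<omega> \<in> space M. dist (S n (\<lambda>j. 1 - \<tau> (n - j)) \<omega>) (I \<omega>) > \<epsilon>} < \<epsilon>"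
    if *: "partition_on_interval (1 - b) (1 - a) n \<tau> \<and> (\<forall>i<n. \<tau> (Suc i) - \<tau> i < \<delta>)" for n \<tau>
  proof (rule \<delta>(2), intro conjI allI impI)
    \<comment> \<open>Cell \<open>i\<close> of the reflected partition is cell
      \<open>n - Suc i\<close> of the original one, traversed backwards.\<close>
    have step: "Suc (n - Suc i) = n - i" if "i < n" for i
      using that by simp
    show "partition_on_interval a b n (\<lambda>j. 1 - \<tau> (n - j))"
      unfolding partition_on_interval_def
    proof (intro conjI allI impI)
      fix i assume "i < n"
      then show "1 - \<tau> (n - i) \<le> 1 - \<tau> (n - Suc i)"
        using * step[of i] by (auto simp: partition_on_interval_def dest!: spec[of _ "n - Suc i"])
    qed (use * in \<open>auto simp: partition_on_interval_def\<close>)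
    fix i assume "i < n"
    then show "1 - \<tau> (n - Suc i) - (1 - \<tau> (n - i)) < \<delta>"
      using conjunct2[OF *, THEN spec, of "n - Suc i"] step[of i] by simp
  qed
  then show "\<exists>\<delta>>0. \<forall>n \<tau>. partition_on_interval (1 - b) (1 - a) n \<tau> \<and> (\<forall>i<n. \<tau> (Suc i) - \<tau> i < \<delta>) \<longrightarrow>
      S n (\<lambda>j. 1 - \<tau> (n - j)) \<in> borel_measurable M \<and>
      prob {\<omega> \<in> space M. \<epsilon> < dist (S n (\<lambda>j. 1 - \<tau> (n - j)) \<omega>) (I \<omega>)} < \<epsilon>"
    using \<delta>(1) by blast
qed

text \<open>Completeness of convergence in probability. One sequence of partitions with tolerances
  \<open>(1/2) ^ k\<close> gives sums that converge off events of summable probability; the Cauchy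
  hypothesis then compares every fine partition with this sequence.\<close>

lemma mesh_limit_Cauchy:
  fixes S :: "nat \<Rightarrow> (nat \<Rightarrow> real) \<Rightarrow> 'a \<Rightarrow> 'c::euclidean_space"
  assumes "a \<le> b" and meas: "\<And>n \<tau>. partition_on_interval a b n \<tau> \<Longrightarrow> S n \<tau> \<in> borel_measurable M"
    and Cauchy: "\<And>\<epsilon>. \<epsilon> > 0 \<Longrightarrow> \<exists>\<delta>>0. \<forall>n \<tau> n' \<tau>'. fine_partition a b \<delta> n \<tau> \<longrightarrow> fine_partition a b \<delta> n' \<tau>' \<longrightarrow>
      prob_bound \<epsilon> \<epsilon> (\<lambda>\<omega>. dist (S n \<tau> \<omega>) (S n' \<tau>' \<omega>))"
  shows "\<exists>I. mesh_limit_in_prob M a b S I"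
proof -
  define e where "e k = (1/2::real) ^ k" for k
  have e_pos: "e k > 0" for k by (simp add: e_def)
  have "\<forall>k. \<exists>\<delta>>0. \<forall>n \<tau> n' \<tau>'. fine_partition a b \<delta> n \<tau> \<longrightarrow> fine_partition a b \<delta> n' \<tau>' \<longrightarrow>
      prob_bound (e k) (e k) (\<lambda>\<omega>. dist (S n \<tau> \<omega>) (S n' \<tau>' \<omega>))"
    using Cauchy e_pos by blast
  then obtain d where d: "\<And>k. d k > 0" "\<And>k n \<tau> n' \<tau>'. fine_partition a b (d k) n \<tau> \<Longrightarrow> fine_partition a b (d k) n' \<tau>' \<Longrightarrow>
      prob_bound (e k) (e k) (\<lambda>\<omega>. dist (S n \<tau> \<omega>) (S n' \<tau>' \<omega>))"
    by metis
  \<comment> \<open>Running minimum: the \<open>k\<close>-th partition is fine for all tolerances up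
    to \<open>k\<close>, so \<open>s k\<close> and \<open>s (Suc k)\<close> can both be compared at
    level \<open>k\<close>.\<close>
  define dm where "dm k = Min (d ` {..k})" for k
  have dm: "dm k > 0" "j \<le> k \<Longrightarrow> dm k \<le> d j" for j k
    using d(1) by (auto simp: dm_def)
  have "\<forall>k. \<exists>n \<tau>. fine_partition a b (dm k) n \<tau>"
    using ex_fine_partition[OF assms(1)] dm(1) by blast
  then obtain N \<theta> where \<theta>: "\<And>k. fine_partition a b (dm k) (N k) (\<theta> k)"
    by metis
  have fp: "fine_partition a b (d j) (N k) (\<theta> k)" if "j \<le> k" for j k
    using fine_partition_mono[OF \<theta> dm(2)[OF that]] .
  define s where "s k = S (N k) (\<theta> k)" for k
  have s_meas [measurable]: "s k \<in> borel_measurable M" for k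
    unfolding s_def using meas fp[of k k] by (simp add: fine_partition_def)
  have "\<forall>k. \<exists>A. A \<in> events \<and> prob A < e k \<and> (\<forall>\<omega>\<in>space M - A. dist (s k \<omega>) (s (Suc k) \<omega>) \<le> e k)"
  proof
    fix k
    have "prob_bound (e k) (e k) (\<lambda>\<omega>. dist (s k \<omega>) (s (Suc k) \<omega>))"
      unfolding s_def by (intro d(2) fp) auto
    then show "\<exists>A. A \<in> events \<and> prob A < e k \<and> (\<forall>\<omega>\<in>space M - A. dist (s k \<omega>) (s (Suc k) \<omega>) \<le> e k)"
      by (rule prob_boundE) auto
  qed
  then obtain A where A: "\<And>k. A k \<in> events" "\<And>k. prob (A k) < e k"
    "\<And>k \<omega>. \<omega> \<in> space M \<Longrightarrow> \<omega> \<notin> A k \<Longrightarrow> dist (s k \<omega>) (s (Suc k) \<omega>) \<le> e k"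
    by (metis DiffI)
  \<comment> \<open>\<open>lim\<close> is total and yields a measurable function; its value matters
    only where the sequence converges, which is the case outside any single
    \<open>B k\<close>.\<close>
  define I where "I \<omega> = lim (\<lambda>k. s k \<omega>)" for \<omega>
  have [measurable]: "I \<in> borel_measurable M"
    unfolding I_def by measurable
  define B where "B k = (\<Union>j. A (j + k))" for k
  have B: "B k \<in> events" for k
    using A(1) by (auto simp: B_def)
  have e_shift: "e (j + k) = e k * (1/2) ^ j" for j k
    by (simp add: e_def power_add)
  have sum_e: "summable (\<lambda>j. e (j + k))" "(\<Sum>j. e (j + k)) = 2 * e k" for k
    unfolding e_shift by (auto intro!: summable_mult simp: suminf_mult suminf_geometric)
  have prob_B: "prob (B k) \<le> 2 * e k" for k
  proof -
    have summ: "summable (\<lambda>j. prob (A (j + k)))"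
      by (rule summable_comparison_test'[OF sum_e(1)[of k]]) (use A(2) in \<open>auto intro: less_imp_le\<close>)
    have "prob (B k) \<le> (\<Sum>j. prob (A (j + k)))"
      unfolding B_def using A(1) summ by (intro finite_measure_subadditive_countably) auto
    also have "\<dots> \<le> (\<Sum>j. e (j + k))"
      using summ sum_e(1) A(2) by (intro suminf_le) (auto intro: less_imp_le)
    finally show ?thesis by (simp add: sum_e)
  qed
  have off_B: "dist (s k \<omega>) (I \<omega>) \<le> 2 * e k" if "\<omega> \<in> space M" "\<omega> \<notin> B k" for k \<omega>
  proof -
    have step: "dist (s j \<omega>) (s (Suc j) \<omega>) \<le> e j" if "j \<ge> k" for j
      using A(3)[of \<omega> j] \<open>\<omega> \<in> space M\<close> \<open>\<omega> \<notin> B k\<close> that unfolding B_def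
      by (metis UNIV_I UN_I le_add_diff_inverse2)
    \<comment> \<open>The difference form makes the induction on \<open>j\<close> close exactly, as
      \<open>2 * e (i + Suc j) = e (i + j)\<close>.\<close>
    have bd: "dist (s i \<omega>) (s (i + j) \<omega>) \<le> 2 * e i - 2 * e (i + j)" if "i \<ge> k" for i j
    proof (induction j)
      case (Suc j)
      have "dist (s i \<omega>) (s (i + Suc j) \<omega>) \<le> dist (s i \<omega>) (s (i + j) \<omega>) + dist (s (i + j) \<omega>) (s (i + Suc j) \<omega>)"
        by (rule dist_triangle)
      also have "\<dots> \<le> (2 * e i - 2 * e (i + j)) + e (i + j)"
        using Suc step[of "i + j"] that by simp
      also have "\<dots> = 2 * e i - 2 * e (i + Suc j)"
        by (simp add: e_def)
      finally show ?case .
    qed simp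
    have bd': "dist (s i \<omega>) (s l \<omega>) \<le> 2 * e i" if "i \<ge> k" "l \<ge> i" for i l
      using bd[OF that(1), of "l - i"] that(2) e_pos[of l] by simp
    have "Cauchy (\<lambda>j. s j \<omega>)"
    proof (rule metric_CauchyI)
      fix r :: real assume "r > 0"
      obtain i where i: "(1/2) ^ i < r / 4"
        using real_arch_pow_inv[of "r / 4" "1/2"] \<open>r > 0\<close> by auto
      define q where "q = max i k"
      have "e q \<le> e i"
        unfolding e_def q_def by (rule power_decreasing) auto
      moreover have "e i < r / 4"
        using i by (simp add: e_def)
      ultimately have q: "4 * e q < r" "q \<ge> k"
        by (auto simp: q_def)
      show "\<exists>q. \<forall>m\<ge>q. \<forall>n\<ge>q. dist (s m \<omega>) (s n \<omega>) < r"
      proof (intro exI[of _ q] allI impI)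
        fix m n assume "q \<le> m" "q \<le> n"
        then show "dist (s m \<omega>) (s n \<omega>) < r"
          using bd'[OF q(2), of m] bd'[OF q(2), of n] q(1) dist_triangle3[of "s m \<omega>" "s n \<omega>" "s q \<omega>"] by linarith
      qed
    qed
    then have lim: "(\<lambda>j. s j \<omega>) \<longlonglongrightarrow> I \<omega>"
      unfolding I_def using Cauchy_convergent convergent_LIMSEQ_iff by blast
    show ?thesis
    proof (rule tendsto_upperbound)
      show "(\<lambda>j. dist (s k \<omega>) (s j \<omega>)) \<longlonglongrightarrow> dist (s k \<omega>) (I \<omega>)"
        by (intro tendsto_intros lim)
      show "eventually (\<lambda>j. dist (s k \<omega>) (s j \<omega>) \<le> 2 * e k) sequentially"
        using bd'[of k] by (auto simp: eventually_sequentially)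
    qed simp
  qed
  have "mesh_small a b (\<lambda>n \<tau> \<omega>. dist (S n \<tau> \<omega>) (I \<omega>))"
    unfolding mesh_small_def
  proof (intro allI impI)
    fix \<epsilon> :: real assume "\<epsilon> > 0"
    obtain k where "(1/2) ^ k < \<epsilon> / 4"
      using real_arch_pow_inv[of "\<epsilon> / 4" "1/2"] \<open>\<epsilon> > 0\<close> by auto
    then have k: "4 * e k < \<epsilon>"
      by (simp add: e_def)
    \<comment> \<open>\<open>prob_B\<close> is a weak inequality, so \<open>3 * e k\<close> is taken
      for the probability; with the further \<open>e k\<close> from \<open>d\<close> this explains
      \<open>4 * e k < \<epsilon>\<close>.\<close>
    have "prob_bound (3 * e k) (2 * e k) (\<lambda>\<omega>. dist (s k \<omega>) (I \<omega>))"
      by (rule prob_boundI[OF B[of k]]) (use prob_B[of k] e_pos[of k] off_B in auto)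
    then have "prob_bound (e k + 3 * e k) (e k + 2 * e k) (\<lambda>\<omega>. dist (S n \<tau> \<omega>) (s k \<omega>) + dist (s k \<omega>) (I \<omega>))"
      if "fine_partition a b (d k) n \<tau>" for n \<tau>
      unfolding s_def using that by (intro prob_bound_add d(2) fp) auto
    then have "prob_bound \<epsilon> \<epsilon> (\<lambda>\<omega>. dist (S n \<tau> \<omega>) (I \<omega>))" if "fine_partition a b (d k) n \<tau>" for n \<tau>
      by (rule prob_bound_AE_mono) (use that k e_pos[of k] in \<open>auto simp: dist_triangle\<close>)
    then show "\<exists>\<delta>>0. \<forall>n \<tau>. fine_partition a b \<delta> n \<tau> \<longrightarrow> prob_bound \<epsilon> \<epsilon> (\<lambda>\<omega>. dist (S n \<tau> \<omega>) (I \<omega>))"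
      using d(1) by blast
  qed
  then have "mesh_limit_in_prob M a b S I"
    by (intro mesh_limitI meas) auto
  then show ?thesis by blast
qed

text \<open>Smallness of the distance to \<open>J\<close> gives the Cauchy condition by the triangle
  inequality; the resulting measurable limit is identified with the possibly nonmeasurable
  \<open>J\<close> by uniqueness.\<close>

lemma mesh_limit_version:
  fixes S :: "nat \<Rightarrow> (nat \<Rightarrow> real) \<Rightarrow> 'a \<Rightarrow> 'c::euclidean_space"
  assumes "a \<le> b" and meas: "\<And>n \<tau>. partition_on_interval a b n \<tau> \<Longrightarrow> S n \<tau> \<in> borel_measurable M"
    and J: "mesh_small a b (\<lambda>n \<tau> \<omega>. dist (S n \<tau> \<omega>) (J \<omega>))"
  shows "\<exists>I. mesh_limit_in_prob M a b S I \<and> (AE \<omega> in M. I \<omega> = J \<omega>)"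
proof -
  have "\<exists>I. mesh_limit_in_prob M a b S I"
  proof (rule mesh_limit_Cauchy[OF assms(1) meas])
    fix \<epsilon> :: real assume "\<epsilon> > 0"
    then obtain d where d: "d > 0" "\<And>n \<tau>. fine_partition a b d n \<tau> \<Longrightarrow> prob_bound (\<epsilon>/2) (\<epsilon>/2) (\<lambda>\<omega>. dist (S n \<tau> \<omega>) (J \<omega>))"
      using J unfolding mesh_small_def by (meson half_gt_zero)
    have "prob_bound \<epsilon> \<epsilon> (\<lambda>\<omega>. dist (S n \<tau> \<omega>) (S n' \<tau>' \<omega>))"
      if "fine_partition a b d n \<tau>" "fine_partition a b d n' \<tau>'" for n \<tau> n' \<tau>'
      by (rule prob_bound_AE_mono[OF prob_bound_add[OF d(2)[OF that(1)] d(2)[OF that(2)]]])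
        (auto simp: dist_triangle2)
    then show "\<exists>\<delta>>0. \<forall>n \<tau> n' \<tau>'. fine_partition a b \<delta> n \<tau> \<longrightarrow> fine_partition a b \<delta> n' \<tau>' \<longrightarrow>
        prob_bound \<epsilon> \<epsilon> (\<lambda>\<omega>. dist (S n \<tau> \<omega>) (S n' \<tau>' \<omega>))"
      using d(1) by blast
  qed
  then show ?thesis
    using mesh_limit_AE_eq[OF _ assms(1) J] by blast
qed

end

section \<open>Square integrable martingale differences\<close>

context prob_space
begin

text \<open>\<open>\<Theta>\<close> has conditional mean 0 and conditional second moment at most \<open>v\<close> given \<open>G\<close>. Unlike
  independence of \<open>G\<close>, this is visibly inherited by sums of consecutive differences.\<close>

definition mart_diff :: "'a measure \<Rightarrow> ('a \<Rightarrow> real) \<Rightarrow> real \<Rightarrow> bool" where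
  "mart_diff G \<Theta> v \<longleftrightarrow> \<Theta> \<in> borel_measurable M \<and> 0 \<le> v \<and>
    (\<forall>\<xi>\<in>borel_measurable G. integrable M \<xi> \<longrightarrow>
       integrable M (\<lambda>\<omega>. \<xi> \<omega> * \<Theta> \<omega>) \<and> expectation (\<lambda>\<omega>. \<xi> \<omega> * \<Theta> \<omega>) = 0 \<and>
       ((\<forall>\<omega>. 0 \<le> \<xi> \<omega>) \<longrightarrow> integrable M (\<lambda>\<omega>. \<xi> \<omega> * (\<Theta> \<omega>)\<^sup>2) \<and>
          expectation (\<lambda>\<omega>. \<xi> \<omega> * (\<Theta> \<omega>)\<^sup>2) \<le> v * expectation \<xi>))"

lemma mart_diffD:
  assumes "mart_diff G \<Theta> v"
  shows "\<Theta> \<in> borel_measurable M" "0 \<le> v"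
    and "\<xi> \<in> borel_measurable G \<Longrightarrow> integrable M \<xi> \<Longrightarrow> integrable M (\<lambda>\<omega>. \<xi> \<omega> * \<Theta> \<omega>)"
    and "\<xi> \<in> borel_measurable G \<Longrightarrow> integrable M \<xi> \<Longrightarrow> expectation (\<lambda>\<omega>. \<xi> \<omega> * \<Theta> \<omega>) = 0"
    and "\<xi> \<in> borel_measurable G \<Longrightarrow> integrable M \<xi> \<Longrightarrow> (\<And>\<omega>. 0 \<le> \<xi> \<omega>) \<Longrightarrow> integrable M (\<lambda>\<omega>. \<xi> \<omega> * (\<Theta> \<omega>)\<^sup>2)"
    and "\<xi> \<in> borel_measurable G \<Longrightarrow> integrable M \<xi> \<Longrightarrow> (\<And>\<omega>. 0 \<le> \<xi> \<omega>) \<Longrightarrow>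
      expectation (\<lambda>\<omega>. \<xi> \<omega> * (\<Theta> \<omega>)\<^sup>2) \<le> v * expectation \<xi>"
  using assms unfolding mart_diff_def by blast+

lemma mart_diff_zero: "mart_diff G (\<lambda>_. 0) 0"
  by (simp add: mart_diff_def)

lemma mart_diff_mono:
  assumes "mart_diff G \<Theta> v" "v \<le> v'"
  shows "mart_diff G \<Theta> v'"
  unfolding mart_diff_def
proof (intro conjI ballI impI)
  fix \<xi> :: "'a \<Rightarrow> real" assume \<xi>: "\<xi> \<in> borel_measurable G" "integrable M \<xi>" "\<forall>\<omega>. 0 \<le> \<xi> \<omega>"
  have "v * expectation \<xi> \<le> v' * expectation \<xi>"
    using assms(2) \<xi>(3) by (intro mult_right_mono Bochner_Integration.integral_nonneg) auto
  then show "expectation (\<lambda>\<omega>. \<xi> \<omega> * (\<Theta> \<omega>)\<^sup>2) \<le> v' * expectation \<xi>"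
    using mart_diffD(6)[OF assms(1) \<xi>(1,2)] \<xi>(3) by fastforce
qed (use mart_diffD[OF assms(1)] assms(2) in auto)

text \<open>Borel functions of an independent increment inherit independence, so expectations of
  products with a \<open>G\<close>-measurable \<open>\<xi>\<close> factorise. Applied to
  \<open>\<phi>\<close> and to its square this gives both parts of \<open>mart_diff\<close>, the
  second one with equality.\<close>

lemma mart_diff_indep:
  fixes X :: "'a \<Rightarrow> 'v::euclidean_space"
  assumes indep: "indep_set {X -` A \<inter> space M | A. A \<in> sets borel} (sets G)"
    and G: "subalgebra M G" and [measurable]: "X \<in> borel_measurable M" "\<phi> \<in> borel_measurable borel"
    and int: "integrable M (\<lambda>\<omega>. (\<phi> (X \<omega>))\<^sup>2)" and mean: "expectation (\<lambda>\<omega>. \<phi> (X \<omega>)) = 0"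
  shows "mart_diff G (\<lambda>\<omega>. \<phi> (X \<omega>)) (expectation (\<lambda>\<omega>. (\<phi> (X \<omega>))\<^sup>2))"
proof -
  have "indep_var borel (\<lambda>\<omega>. \<psi> (X \<omega>)) borel \<xi>"
    if \<xi>: "\<xi> \<in> borel_measurable G" and \<psi> [measurable]: "\<psi> \<in> borel_measurable borel" for \<psi> \<xi> :: "_ \<Rightarrow> real"
  proof -
    \<comment> \<open>\<open>indep_var\<close> speaks of generated sigma algebras; intersection
      stability of the preimage families lifts the independence to them.\<close>
    have Int_stable: "Int_stable {Z -` A \<inter> space M |A. A \<in> sets borel}" for Z :: "'a \<Rightarrow> 'c::topological_space"
    proof (safe intro!: Int_stableI)
      fix A B :: "'c set" assume "A \<in> sets borel" "B \<in> sets borel"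
      then show "\<exists>C. (Z -` A \<inter> space M) \<inter> (Z -` B \<inter> space M) = (Z -` C \<inter> space M) \<and> C \<in> sets borel"
        by (intro exI[of _ "A \<inter> B"]) auto
    qed
    have meas: "\<xi> \<in> borel_measurable M"
      using measurable_from_subalg[OF G \<xi>] .
    have "{\<xi> -` A \<inter> space M | A. A \<in> sets borel} \<subseteq> sets G"
      using measurable_sets[OF \<xi>] G by (auto simp: subalgebra_def)
    moreover have "{(\<lambda>\<omega>. \<psi> (X \<omega>)) -` A \<inter> space M | A. A \<in> sets borel} \<subseteq> {X -` A \<inter> space M | A. A \<in> sets borel}"
    proof safe
      fix A :: "real set" assume "A \<in> sets borel"
      then show "\<exists>B. (\<lambda>\<omega>. \<psi> (X \<omega>)) -` A \<inter> space M = X -` B \<inter> space M \<and> B \<in> sets borel"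
        by (intro exI[of _ "\<psi> -` A"]) (use measurable_sets_borel[OF \<psi>] in auto)
    qed
    ultimately have "indep_set {(\<lambda>\<omega>. \<psi> (X \<omega>)) -` A \<inter> space M | A. A \<in> sets borel} {\<xi> -` A \<inter> space M | A. A \<in> sets borel}"
      using indep unfolding indep_set_def by (elim indep_sets_mono_sets) (auto split: bool.split)
    then show ?thesis
      unfolding indep_var_eq using meas by (intro conjI indep_set_sigma_sets Int_stable) auto
  qed note ind = this
  have int1: "integrable M (\<lambda>\<omega>. \<phi> (X \<omega>))"
    by (rule square_integrable_imp_integrable[OF _ int]) measurable
  show ?thesis
    unfolding mart_diff_def
  proof (intro conjI ballI impI)
    fix \<xi> :: "'a \<Rightarrow> real" assume \<xi>: "\<xi> \<in> borel_measurable G" "integrable M \<xi>"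
    note i1 = ind[OF \<xi>(1), of \<phi>] and i2 = ind[OF \<xi>(1), of "\<lambda>x. (\<phi> x)\<^sup>2"]
    show "integrable M (\<lambda>\<omega>. \<xi> \<omega> * \<phi> (X \<omega>))"
      using indep_var_integrable[OF i1 int1 \<xi>(2)] by (simp add: mult.commute)
    show "expectation (\<lambda>\<omega>. \<xi> \<omega> * \<phi> (X \<omega>)) = 0"
      using indep_var_lebesgue_integral[OF i1 int1 \<xi>(2)] mean by (simp add: mult.commute)
    show "integrable M (\<lambda>\<omega>. \<xi> \<omega> * (\<phi> (X \<omega>))\<^sup>2)"
      using indep_var_integrable[OF i2 int \<xi>(2)] by (simp add: mult.commute)
    show "expectation (\<lambda>\<omega>. \<xi> \<omega> * (\<phi> (X \<omega>))\<^sup>2) \<le> expectation (\<lambda>\<omega>. (\<phi> (X \<omega>))\<^sup>2) * expectation \<xi>"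
      using indep_var_lebesgue_integral[OF i2 int \<xi>(2)] by (simp add: mult.commute)
  qed (auto intro!: Bochner_Integration.integral_nonneg)
qed

lemma integrable_mult_square:
  fixes X Y :: "'a \<Rightarrow> real"
  assumes [measurable]: "X \<in> borel_measurable M" "Y \<in> borel_measurable M"
    and "integrable M (\<lambda>\<omega>. (X \<omega>)\<^sup>2)" "integrable M (\<lambda>\<omega>. (Y \<omega>)\<^sup>2)"
  shows "integrable M (\<lambda>\<omega>. X \<omega> * Y \<omega>)"
proof (rule Bochner_Integration.integrable_bound)
  show "integrable M (\<lambda>\<omega>. (X \<omega>)\<^sup>2 + (Y \<omega>)\<^sup>2)"
    using assms by simp
  have "\<bar>x * y\<bar> \<le> x\<^sup>2 + y\<^sup>2" for x y :: real
    using sum_squares_bound[of "\<bar>x\<bar>" "\<bar>y\<bar>"] mult_nonneg_nonneg[OF abs_ge_zero[of x] abs_ge_zero[of y]]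
    unfolding abs_mult power2_abs by linarith
  then show "AE \<omega> in M. norm (X \<omega> * Y \<omega>) \<le> norm ((X \<omega>)\<^sup>2 + (Y \<omega>)\<^sup>2)"
    by simp
qed measurable

text \<open>Orthogonality of martingale differences: in the induction the cross term is
  \<open>S \<omega> * \<zeta> n \<omega>\<close>, known at stage \<open>n\<close> and integrable as
  a product of square integrable factors, times \<open>\<Theta> n \<omega>\<close>, hence of mean
  0.\<close>

lemma mart_diff_sum:
  assumes sub: "\<And>i. i \<le> n \<Longrightarrow> subalgebra M (F i)" "\<And>i. i < n \<Longrightarrow> subalgebra (F (Suc i)) (F i)"
    and \<Theta>: "\<And>i. i < n \<Longrightarrow> \<Theta> i \<in> borel_measurable (F (Suc i))" "\<And>i. i < n \<Longrightarrow> mart_diff (F i) (\<Theta> i) (v i)"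
    and \<zeta>: "\<And>i. i < n \<Longrightarrow> \<zeta> i \<in> borel_measurable (F i)" "\<And>i. i < n \<Longrightarrow> integrable M (\<lambda>\<omega>. (\<zeta> i \<omega>)\<^sup>2)"
  shows "(\<lambda>\<omega>. \<Sum>i<n. \<zeta> i \<omega> * \<Theta> i \<omega>) \<in> borel_measurable (F n)"
    and "integrable M (\<lambda>\<omega>. (\<Sum>i<n. \<zeta> i \<omega> * \<Theta> i \<omega>)\<^sup>2)"
    and "expectation (\<lambda>\<omega>. (\<Sum>i<n. \<zeta> i \<omega> * \<Theta> i \<omega>)\<^sup>2) \<le> (\<Sum>i<n. v i * expectation (\<lambda>\<omega>. (\<zeta> i \<omega>)\<^sup>2))"
proof -
  have "(\<lambda>\<omega>. \<Sum>i<n. \<zeta> i \<omega> * \<Theta> i \<omega>) \<in> borel_measurable (F n) \<and>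
    integrable M (\<lambda>\<omega>. (\<Sum>i<n. \<zeta> i \<omega> * \<Theta> i \<omega>)\<^sup>2) \<and>
    expectation (\<lambda>\<omega>. (\<Sum>i<n. \<zeta> i \<omega> * \<Theta> i \<omega>)\<^sup>2) \<le> (\<Sum>i<n. v i * expectation (\<lambda>\<omega>. (\<zeta> i \<omega>)\<^sup>2))"
    using assms
  proof (induction n)
    case 0
    then show ?case by simp
  next
    case (Suc n)
    define S where "S \<omega> = (\<Sum>i<n. \<zeta> i \<omega> * \<Theta> i \<omega>)" for \<omega>
    have IH: "S \<in> borel_measurable (F n)" "integrable M (\<lambda>\<omega>. (S \<omega>)\<^sup>2)"
      "expectation (\<lambda>\<omega>. (S \<omega>)\<^sup>2) \<le> (\<Sum>i<n. v i * expectation (\<lambda>\<omega>. (\<zeta> i \<omega>)\<^sup>2))"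
      using Suc unfolding S_def by auto
    note md = mart_diffD[OF Suc.prems(4)[of n]]
    have meas: "S \<in> borel_measurable M" "\<zeta> n \<in> borel_measurable M" "\<zeta> n \<in> borel_measurable (F n)"
      using measurable_from_subalg[OF Suc.prems(1)[of n]] IH(1) Suc.prems(5)[of n] by auto
    have int: "integrable M (\<lambda>\<omega>. S \<omega> * \<zeta> n \<omega>)"
      using integrable_mult_square[OF meas(1,2) IH(2)] Suc.prems(6)[of n] by simp
    have cross: "integrable M (\<lambda>\<omega>. S \<omega> * \<zeta> n \<omega> * \<Theta> n \<omega>)" "expectation (\<lambda>\<omega>. S \<omega> * \<zeta> n \<omega> * \<Theta> n \<omega>) = 0"
      using md(3,4)[of "\<lambda>\<omega>. S \<omega> * \<zeta> n \<omega>"] int IH(1) meas(3) by auto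
    have diag: "integrable M (\<lambda>\<omega>. (\<zeta> n \<omega>)\<^sup>2 * (\<Theta> n \<omega>)\<^sup>2)"
      "expectation (\<lambda>\<omega>. (\<zeta> n \<omega>)\<^sup>2 * (\<Theta> n \<omega>)\<^sup>2) \<le> v n * expectation (\<lambda>\<omega>. (\<zeta> n \<omega>)\<^sup>2)"
      using md(5,6)[of "\<lambda>\<omega>. (\<zeta> n \<omega>)\<^sup>2"] meas(3) Suc.prems(6)[of n] by auto
    have eq: "(\<Sum>i<Suc n. \<zeta> i \<omega> * \<Theta> i \<omega>)\<^sup>2 =
        ((S \<omega>)\<^sup>2 + 2 * (S \<omega> * \<zeta> n \<omega> * \<Theta> n \<omega>)) + (\<zeta> n \<omega>)\<^sup>2 * (\<Theta> n \<omega>)\<^sup>2" for \<omega>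
      by (simp add: S_def power2_eq_square algebra_simps)
    have "(\<lambda>\<omega>. S \<omega> + \<zeta> n \<omega> * \<Theta> n \<omega>) \<in> borel_measurable (F (Suc n))"
      using measurable_from_subalg[OF Suc.prems(2)[of n] IH(1)]
        measurable_from_subalg[OF Suc.prems(2)[of n] meas(3)] Suc.prems(3)[of n] by auto
    then show ?case
      unfolding eq using IH cross diag by (auto simp: S_def)
  qed
  then show "(\<lambda>\<omega>. \<Sum>i<n. \<zeta> i \<omega> * \<Theta> i \<omega>) \<in> borel_measurable (F n)"
    "integrable M (\<lambda>\<omega>. (\<Sum>i<n. \<zeta> i \<omega> * \<Theta> i \<omega>)\<^sup>2)"
    "expectation (\<lambda>\<omega>. (\<Sum>i<n. \<zeta> i \<omega> * \<Theta> i \<omega>)\<^sup>2) \<le> (\<Sum>i<n. v i * expectation (\<lambda>\<omega>. (\<zeta> i \<omega>)\<^sup>2))"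
    by blast+
qed

text \<open>The noise over one cell is later approximated by a sum over a finer partition, which
  must again act as a single difference for the coarse filtration.\<close>

lemma mart_diff_combination:
  assumes sub: "\<And>i. i \<le> n \<Longrightarrow> subalgebra M (F i)" "\<And>i. i < n \<Longrightarrow> subalgebra (F (Suc i)) (F i)"
    and \<Theta>: "\<And>i. i < n \<Longrightarrow> \<Theta> i \<in> borel_measurable (F (Suc i))" "\<And>i. i < n \<Longrightarrow> mart_diff (F i) (\<Theta> i) (v i)"
  shows "mart_diff (F 0) (\<lambda>\<omega>. \<Sum>i<n. c i * \<Theta> i \<omega>) (\<Sum>i<n. v i * (c i)\<^sup>2)"
  unfolding mart_diff_def
proof (intro conjI ballI impI)
  have F0: "\<xi> \<in> borel_measurable (F i)" if "\<xi> \<in> borel_measurable (F 0)" "i \<le> n" for \<xi> :: "'a \<Rightarrow> real" and i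
    using that(2)
  proof (induction i)
    case (Suc i)
    then show ?case using measurable_from_subalg[OF sub(2)[of i]] by simp
  qed (use that(1) in simp)
  show "(\<lambda>\<omega>. \<Sum>i<n. c i * \<Theta> i \<omega>) \<in> borel_measurable M"
    using mart_diffD(1)[OF \<Theta>(2)] by auto
  show "0 \<le> (\<Sum>i<n. v i * (c i)\<^sup>2)"
    using mart_diffD(2)[OF \<Theta>(2)] by (auto intro!: sum_nonneg)
  fix \<xi> :: "'a \<Rightarrow> real" assume \<xi>: "\<xi> \<in> borel_measurable (F 0)" "integrable M \<xi>"
  have lin: "\<xi> \<omega> * (\<Sum>i<n. c i * \<Theta> i \<omega>) = (\<Sum>i<n. c i * (\<xi> \<omega> * \<Theta> i \<omega>))" for \<omega>
    by (simp add: sum_distrib_left algebra_simps)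
  have i: "integrable M (\<lambda>\<omega>. \<xi> \<omega> * \<Theta> i \<omega>)" "expectation (\<lambda>\<omega>. \<xi> \<omega> * \<Theta> i \<omega>) = 0" if "i < n" for i
    using mart_diffD(3,4)[OF \<Theta>(2)[OF that] F0[OF \<xi>(1)] \<xi>(2)] that by auto
  show "integrable M (\<lambda>\<omega>. \<xi> \<omega> * (\<Sum>i<n. c i * \<Theta> i \<omega>))"
    unfolding lin using i by (intro Bochner_Integration.integrable_sum) auto
  show "expectation (\<lambda>\<omega>. \<xi> \<omega> * (\<Sum>i<n. c i * \<Theta> i \<omega>)) = 0"
    unfolding lin using i by (subst Bochner_Integration.integral_sum) auto
  assume nonneg: "\<forall>\<omega>. 0 \<le> \<xi> \<omega>"
  \<comment> \<open>The square root moves the nonnegative \<open>\<xi>\<close> inside the square, so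
    the unconditional second moment estimate applies with weights
    \<open>c i * sqrt (\<xi> \<omega>)\<close>, which are square integrable because
    \<open>\<xi>\<close> is integrable.\<close>
  have sq: "(\<Sum>i<n. c i * sqrt (\<xi> \<omega>) * \<Theta> i \<omega>)\<^sup>2 = \<xi> \<omega> * (\<Sum>i<n. c i * \<Theta> i \<omega>)\<^sup>2" for \<omega>
  proof -
    have "(\<Sum>i<n. c i * sqrt (\<xi> \<omega>) * \<Theta> i \<omega>) = sqrt (\<xi> \<omega>) * (\<Sum>i<n. c i * \<Theta> i \<omega>)"
      by (simp add: sum_distrib_left algebra_simps)
    then show ?thesis using nonneg by (simp add: power_mult_distrib)
  qed
  have sq1: "(c i * sqrt (\<xi> \<omega>))\<^sup>2 = (c i)\<^sup>2 * \<xi> \<omega>" for i \<omega>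
    using nonneg by (simp add: power_mult_distrib)
  have m: "(\<lambda>\<omega>. c i * sqrt (\<xi> \<omega>)) \<in> borel_measurable (F i)" if "i < n" for i
    using F0[OF \<xi>(1), of i] that by auto
  have int: "integrable M (\<lambda>\<omega>. (c i * sqrt (\<xi> \<omega>))\<^sup>2)" for i
    unfolding sq1 using \<xi> by simp
  show "integrable M (\<lambda>\<omega>. \<xi> \<omega> * (\<Sum>i<n. c i * \<Theta> i \<omega>)\<^sup>2)"
    using mart_diff_sum(2)[of n F \<Theta> v "\<lambda>i \<omega>. c i * sqrt (\<xi> \<omega>)", OF assms m int] unfolding sq by simp
  have "expectation (\<lambda>\<omega>. \<xi> \<omega> * (\<Sum>i<n. c i * \<Theta> i \<omega>)\<^sup>2) \<le> (\<Sum>i<n. v i * expectation (\<lambda>\<omega>. (c i * sqrt (\<xi> \<omega>))\<^sup>2))"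
    using mart_diff_sum(3)[of n F \<Theta> v "\<lambda>i \<omega>. c i * sqrt (\<xi> \<omega>)", OF assms m int] unfolding sq by simp
  also have "\<dots> = (\<Sum>i<n. v i * (c i)\<^sup>2) * expectation \<xi>"
    unfolding sq1 by (simp add: sum_distrib_right mult.assoc)
  finally show "expectation (\<lambda>\<omega>. \<xi> \<omega> * (\<Sum>i<n. c i * \<Theta> i \<omega>)\<^sup>2) \<le> (\<Sum>i<n. v i * (c i)\<^sup>2) * expectation \<xi>" .
qed

end

section \<open>Moments of Gaussian vectors\<close>

text \<open>Fubini in the form of \<open>lborel_eq\<close>: Lebesgue measure on the Euclidean space
  is the image of the product of one-dimensional ones under summation of coordinates.\<close>

lemma lborel_prod_integral:
  fixes g :: "'v::euclidean_space \<Rightarrow> real \<Rightarrow> real"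
  assumes "\<And>e. e \<in> Basis \<Longrightarrow> integrable lborel (g e)"
  shows "integrable lborel (\<lambda>x::'v. \<Prod>e\<in>Basis. g e (x \<bullet> e))"
    and "(LINT x|lborel. (\<Prod>e\<in>Basis. g e ((x::'v) \<bullet> e))) = (\<Prod>e\<in>Basis. (LINT y|lborel. g e y))"
proof -
  interpret product_sigma_finite "\<lambda>_::'v. lborel :: real measure"
    by standard
  have [measurable]: "g e \<in> borel_measurable borel" if "e \<in> Basis" for e
    using assms[OF that] by (simp add: borel_measurable_integrable)
  have meas: "(\<lambda>x::'v. \<Prod>e\<in>Basis. g e (x \<bullet> e)) \<in> borel_measurable borel"
    by measurable
  have T [measurable]: "(\<lambda>f. \<Sum>b\<in>Basis. f b *\<^sub>R b) \<in> (\<Pi>\<^sub>M b\<in>(Basis::'v set). lborel) \<rightarrow>\<^sub>M borel"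
    by measurable
  have eq: "(\<Prod>e\<in>Basis. g e ((\<Sum>b\<in>Basis. f b *\<^sub>R b) \<bullet> e)) = (\<Prod>e\<in>Basis. g e (f e))" for f :: "'v \<Rightarrow> real"
    by (intro prod.cong refl) simp
  show "integrable lborel (\<lambda>x::'v. \<Prod>e\<in>Basis. g e (x \<bullet> e))"
    unfolding lborel_eq[where 'a='v] integrable_distr_eq[OF T meas] eq
    by (intro product_integrable_prod assms) auto
  show "(LINT x|lborel. (\<Prod>e\<in>Basis. g e ((x::'v) \<bullet> e))) = (\<Prod>e\<in>Basis. (LINT y|lborel. g e y))"
    unfolding lborel_eq[where 'a='v] integral_distr[OF T meas] eq
    by (intro product_integral_prod assms) auto
qed

context prob_space
begin

text \<open>A general multi-index \<open>k\<close> treats pure and mixed moments at once: density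
  and monomial are both products over \<open>Basis\<close>, so each moment is a product of
  one-dimensional ones.\<close>

lemma gaussian_vector_moments:
  fixes X :: "'a \<Rightarrow> 'v::euclidean_space" and k :: "'v \<Rightarrow> nat"
  assumes "s > 0" and X: "distributed M lborel X (\<lambda>x. ennreal (\<Prod>e\<in>Basis. normal_density 0 s (x \<bullet> e)))"
  shows "integrable M (\<lambda>\<omega>. \<Prod>e\<in>Basis. (X \<omega> \<bullet> e) ^ k e)"
    and "expectation (\<lambda>\<omega>. \<Prod>e\<in>Basis. (X \<omega> \<bullet> e) ^ k e) = (\<Prod>e\<in>Basis. (LINT y|lborel. (normal_density 0 s y * y ^ k e)))"
proof -
  have int: "integrable lborel (\<lambda>y. normal_density 0 s y * y ^ k e)" for e
    using integrable_normal_moment[OF \<open>s > 0\<close>, of 0 "k e"] by simp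
  have eq: "(\<Prod>e\<in>Basis. normal_density 0 s (x \<bullet> e)) * (\<Prod>e\<in>Basis. (x \<bullet> e) ^ k e) =
      (\<Prod>e\<in>Basis. normal_density 0 s (x \<bullet> e) * (x \<bullet> e) ^ k e)" for x :: 'v
    by (simp add: prod.distrib)
  have meas: "(\<lambda>x::'v. \<Prod>e\<in>Basis. (x \<bullet> e) ^ k e) \<in> borel_measurable lborel"
    by measurable
  have nn: "0 \<le> (\<Prod>e\<in>Basis. normal_density 0 s (x \<bullet> e))" for x :: 'v
    by (intro prod_nonneg) simp
  show "integrable M (\<lambda>\<omega>. \<Prod>e\<in>Basis. (X \<omega> \<bullet> e) ^ k e)"
    using distributed_integrable[OF X meas nn] lborel_prod_integral(1)[of "\<lambda>e y. normal_density 0 s y * y ^ k e", OF int] unfolding eq by simp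
  show "expectation (\<lambda>\<omega>. \<Prod>e\<in>Basis. (X \<omega> \<bullet> e) ^ k e) = (\<Prod>e\<in>Basis. (LINT y|lborel. (normal_density 0 s y * y ^ k e)))"
    using distributed_integral[OF X meas nn] lborel_prod_integral(2)[of "\<lambda>e y. normal_density 0 s y * y ^ k e", OF int] unfolding eq by simp
qed

lemma prod_Basis_power_single:
  assumes "e \<in> Basis"
  shows "(\<Prod>b\<in>Basis. (x \<bullet> b) ^ (if b = e then k else 0)) = ((x::'v::euclidean_space) \<bullet> e) ^ k"
proof -
  have "(\<Prod>b\<in>Basis. (x \<bullet> b) ^ (if b = e then k else 0)) = (\<Prod>b\<in>Basis. if b = e then (x \<bullet> b) ^ k else 1)"
    by (intro prod.cong) auto
  then show ?thesis using assms by simp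
qed

lemma gaussian_vector_low_moments:
  fixes X :: "'a \<Rightarrow> 'v::euclidean_space"
  assumes "r > 0" and X: "distributed M lborel X (\<lambda>x. ennreal (\<Prod>e\<in>Basis. normal_density 0 (sqrt r) (x \<bullet> e)))"
    and e: "e \<in> Basis" "e' \<in> Basis"
  shows "expectation (\<lambda>\<omega>. X \<omega> \<bullet> e) = 0"
    and "integrable M (\<lambda>\<omega>. (X \<omega> \<bullet> e)\<^sup>2)" "expectation (\<lambda>\<omega>. (X \<omega> \<bullet> e)\<^sup>2) = r"
    and "expectation (\<lambda>\<omega>. (X \<omega> \<bullet> e) * (X \<omega> \<bullet> e')) = (if e = e' then r else 0)"
    and "integrable M (\<lambda>\<omega>. (X \<omega> \<bullet> e) ^ 4)" "expectation (\<lambda>\<omega>. (X \<omega> \<bullet> e) ^ 4) = 3 * r\<^sup>2"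
proof -
  have s: "sqrt r > 0" using \<open>r > 0\<close> by simp
  define m where "m k = (LINT y|lborel. (normal_density 0 (sqrt r) y * y ^ k))" for k
  have m0: "m 0 = 1"
    using integral_normal_moment_even[OF s, of 0 0] by (simp add: m_def)
  have m1: "m (Suc 0) = 0"
    using integral_normal_moment_odd[OF s, of 0 0] by (simp add: m_def)
  have m2: "m 2 = r"
    using integral_normal_moment_even[OF s, of 0 1] \<open>r > 0\<close> by (simp add: m_def)
  have m4: "m 4 = 3 * r\<^sup>2"
    using integral_normal_moment_even[OF s, of 0 2] \<open>r > 0\<close>
    by (simp add: m_def fact_numeral power2_eq_square)
  note mom = gaussian_vector_moments[OF s X, folded m_def]
  have single: "integrable M (\<lambda>\<omega>. (X \<omega> \<bullet> e) ^ k)" "expectation (\<lambda>\<omega>. (X \<omega> \<bullet> e) ^ k) = m k"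
    if "e \<in> Basis" for e k
  proof -
    have "(\<Prod>b\<in>Basis. m (if b = e then k else 0)) = (\<Prod>b\<in>Basis. if b = e then m k else 1)"
      by (intro prod.cong) (auto simp: m0)
    also have "\<dots> = m k"
      using that by simp
    finally show "integrable M (\<lambda>\<omega>. (X \<omega> \<bullet> e) ^ k)" "expectation (\<lambda>\<omega>. (X \<omega> \<bullet> e) ^ k) = m k"
      using mom[of "\<lambda>b. if b = e then k else 0"] prod_Basis_power_single[OF that] by auto
  qed
  show "expectation (\<lambda>\<omega>. X \<omega> \<bullet> e) = 0"
    using single(2)[OF e(1), of 1] m1 by simp
  show "integrable M (\<lambda>\<omega>. (X \<omega> \<bullet> e)\<^sup>2)" "expectation (\<lambda>\<omega>. (X \<omega> \<bullet> e)\<^sup>2) = r"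
    using single[OF e(1), of 2] m2 by auto
  show "integrable M (\<lambda>\<omega>. (X \<omega> \<bullet> e) ^ 4)" "expectation (\<lambda>\<omega>. (X \<omega> \<bullet> e) ^ 4) = 3 * r\<^sup>2"
    using single[OF e(1), of 4] m4 by auto
  show "expectation (\<lambda>\<omega>. (X \<omega> \<bullet> e) * (X \<omega> \<bullet> e')) = (if e = e' then r else 0)"
  proof (cases "e = e'")
    case True
    then show ?thesis
      using single(2)[OF e(1), of 2] m2 by (simp add: power2_eq_square)
  next
    case False
    \<comment> \<open>For distinct \<open>e\<close> and \<open>e'\<close> the multi-index is 1 at
      both, and the vanishing first moment \<open>m (Suc 0)\<close> kills the product.\<close>
    define k where "k b = (if b = e then 1 else 0) + (if b = e' then 1 else (0::nat))" for b
    have "(\<Prod>b\<in>Basis. m (k b)) = 0"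
      using e False m1 by (intro prod_zero) (auto simp: k_def intro!: bexI[of _ e])
    moreover have "(\<Prod>b\<in>Basis. (x \<bullet> b) ^ k b) = (x \<bullet> e) * (x \<bullet> e')" for x :: 'v
      unfolding k_def power_add prod.distrib using e by (simp add: prod_Basis_power_single)
    ultimately show ?thesis
      using mom(2)[of k] False by simp
  qed
qed

end

section \<open>Increments of Brownian motion\<close>

locale brownian = prob_space M for M :: "'w measure" +
  fixes F :: "real \<Rightarrow> 'w measure" and W :: "real \<Rightarrow> 'w \<Rightarrow> 'v::euclidean_space"
  assumes brownian: "brownian_motion M F W"
begin

lemma F_subalgebra: "subalgebra M (F t)"
  using brownian by (simp add: brownian_motion_def)

lemma F_mono: "s \<le> t \<Longrightarrow> subalgebra (F t) (F s)"
  using brownian filtration.sets_F_mono[of "space M" F s t] filtration.space_F[of "space M" F]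
  by (simp add: brownian_motion_def subalgebra_def)

lemma F_measurable_M: "Z \<in> borel_measurable (F t) \<Longrightarrow> Z \<in> borel_measurable M"
  by (rule measurable_from_subalg[OF F_subalgebra])

lemma F_measurable_mono: "Z \<in> borel_measurable (F s) \<Longrightarrow> s \<le> t \<Longrightarrow> Z \<in> borel_measurable (F t)"
  by (rule measurable_from_subalg[OF F_mono])

lemma W_adapted: "t \<in> {0..1} \<Longrightarrow> W t \<in> borel_measurable (F t)"
  using brownian by (simp add: brownian_motion_def)

lemma W_measurable: "t \<in> {0..1} \<Longrightarrow> W t \<in> borel_measurable M"
  by (rule F_measurable_M[OF W_adapted])

lemma W_increment:
  assumes "s \<in> {0..1}" "t \<in> {0..1}" "s < t"
  shows "indep_set {(\<lambda>\<omega>. W t \<omega> - W s \<omega>) -` A \<inter> space M | A. A \<in> sets borel} (sets (F s))"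
    and "distributed M lborel (\<lambda>\<omega>. W t \<omega> - W s \<omega>) (\<lambda>x. ennreal (\<Prod>e\<in>Basis. normal_density 0 (sqrt (t - s)) (x \<bullet> e)))"
  using brownian assms by (simp_all add: brownian_motion_def)

lemma W_increment_square:
  assumes "s \<in> {0..1}" "t \<in> {0..1}" "s \<le> t" "e \<in> Basis"
  shows "integrable M (\<lambda>\<omega>. ((W t \<omega> - W s \<omega>) \<bullet> e)\<^sup>2)" "expectation (\<lambda>\<omega>. ((W t \<omega> - W s \<omega>) \<bullet> e)\<^sup>2) = t - s"
proof -
  have "integrable M (\<lambda>\<omega>. ((W t \<omega> - W s \<omega>) \<bullet> e)\<^sup>2) \<and> expectation (\<lambda>\<omega>. ((W t \<omega> - W s \<omega>) \<bullet> e)\<^sup>2) = t - s"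
  proof (cases "s = t")
    case False
    then show ?thesis
      using gaussian_vector_low_moments(2,3)[OF _ W_increment(2)] assms by auto
  qed simp
  then show "integrable M (\<lambda>\<omega>. ((W t \<omega> - W s \<omega>) \<bullet> e)\<^sup>2)" "expectation (\<lambda>\<omega>. ((W t \<omega> - W s \<omega>) \<bullet> e)\<^sup>2) = t - s"
    by auto
qed

lemma W_increment_mart_diff:
  assumes "s \<in> {0..1}" "t \<in> {0..1}" "s \<le> t" "e \<in> Basis"
  shows "mart_diff (F s) (\<lambda>\<omega>. (W t \<omega> - W s \<omega>) \<bullet> e) (t - s)"
proof (cases "s = t")
  case True
  then show ?thesis using mart_diff_zero by simp
next
  case False
  then have *: "s < t" using assms by simp
  note mom = gaussian_vector_low_moments[OF _ W_increment(2)[OF assms(1,2) *] assms(4,4)]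
  have "mart_diff (F s) (\<lambda>\<omega>. (\<lambda>x. x \<bullet> e) (W t \<omega> - W s \<omega>)) (expectation (\<lambda>\<omega>. ((\<lambda>x. x \<bullet> e) (W t \<omega> - W s \<omega>))\<^sup>2))"
    by (rule mart_diff_indep[OF W_increment(1)[OF assms(1,2) *] F_subalgebra])
       (use mom * W_measurable assms in auto)
  then show ?thesis
    using mom(3) * by simp
qed

text \<open>The variance is of second order in the length of the interval, which makes compensated
  products negligible when summed. The constant 8 is \<open>3 + 3 + 2\<close>: with
  \<open>r = t - s\<close>, two fourth moments \<open>3 * r\<^sup>2\<close> and the
  \<open>2 * r\<^sup>2\<close> in \<open>bound\<close>.\<close>

lemma W_increment_product_mart_diff:
  assumes "s \<in> {0..1}" "t \<in> {0..1}" "s \<le> t" "e \<in> Basis" "e' \<in> Basis"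
  shows "mart_diff (F s) (\<lambda>\<omega>. ((W t \<omega> - W s \<omega>) \<bullet> e) * ((W t \<omega> - W s \<omega>) \<bullet> e') - (if e = e' then t - s else 0))
    (8 * (t - s)\<^sup>2)"
proof (cases "s = t")
  case True
  then show ?thesis using mart_diff_zero by simp
next
  case False
  then have *: "s < t" "t - s > 0" using assms by auto
  let ?X = "\<lambda>\<omega>. W t \<omega> - W s \<omega>"
  define r where "r = t - s"
  have [measurable]: "?X \<in> borel_measurable M"
    using W_measurable assms by auto
  note mom = gaussian_vector_low_moments[OF *(2) W_increment(2)[OF assms(1,2) *(1)], folded r_def]
  define \<phi> where "\<phi> x = (x \<bullet> e) * (x \<bullet> e') - (if e = e' then r else 0)" for x
  have bound: "(\<phi> x)\<^sup>2 \<le> (x \<bullet> e) ^ 4 + (x \<bullet> e') ^ 4 + 2 * r\<^sup>2" for x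
  proof -
    define d where "d = (if e = e' then r else 0)"
    have "(\<phi> x)\<^sup>2 \<le> 2 * ((x \<bullet> e) * (x \<bullet> e'))\<^sup>2 + 2 * d\<^sup>2"
      using zero_le_power2[of "(x \<bullet> e) * (x \<bullet> e') + d"]
      unfolding \<phi>_def d_def[symmetric] by (simp add: power2_eq_square algebra_simps)
    moreover have "2 * ((x \<bullet> e) * (x \<bullet> e'))\<^sup>2 \<le> (x \<bullet> e) ^ 4 + (x \<bullet> e') ^ 4"
      using sum_squares_bound[of "(x \<bullet> e)\<^sup>2" "(x \<bullet> e')\<^sup>2"] by (simp add: power_mult_distrib)
    moreover have "d\<^sup>2 \<le> r\<^sup>2"
      by (simp add: d_def)
    ultimately show ?thesis by linarith
  qed
  have [measurable]: "\<phi> \<in> borel_measurable borel"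
    unfolding \<phi>_def by measurable
  have int4: "integrable M (\<lambda>\<omega>. (?X \<omega> \<bullet> e) ^ 4 + (?X \<omega> \<bullet> e') ^ 4 + 2 * r\<^sup>2)"
    using mom(5)[OF assms(4,4)] mom(5)[OF assms(5,5)] by simp
  have int: "integrable M (\<lambda>\<omega>. (\<phi> (?X \<omega>))\<^sup>2)"
    by (rule Bochner_Integration.integrable_bound[OF int4]) (use bound in \<open>auto intro!: AE_I2 order_trans[OF bound]\<close>)
  have "integrable M (\<lambda>\<omega>. (?X \<omega> \<bullet> e) * (?X \<omega> \<bullet> e'))"
    using integrable_mult_square mom(2)[OF assms(4,4)] mom(2)[OF assms(5,5)] by simp
  then have "expectation (\<lambda>\<omega>. \<phi> (?X \<omega>)) = 0"
    unfolding \<phi>_def using mom(4)[OF assms(4,5)] by (simp add: prob_space)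
  then have "mart_diff (F s) (\<lambda>\<omega>. \<phi> (?X \<omega>)) (expectation (\<lambda>\<omega>. (\<phi> (?X \<omega>))\<^sup>2))"
    by (intro mart_diff_indep[OF W_increment(1)[OF assms(1,2) *(1)] F_subalgebra] int) auto
  moreover have "expectation (\<lambda>\<omega>. (\<phi> (?X \<omega>))\<^sup>2) \<le> expectation (\<lambda>\<omega>. (?X \<omega> \<bullet> e) ^ 4 + (?X \<omega> \<bullet> e') ^ 4 + 2 * r\<^sup>2)"
    using int int4 bound by (rule Bochner_Integration.integral_mono)
  moreover have "expectation (\<lambda>\<omega>. (?X \<omega> \<bullet> e) ^ 4 + (?X \<omega> \<bullet> e') ^ 4 + 2 * r\<^sup>2) = 8 * r\<^sup>2"
    using mom(5,6)[OF assms(4,4)] mom(5,6)[OF assms(5,5)] by (simp add: prob_space)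
  ultimately show ?thesis
    using mart_diff_mono unfolding \<phi>_def r_def by fastforce
qed

lemma martingale_transform_second_moment:
  assumes \<tau>: "partition_on_interval a b n \<tau>" and ab: "0 \<le> a" "b \<le> 1"
    and \<Theta>: "\<And>i. i < n \<Longrightarrow> \<Theta> i \<in> borel_measurable (F (\<tau> (Suc i)))" "\<And>i. i < n \<Longrightarrow> mart_diff (F (\<tau> i)) (\<Theta> i) (v i)"
    and \<zeta>: "\<And>i. i < n \<Longrightarrow> \<zeta> i \<in> borel_measurable (F (\<tau> i))" "\<And>i \<omega>. i < n \<Longrightarrow> \<bar>\<zeta> i \<omega>\<bar> \<le> K"
  shows "(\<lambda>\<omega>. \<Sum>i<n. \<zeta> i \<omega> * \<Theta> i \<omega>) \<in> borel_measurable M"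
    and "integrable M (\<lambda>\<omega>. (\<Sum>i<n. \<zeta> i \<omega> * \<Theta> i \<omega>)\<^sup>2)"
    and "expectation (\<lambda>\<omega>. (\<Sum>i<n. \<zeta> i \<omega> * \<Theta> i \<omega>)\<^sup>2) \<le> K\<^sup>2 * (\<Sum>i<n. v i)"
proof -
  have sub: "subalgebra (F (\<tau> (Suc i))) (F (\<tau> i))" if "i < n" for i
    using that \<tau> by (auto simp: partition_on_interval_def intro!: F_mono)
  have sq: "(\<zeta> i \<omega>)\<^sup>2 \<le> K\<^sup>2" if "i < n" for i \<omega>
    using power_mono[OF \<zeta>(2)[OF that, of \<omega>], of 2] by simp
  have int: "integrable M (\<lambda>\<omega>. (\<zeta> i \<omega>)\<^sup>2)" if "i < n" for i
    using F_measurable_M[OF \<zeta>(1)[OF that]] sq[OF that]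
    by (intro integrable_const_bound[of _ "K\<^sup>2"]) auto
  note S = mart_diff_sum[of n "\<lambda>i. F (\<tau> i)", OF F_subalgebra sub \<Theta> \<zeta>(1) int]
  show "(\<lambda>\<omega>. \<Sum>i<n. \<zeta> i \<omega> * \<Theta> i \<omega>) \<in> borel_measurable M"
    by (rule F_measurable_M[OF S(1)])
  show "integrable M (\<lambda>\<omega>. (\<Sum>i<n. \<zeta> i \<omega> * \<Theta> i \<omega>)\<^sup>2)"
    by (rule S(2))
  have "(\<Sum>i<n. v i * expectation (\<lambda>\<omega>. (\<zeta> i \<omega>)\<^sup>2)) \<le> (\<Sum>i<n. v i * K\<^sup>2)"
  proof (intro sum_mono mult_left_mono)
    fix i assume "i \<in> {..<n}"
    then have "expectation (\<lambda>\<omega>. (\<zeta> i \<omega>)\<^sup>2) \<le> expectation (\<lambda>\<omega>. K\<^sup>2)"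
      using int sq by (intro Bochner_Integration.integral_mono) auto
    then show "expectation (\<lambda>\<omega>. (\<zeta> i \<omega>)\<^sup>2) \<le> K\<^sup>2"
      by (simp add: prob_space)
    show "0 \<le> v i"
      using \<open>i \<in> {..<n}\<close> mart_diffD(2)[OF \<Theta>(2)] by simp
  qed
  then show "expectation (\<lambda>\<omega>. (\<Sum>i<n. \<zeta> i \<omega> * \<Theta> i \<omega>)\<^sup>2) \<le> K\<^sup>2 * (\<Sum>i<n. v i)"
    by (intro order_trans[OF S(3)]) (auto simp: sum_distrib_right[symmetric] mult.commute[of "K\<^sup>2"])
qed

text \<open>Deterministic coefficients bounded by \<open>C\<close> give a variance bound that
  depends on the interval but not on the partition \<open>u\<close>, so approximating partitions of
  the cells may later be chosen freely.\<close>

lemma W_sum_mart_diff: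
  assumes u: "partition_on_interval s t n u" and st: "0 \<le> s" "t \<le> 1" and e: "e \<in> Basis"
    and c: "\<And>j. j < n \<Longrightarrow> \<bar>c j\<bar> \<le> C"
  shows "mart_diff (F s) (\<lambda>\<omega>. \<Sum>j<n. c j * ((W (u (Suc j)) \<omega> - W (u j) \<omega>) \<bullet> e)) (C\<^sup>2 * (t - s))"
    and "(\<lambda>\<omega>. \<Sum>j<n. c j * ((W (u (Suc j)) \<omega> - W (u j) \<omega>) \<bullet> e)) \<in> borel_measurable (F t)"
proof -
  have u01: "u j \<in> {0..1}" if "j \<le> n" for j
    using partition_in_interval[OF u that] st by auto
  have mono: "u j \<le> u (Suc j)" if "j < n" for j
    using u that by (simp add: partition_on_interval_def)
  have ad: "(\<lambda>\<omega>. (W (u (Suc j)) \<omega> - W (u j) \<omega>) \<bullet> e) \<in> borel_measurable (F (u (Suc j)))" if "j < n" for j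
    using W_adapted[of "u (Suc j)"] F_measurable_mono[OF W_adapted mono, of j] u01[of j] u01[of "Suc j"] that
    by auto
  have ends: "u 0 = s" "u n = t"
    using u by (auto simp: partition_on_interval_def)
  have "mart_diff (F (u 0)) (\<lambda>\<omega>. \<Sum>j<n. c j * ((W (u (Suc j)) \<omega> - W (u j) \<omega>) \<bullet> e))
      (\<Sum>j<n. (u (Suc j) - u j) * (c j)\<^sup>2)"
    by (rule mart_diff_combination[of n "\<lambda>j. F (u j)"])
       (use F_subalgebra F_mono mono ad u01 e in \<open>auto intro!: W_increment_mart_diff\<close>)
  moreover have "(\<Sum>j<n. (u (Suc j) - u j) * (c j)\<^sup>2) \<le> C\<^sup>2 * (t - s)"
  proof -
    have "(c j)\<^sup>2 \<le> C\<^sup>2" if "j < n" for j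
      using power_mono[OF c[OF that], of 2] by simp
    then have "(\<Sum>j<n. (u (Suc j) - u j) * (c j)\<^sup>2) \<le> (\<Sum>j<n. (u (Suc j) - u j) * C\<^sup>2)"
      using mono by (intro sum_mono mult_left_mono) auto
    also have "\<dots> = C\<^sup>2 * (t - s)"
      using sum_partition_telescope[OF u, of "\<lambda>x. x"] by (simp add: sum_distrib_right[symmetric])
    finally show ?thesis .
  qed
  ultimately show "mart_diff (F s) (\<lambda>\<omega>. \<Sum>j<n. c j * ((W (u (Suc j)) \<omega> - W (u j) \<omega>) \<bullet> e)) (C\<^sup>2 * (t - s))"
    using mart_diff_mono ends by simp
  show "(\<lambda>\<omega>. \<Sum>j<n. c j * ((W (u (Suc j)) \<omega> - W (u j) \<omega>) \<bullet> e)) \<in> borel_measurable (F t)"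
  proof (intro borel_measurable_sum borel_measurable_times borel_measurable_const)
    fix j assume "j \<in> {..<n}"
    then show "(\<lambda>\<omega>. (W (u (Suc j)) \<omega> - W (u j) \<omega>) \<bullet> e) \<in> borel_measurable (F t)"
      using F_measurable_mono[OF ad] partition_in_interval[OF u, of "Suc j"] by auto
  qed
qed

end

section \<open>Ito processes as integrators\<close>

locale ito = brownian M F W for M :: "'w measure" and F and W :: "real \<Rightarrow> 'w \<Rightarrow> 'v::euclidean_space" +
  fixes b X :: "real \<Rightarrow> 'w \<Rightarrow> 'v" and \<sigma> :: "real \<Rightarrow> real"
  assumes ito_process: "ito_process M F W b \<sigma> X"
    and \<sigma>_continuous: "continuous_on {0..1} \<sigma>"
begin

abbreviation "dX \<tau> i \<omega> \<equiv> X (\<tau> (Suc i)) \<omega> - X (\<tau> i) \<omega>"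
abbreviation "dW \<tau> i \<omega> \<equiv> W (\<tau> (Suc i)) \<omega> - W (\<tau> i) \<omega>"
abbreviation "dB \<tau> i \<omega> \<equiv> LINT r:{\<tau> i..\<tau> (Suc i)}|lborel. b r \<omega>"

lemma X_adapted: "t \<in> {0..1} \<Longrightarrow> X t \<in> borel_measurable (F t)"
  using ito_process by (simp add: ito_process_def)

lemma X_measurable: "t \<in> {0..1} \<Longrightarrow> X t \<in> borel_measurable M"
  by (rule F_measurable_M[OF X_adapted])

lemma X_continuous: "AE \<omega> in M. continuous_on {0..1} (\<lambda>t. X t \<omega>)"
  using ito_process by (simp add: ito_process_def)

text \<open>Dominates the drift part over any interval by differences of one scalar process with
  continuous paths, so that the modulus and tightness of this process can be used in place of bounds
  on \<open>b\<close>.\<close>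

definition drift_variation :: "real \<Rightarrow> 'w \<Rightarrow> real" where
  "drift_variation t \<omega> = (LINT r:{0..t}|lborel. norm (b r \<omega>))"

lemma drift_variation_measurable [measurable]:
  assumes "t \<in> {0..1}"
  shows "drift_variation t \<in> borel_measurable M"
proof -
  \<comment> \<open>Progressive measurability concerns times in \<open>{0..1}\<close> only. Clamping
    the time extends \<open>b\<close> to the whole line, as needed for measurability of an integral
    over \<open>lborel\<close> with a parameter; on \<open>{0..t}\<close> nothing changes.\<close>
  define clamp :: "real \<Rightarrow> real" where "clamp = (\<lambda>s. max 0 (min 1 s))"
  have m1: "(\<lambda>(s, \<omega>). b s \<omega>) \<in> borel_measurable (restrict_space borel {0..1} \<Otimes>\<^sub>M F 1)"
    using ito_process by (simp add: ito_process_def prog_measurable_def)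
  have m2: "(\<lambda>(\<omega>, s). (clamp s, \<omega>)) \<in> M \<Otimes>\<^sub>M borel \<rightarrow>\<^sub>M restrict_space borel {0..1} \<Otimes>\<^sub>M F 1"
  proof -
    have [measurable]: "clamp \<in> borel \<rightarrow>\<^sub>M restrict_space borel {0..1}"
      by (rule measurable_restrict_space2) (auto simp: clamp_def)
    have [measurable]: "(\<lambda>\<omega>. \<omega>) \<in> M \<rightarrow>\<^sub>M F 1"
      using F_subalgebra[of 1] by (auto simp: subalgebra_def measurable_def sets.sets_into_space Int_absorb2)
    show ?thesis by measurable
  qed
  have "(\<lambda>(\<omega>, s). b (clamp s) \<omega>) \<in> borel_measurable (M \<Otimes>\<^sub>M borel)"
    using measurable_compose[OF m2 m1] by (simp add: case_prod_beta')
  then have "(\<lambda>(\<omega>, s). b (clamp s) \<omega>) \<in> borel_measurable (M \<Otimes>\<^sub>M lborel)"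
    by (simp cong: measurable_cong_sets)
  then have "(\<lambda>(\<omega>, s). indicator {0..t} s *\<^sub>R norm (b (clamp s) \<omega>)) \<in> borel_measurable (M \<Otimes>\<^sub>M lborel)"
    by (simp add: case_prod_beta')
  then have "(\<lambda>\<omega>. LINT s|lborel. indicator {0..t} s *\<^sub>R norm (b (clamp s) \<omega>)) \<in> borel_measurable M"
    by (rule lborel.borel_measurable_lebesgue_integral)
  moreover have "(LINT s|lborel. indicator {0..t} s *\<^sub>R norm (b (clamp s) \<omega>)) = drift_variation t \<omega>" for \<omega>
    unfolding drift_variation_def set_lebesgue_integral_def using assms
    by (intro Bochner_Integration.integral_cong refl) (auto simp: clamp_def split: split_indicator)
  ultimately show ?thesis
    by simp
qed

text \<open>The pathwise Lebesgue integrals are converted to Henstock-Kurzweil integrals, for which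
  additivity over intervals and continuity of the indefinite integral are at hand.\<close>

lemma drift_bounds:
  "AE \<omega> in M. continuous_on {0..1} (\<lambda>t. drift_variation t \<omega>) \<and>
    (\<forall>s t. 0 \<le> s \<longrightarrow> s \<le> t \<longrightarrow> t \<le> 1 \<longrightarrow>
      norm (LINT r:{s..t}|lborel. b r \<omega>) \<le> drift_variation t \<omega> - drift_variation s \<omega>)"
proof -
  have "AE \<omega> in M. set_integrable lborel {0..1} (\<lambda>s. b s \<omega>)"
    using ito_process by (simp add: ito_process_def)
  then show ?thesis
  proof eventually_elim
    case (elim \<omega>)
    have sub: "set_integrable lborel {s..t} (\<lambda>r. b r \<omega>)" if "0 \<le> s" "t \<le> 1" for s t
      by (rule set_integrable_subset[OF elim]) (use that in auto)
    have subn: "set_integrable lborel {s..t} (\<lambda>r. norm (b r \<omega>))" if "0 \<le> s" "t \<le> 1" for s t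
      by (rule set_integrable_norm[OF sub[OF that]])
    have V: "drift_variation t \<omega> = integral {0..t} (\<lambda>r. norm (b r \<omega>))" if "t \<le> 1" for t
      unfolding drift_variation_def by (rule set_borel_integral_eq_integral(2)[OF subn]) (use that in auto)
    have "continuous_on {0..1} (\<lambda>t. integral {0..t} (\<lambda>r. norm (b r \<omega>)))"
      by (rule indefinite_integral_continuous_1[OF set_borel_integral_eq_integral(1)[OF subn]]) auto
    then have "continuous_on {0..1} (\<lambda>t. drift_variation t \<omega>)"
      by (rule continuous_on_eq) (simp add: V)
    moreover have "norm (LINT r:{s..t}|lborel. b r \<omega>) \<le> drift_variation t \<omega> - drift_variation s \<omega>"
      if st: "0 \<le> s" "s \<le> t" "t \<le> 1" for s t
    proof -
      have "norm (LINT r:{s..t}|lborel. b r \<omega>) = norm (integral {s..t} (\<lambda>r. b r \<omega>))"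
        using set_borel_integral_eq_integral(2)[OF sub, of s t] st by simp
      also have "\<dots> \<le> integral {s..t} (\<lambda>r. norm (b r \<omega>))"
        using set_borel_integral_eq_integral(1)[OF sub, of s t] set_borel_integral_eq_integral(1)[OF subn, of s t] st
        by (intro integral_norm_bound_integral) auto
      also have "\<dots> = integral {0..t} (\<lambda>r. norm (b r \<omega>)) - integral {0..s} (\<lambda>r. norm (b r \<omega>))"
        using Henstock_Kurzweil_Integration.integral_combine[of 0 s t "\<lambda>r. norm (b r \<omega>)"]
          set_borel_integral_eq_integral(1)[OF subn, of 0 t] st by simp
      finally show ?thesis
        using V st by simp
    qed
    ultimately show ?case by blast
  qed
qed

lemma drift_sum_bound:
  assumes \<tau>: "partition_on_interval u v n \<tau>" "0 \<le> u" "v \<le> 1"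
    and bd: "\<And>s t. 0 \<le> s \<Longrightarrow> s \<le> t \<Longrightarrow> t \<le> 1 \<Longrightarrow>
      norm (LINT r:{s..t}|lborel. b r \<omega>) \<le> drift_variation t \<omega> - drift_variation s \<omega>"
  shows "(\<Sum>i<n. norm (dB \<tau> i \<omega>)) \<le> drift_variation 1 \<omega>"
proof -
  have "(\<Sum>i<n. norm (dB \<tau> i \<omega>)) \<le>
      (\<Sum>i<n. drift_variation (\<tau> (Suc i)) \<omega> - drift_variation (\<tau> i) \<omega>)"
  proof (intro sum_mono bd)
    fix i assume "i \<in> {..<n}"
    then show "0 \<le> \<tau> i" "\<tau> i \<le> \<tau> (Suc i)" "\<tau> (Suc i) \<le> 1"
      using partition_unit[OF \<tau>, of i] by auto
  qed
  also have "\<dots> = drift_variation v \<omega> - drift_variation u \<omega>"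
    by (rule sum_partition_telescope[OF \<tau>(1)])
  also have "\<dots> \<le> drift_variation 1 \<omega>"
  proof -
    have "0 \<le> norm (LINT r:{0..u}|lborel. b r \<omega>)" "0 \<le> norm (LINT r:{v..1}|lborel. b r \<omega>)"
      by simp_all
    moreover have "drift_variation 0 \<omega> = 0"
      unfolding drift_variation_def set_lebesgue_integral_def
    proof (rule integral_eq_zero_AE)
      show "AE r in lborel. indicator {0..0} r *\<^sub>R norm (b r \<omega>) = 0"
        using AE_lborel_singleton[of "0::real"] by eventually_elim simp
    qed
    ultimately show ?thesis
      using bd[of 0 u] bd[of v 1] partition_le[OF \<tau>(1)] \<tau>(2,3) by linarith
  qed
  finally show ?thesis .
qed

abbreviation noise_sum :: "nat \<Rightarrow> (nat \<Rightarrow> real) \<Rightarrow> 'w \<Rightarrow> 'v" where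
  "noise_sum \<equiv> left_sum (*\<^sub>R) (\<lambda>r _. \<sigma> r) W"

lemma noise_sum_inner: "noise_sum N \<pi> \<omega> \<bullet> e = (\<Sum>j<N. \<sigma> (\<pi> j) * ((W (\<pi> (Suc j)) \<omega> - W (\<pi> j) \<omega>) \<bullet> e))"
  by (simp add: left_sum_def inner_sum_left)

text \<open>The noise part of an increment is known only as a limit in probability. Replacing it by
  a sum over a partition of the cell gives a genuine martingale difference. These partitions depend
  on \<open>\<tau>\<close> and \<open>\<epsilon>\<close>, which is harmless because the moment
  bounds for noise sums do not.\<close>

lemma increment_approx:
  assumes \<tau>: "partition_on_interval u v n \<tau>" "0 \<le> u" "v \<le> 1" and "\<epsilon> > 0"
  shows "\<exists>N \<pi>. (\<forall>i<n. partition_on_interval (\<tau> i) (\<tau> (Suc i)) (N i) (\<pi> i)) \<and>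
    prob_bound \<epsilon> \<epsilon> (\<lambda>\<omega>. \<Sum>i<n. norm (dX \<tau> i \<omega>
      - dB \<tau> i \<omega> - noise_sum (N i) (\<pi> i) \<omega>))"
proof -
  \<comment> \<open>A share for each of the \<open>n\<close> cells and the spare unit demanded by
    \<open>prob_bound_sum\<close>.\<close>
  define e where "e = \<epsilon> / real (n + 1)"
  have e: "e > 0" "real (n + 1) * e = \<epsilon>"
    using \<open>\<epsilon> > 0\<close> by (auto simp: e_def field_simps)
  define R where "R i N \<pi> \<omega> = norm (dX \<tau> i \<omega>
    - dB \<tau> i \<omega> - noise_sum N \<pi> \<omega>)" for i N \<pi> \<omega>
  have "\<exists>N \<pi>. partition_on_interval (\<tau> i) (\<tau> (Suc i)) N \<pi> \<and> prob_bound e e (R i N \<pi>)" if "i < n" for i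
  proof -
    note le = partition_unit[OF \<tau> that]
    obtain I where I: "has_fwd_integral (*\<^sub>R) M (\<lambda>r _. \<sigma> r) W (\<tau> i) (\<tau> (Suc i)) I"
      "AE \<omega> in M. dX \<tau> i \<omega> = dB \<tau> i \<omega> + I \<omega>"
      using ito_process le unfolding ito_process_def by blast
    obtain \<delta> where \<delta>: "\<delta> > 0" "\<And>N \<pi>. fine_partition (\<tau> i) (\<tau> (Suc i)) \<delta> N \<pi> \<Longrightarrow>
        prob_bound e e (\<lambda>\<omega>. dist (noise_sum N \<pi> \<omega>) (I \<omega>))"
      using mesh_limitD[OF I(1)[unfolded has_fwd_integral_def]] e(1) unfolding mesh_small_def by meson
    obtain N \<pi> where fp: "fine_partition (\<tau> i) (\<tau> (Suc i)) \<delta> N \<pi>"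
      using ex_fine_partition[OF le(3) \<delta>(1)] by blast
    have "prob_bound e e (R i N \<pi>)"
    proof (rule prob_bound_AE_mono[OF \<delta>(2)[OF fp] order_refl order_refl])
      show "AE \<omega> in M. \<bar>R i N \<pi> \<omega>\<bar> \<le> \<bar>dist (noise_sum N \<pi> \<omega>) (I \<omega>)\<bar>"
        using I(2)
      proof eventually_elim
        case (elim \<omega>)
        have "R i N \<pi> \<omega> = norm (I \<omega> - noise_sum N \<pi> \<omega>)"
          unfolding R_def elim by simp
        then show ?case by (simp add: dist_norm norm_minus_commute)
      qed
    qed
    then show ?thesis
      using fp by (auto simp: fine_partition_def)
  qed
  then obtain N \<pi> where N: "\<And>i. i < n \<Longrightarrow> partition_on_interval (\<tau> i) (\<tau> (Suc i)) (N i) (\<pi> i)"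
    "\<And>i. i < n \<Longrightarrow> prob_bound e e (R i (N i) (\<pi> i))"
    by metis
  have "prob_bound (real (card {..<n} + 1) * e) (real (card {..<n}) * e) (\<lambda>\<omega>. \<Sum>i<n. R i (N i) (\<pi> i) \<omega>)"
    using N(2) e(1) by (intro prob_bound_sum) auto
  then have "prob_bound \<epsilon> \<epsilon> (\<lambda>\<omega>. \<Sum>i<n. R i (N i) (\<pi> i) \<omega>)"
    by (rule prob_bound_mono) (use e in \<open>auto simp: algebra_simps\<close>)
  then show ?thesis
    using N(1) unfolding R_def by blast
qed

section \<open>Adapted weights summed against the increments\<close>

lemma \<sigma>_bounded: "\<exists>C>0. \<forall>t\<in>{0..1}. \<bar>\<sigma> t\<bar> \<le> C"
proof -
  have "bounded (\<sigma> ` {0..1})"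
    by (intro compact_imp_bounded compact_continuous_image \<sigma>_continuous) auto
  then show ?thesis
    unfolding bounded_pos by auto
qed

lemma noise_sum_mart_diff:
  assumes "partition_on_interval s t N \<pi>" "0 \<le> s" "t \<le> 1" "e \<in> Basis" "\<And>r. r \<in> {0..1} \<Longrightarrow> \<bar>\<sigma> r\<bar> \<le> C"
  shows "mart_diff (F s) (\<lambda>\<omega>. noise_sum N \<pi> \<omega> \<bullet> e) (C\<^sup>2 * (t - s))"
    and "(\<lambda>\<omega>. noise_sum N \<pi> \<omega> \<bullet> e) \<in> borel_measurable (F t)"
proof -
  have "\<bar>\<sigma> (\<pi> j)\<bar> \<le> C" if "j < N" for j
    using assms(5)[of "\<pi> j"] partition_in_interval[OF assms(1), of j] that assms(2,3) by auto
  then show "mart_diff (F s) (\<lambda>\<omega>. noise_sum N \<pi> \<omega> \<bullet> e) (C\<^sup>2 * (t - s))"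
    "(\<lambda>\<omega>. noise_sum N \<pi> \<omega> \<bullet> e) \<in> borel_measurable (F t)"
    unfolding noise_sum_inner using W_sum_mart_diff[OF assms(1-4), of "\<lambda>j. \<sigma> (\<pi> j)" C] by auto
qed

text \<open>The three parts of an increment are estimated separately: the drift by
  \<open>\<kappa>\<close> times its total variation, the noise by a second moment of size
  \<open>(\<kappa> * C)\<^sup>2\<close>, the approximation error by the bound 1 on the weights. What
  matters later is that \<open>\<kappa>\<close> is chosen before the interval, the partition and the
  weights.\<close>

lemma good_integrator:
  assumes "\<epsilon> > 0"
  shows "\<exists>\<kappa>>0. \<forall>u v n \<tau> \<eta> e. 0 \<le> u \<and> v \<le> 1 \<and> partition_on_interval u v n \<tau> \<and> e \<in> Basis \<and>
    (\<forall>i<n. \<eta> i \<in> borel_measurable (F (\<tau> i)) \<and> (\<forall>\<omega>. \<bar>\<eta> i \<omega>\<bar> \<le> \<kappa>)) \<longrightarrow>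
    prob_bound \<epsilon> \<epsilon> (\<lambda>\<omega>. \<Sum>i<n. \<eta> i \<omega> * ((dX \<tau> i \<omega>) \<bullet> e))"
proof -
  obtain C where C: "C > 0" "\<And>t. t \<in> {0..1} \<Longrightarrow> \<bar>\<sigma> t\<bar> \<le> C"
    using \<sigma>_bounded by blast
  obtain L where L: "L > 0" "prob_bound (\<epsilon> / 4) L (drift_variation 1)"
    using random_variable_tight[OF drift_variation_measurable, of 1 "\<epsilon> / 4"] \<open>\<epsilon> > 0\<close> by auto
  \<comment> \<open>The square of \<open>q\<close> is half of the second moment that Chebyshev
    admits for probability and size \<open>\<epsilon> / 4\<close>, so that the required inequality
    is strict.\<close>
  define q where "q = sqrt ((\<epsilon> / 4) * (\<epsilon> / 4)\<^sup>2 / 2)"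
  have q: "q > 0" "q\<^sup>2 < (\<epsilon> / 4) * (\<epsilon> / 4)\<^sup>2"
    using \<open>\<epsilon> > 0\<close> by (auto simp: q_def)
  \<comment> \<open>One entry for each part: approximation error, drift, noise.\<close>
  define \<kappa> where "\<kappa> = min 1 (min (\<epsilon> / (4 * L)) (q / C))"
  have "\<kappa> > 0" "\<kappa> \<le> 1" "\<kappa> \<le> \<epsilon> / (4 * L)" "\<kappa> \<le> q / C"
    using \<open>\<epsilon> > 0\<close> L(1) C(1) q(1) by (auto simp: \<kappa>_def)
  then have \<kappa>: "\<kappa> > 0" "\<kappa> \<le> 1" "\<kappa> * L \<le> \<epsilon> / 4" "\<kappa> * C \<le> q"
    using L(1) C(1) by (auto simp: field_simps)
  have "prob_bound \<epsilon> \<epsilon> (\<lambda>\<omega>. \<Sum>i<n. \<eta> i \<omega> * ((dX \<tau> i \<omega>) \<bullet> e))"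
    if uv: "0 \<le> u" "v \<le> 1" and \<tau>: "partition_on_interval u v n \<tau>" and e: "e \<in> Basis"
      and \<eta>: "\<And>i. i < n \<Longrightarrow> \<eta> i \<in> borel_measurable (F (\<tau> i))" "\<And>i \<omega>. i < n \<Longrightarrow> \<bar>\<eta> i \<omega>\<bar> \<le> \<kappa>"
    for u v n \<tau> \<eta> e
  proof -
    have \<epsilon>4: "\<epsilon> / 4 > 0" using \<open>\<epsilon> > 0\<close> by simp
    obtain N \<pi> where N: "\<forall>i<n. partition_on_interval (\<tau> i) (\<tau> (Suc i)) (N i) (\<pi> i)"
      "prob_bound (\<epsilon>/4) (\<epsilon>/4) (\<lambda>\<omega>. \<Sum>i<n. norm (dX \<tau> i \<omega> - dB \<tau> i \<omega> - noise_sum (N i) (\<pi> i) \<omega>))"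
      using increment_approx[OF \<tau> uv \<epsilon>4] by blast
    have \<tau>01: "0 \<le> \<tau> i \<and> \<tau> i \<le> 1" if "i \<le> n" for i
      using partition_in_interval[OF \<tau> that] uv by auto
    have drift: "prob_bound (\<epsilon>/4) (\<epsilon>/4) (\<lambda>\<omega>. \<Sum>i<n. \<eta> i \<omega> * (dB \<tau> i \<omega> \<bullet> e))"
    proof (rule prob_bound_AE_mono)
      show "prob_bound (\<epsilon>/4 / 2 + \<epsilon>/4 / 2) (\<kappa> * L) (\<lambda>\<omega>. \<kappa> * drift_variation 1 \<omega>)"
      proof -
        obtain A where A: "A \<in> events" "prob A < \<epsilon> / 4" "\<And>\<omega>. \<omega> \<in> space M \<Longrightarrow> \<omega> \<notin> A \<Longrightarrow> \<bar>drift_variation 1 \<omega>\<bar> \<le> L"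
          using prob_boundE[OF L(2)] by blast
        show ?thesis
          by (rule prob_boundI[OF A(1)]) (use A(2,3) \<kappa>(1) in \<open>auto simp: abs_mult\<close>)
      qed
      show "AE \<omega> in M. \<bar>\<Sum>i<n. \<eta> i \<omega> * (dB \<tau> i \<omega> \<bullet> e)\<bar> \<le> \<bar>\<kappa> * drift_variation 1 \<omega>\<bar>"
        using drift_bounds
      proof eventually_elim
        case (elim \<omega>)
        have "\<bar>\<Sum>i<n. \<eta> i \<omega> * (dB \<tau> i \<omega> \<bullet> e)\<bar> \<le> (\<Sum>i<n. \<kappa> * norm (dB \<tau> i \<omega>))"
        proof (intro order_trans[OF sum_abs] sum_mono)
          fix i assume "i \<in> {..<n}"
          then show "\<bar>\<eta> i \<omega> * (dB \<tau> i \<omega> \<bullet> e)\<bar> \<le> \<kappa> * norm (dB \<tau> i \<omega>)"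
            unfolding abs_mult using \<eta>(2) Basis_le_norm[OF e] \<kappa>(1) by (intro mult_mono) auto
        qed
        also have "\<dots> \<le> \<kappa> * drift_variation 1 \<omega>"
          unfolding sum_distrib_left[symmetric]
          using drift_sum_bound[OF \<tau> uv, of \<omega>] elim \<kappa>(1) by (intro mult_left_mono) auto
        finally show ?case by simp
      qed
    qed (use \<kappa>(3) in auto)
    have noise: "prob_bound (\<epsilon>/4) (\<epsilon>/4) (\<lambda>\<omega>. \<Sum>i<n. \<eta> i \<omega> * (noise_sum (N i) (\<pi> i) \<omega> \<bullet> e))"
    proof -
      have md: "mart_diff (F (\<tau> i)) (\<lambda>\<omega>. noise_sum (N i) (\<pi> i) \<omega> \<bullet> e) (C\<^sup>2 * (\<tau> (Suc i) - \<tau> i))"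
        "(\<lambda>\<omega>. noise_sum (N i) (\<pi> i) \<omega> \<bullet> e) \<in> borel_measurable (F (\<tau> (Suc i)))" if "i < n" for i
        using noise_sum_mart_diff[of "\<tau> i" "\<tau> (Suc i)" "N i" "\<pi> i" e C] N(1) \<tau>01[of i] \<tau>01[of "Suc i"] e C(2) that
        by auto
      note m = martingale_transform_second_moment[where \<zeta>=\<eta> and K=\<kappa>, OF \<tau> uv md(2) md(1) \<eta>]
      have "(\<Sum>i<n. C\<^sup>2 * (\<tau> (Suc i) - \<tau> i)) = C\<^sup>2 * (v - u)"
        using sum_partition_telescope[OF \<tau>, of "\<lambda>x. x"] by (simp add: sum_distrib_left[symmetric])
      also have "\<dots> \<le> C\<^sup>2 * 1"
        using uv by (intro mult_left_mono) auto
      finally have "\<kappa>\<^sup>2 * (\<Sum>i<n. C\<^sup>2 * (\<tau> (Suc i) - \<tau> i)) \<le> (\<kappa> * C)\<^sup>2"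
        unfolding power_mult_distrib by (intro mult_left_mono) auto
      also have "\<dots> \<le> q\<^sup>2"
        using \<kappa>(1,4) C(1) by (intro power_mono) auto
      finally have "\<kappa>\<^sup>2 * (\<Sum>i<n. C\<^sup>2 * (\<tau> (Suc i) - \<tau> i)) < (\<epsilon> / 4) * (\<epsilon> / 4)\<^sup>2"
        using q(2) by linarith
      then show ?thesis
        by (intro prob_bound_second_moment \<epsilon>4 m(1,2) le_less_trans[OF m(3)]) auto
    qed
    have rest: "prob_bound (\<epsilon>/4) (\<epsilon>/4) (\<lambda>\<omega>. \<Sum>i<n. \<eta> i \<omega> *
        ((dX \<tau> i \<omega> - dB \<tau> i \<omega> - noise_sum (N i) (\<pi> i) \<omega>) \<bullet> e))"
    proof (rule prob_bound_AE_mono[OF N(2) order_refl order_refl AE_I2])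
      fix \<omega>
      let ?r = "\<lambda>i. dX \<tau> i \<omega> - dB \<tau> i \<omega> - noise_sum (N i) (\<pi> i) \<omega>"
      have "\<bar>\<Sum>i<n. \<eta> i \<omega> * (?r i \<bullet> e)\<bar> \<le> (\<Sum>i<n. 1 * norm (?r i))"
      proof (intro order_trans[OF sum_abs] sum_mono)
        fix i assume "i \<in> {..<n}"
        then have "\<bar>\<eta> i \<omega>\<bar> \<le> 1"
          using \<eta>(2)[of i \<omega>] \<kappa>(2) by simp
        then show "\<bar>\<eta> i \<omega> * (?r i \<bullet> e)\<bar> \<le> 1 * norm (?r i)"
          unfolding abs_mult using Basis_le_norm[OF e] by (intro mult_mono) auto
      qed
      also have "\<dots> \<le> \<bar>\<Sum>i<n. norm (?r i)\<bar>"
        by simp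
      finally show "\<bar>\<Sum>i<n. \<eta> i \<omega> * (?r i \<bullet> e)\<bar> \<le> \<bar>\<Sum>i<n. norm (?r i)\<bar>" .
    qed
    have "prob_bound (\<epsilon>/4 + \<epsilon>/4 + \<epsilon>/4) (\<epsilon>/4 + \<epsilon>/4 + \<epsilon>/4) (\<lambda>\<omega>. (\<Sum>i<n. \<eta> i \<omega> * (dB \<tau> i \<omega> \<bullet> e)) +
        (\<Sum>i<n. \<eta> i \<omega> * (noise_sum (N i) (\<pi> i) \<omega> \<bullet> e)) + (\<Sum>i<n. \<eta> i \<omega> *
        ((dX \<tau> i \<omega> - dB \<tau> i \<omega> - noise_sum (N i) (\<pi> i) \<omega>) \<bullet> e)))"
      by (intro prob_bound_add drift noise rest)
    then show ?thesis
      by (rule prob_bound_AE_mono)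
         (use \<open>\<epsilon> > 0\<close> in \<open>auto simp: sum.distrib[symmetric] algebra_simps inner_diff_left\<close>)
  qed
  then show ?thesis
    using \<kappa>(1) by blast
qed

lemma clipped_measurable:
  "Z \<in> borel_measurable N \<Longrightarrow> (\<lambda>\<omega>. max (- \<kappa>) (min \<kappa> (Z \<omega>)) :: real) \<in> borel_measurable N"
  by (intro borel_measurable_max borel_measurable_min borel_measurable_const)

text \<open>Weights coming from a path are small only off an event. Half of the budget is reserved
  for \<open>A\<close>; the other half is shared by the coordinates, to each of which the integrator
  property is applied, and one spare unit.\<close>

lemma sum_against_increments_small:
  assumes "\<epsilon> > 0"
  shows "\<exists>\<kappa>>0. \<forall>u v n \<tau> \<eta> A. 0 \<le> u \<and> v \<le> 1 \<and> partition_on_interval u v n \<tau> \<and>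
    (\<forall>i<n. \<eta> i \<in> borel_measurable (F (\<tau> i))) \<and> A \<in> events \<and> prob A < \<epsilon> / 2 \<and>
    (\<forall>i<n. \<forall>\<omega>\<in>space M - A. norm (\<eta> i \<omega>) \<le> \<kappa>) \<longrightarrow>
    prob_bound \<epsilon> \<epsilon> (\<lambda>\<omega>. \<Sum>i<n. \<eta> i \<omega> \<bullet> (dX \<tau> i \<omega>))"
proof -
  define e where "e = \<epsilon> / (2 * real (DIM('v) + 1))"
  have e: "e > 0" "real (DIM('v) + 1) * e = \<epsilon> / 2"
    using \<open>\<epsilon> > 0\<close> by (auto simp: e_def field_simps)
  obtain \<kappa> where \<kappa>: "\<kappa> > 0" "\<And>u v n \<tau> \<eta> i. 0 \<le> u \<Longrightarrow> v \<le> 1 \<Longrightarrow> partition_on_interval u v n \<tau> \<Longrightarrow> i \<in> Basis \<Longrightarrow>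
    (\<forall>i<n. \<eta> i \<in> borel_measurable (F (\<tau> i)) \<and> (\<forall>\<omega>. \<bar>\<eta> i \<omega>\<bar> \<le> \<kappa>)) \<Longrightarrow>
    prob_bound e e (\<lambda>\<omega>. \<Sum>k<n. \<eta> k \<omega> * ((dX \<tau> k \<omega>) \<bullet> i))"
    using good_integrator[OF e(1)] by blast
  have "prob_bound \<epsilon> \<epsilon> (\<lambda>\<omega>. \<Sum>i<n. \<eta> i \<omega> \<bullet> (dX \<tau> i \<omega>))"
    if uv: "0 \<le> u" "v \<le> 1" and \<tau>: "partition_on_interval u v n \<tau>"
      and \<eta>: "\<forall>i<n. \<eta> i \<in> borel_measurable (F (\<tau> i))" and A: "A \<in> events" "prob A < \<epsilon> / 2"
      and bd: "\<forall>i<n. \<forall>\<omega>\<in>space M - A. norm (\<eta> i \<omega>) \<le> \<kappa>"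
    for u v n \<tau> \<eta> A
  proof -
    \<comment> \<open>Clipping keeps the weights adapted and makes the bound hold everywhere; off \<open>A\<close> it changes nothing.\<close>
    define \<zeta> where "\<zeta> e k \<omega> = max (- \<kappa>) (min \<kappa> (\<eta> k \<omega> \<bullet> e))" for e k \<omega>
    have "prob_bound (real (card (Basis :: 'v set) + 1) * e) (real (card (Basis :: 'v set)) * e)
        (\<lambda>\<omega>. \<Sum>i\<in>Basis. \<Sum>k<n. \<zeta> i k \<omega> * ((dX \<tau> k \<omega>) \<bullet> i))"
    proof (intro prob_bound_sum \<kappa>(2)[OF uv \<tau>] allI impI conjI e(1))
      fix i k assume "k < n"
      then show "\<zeta> i k \<in> borel_measurable (F (\<tau> k))"
        unfolding \<zeta>_def using \<eta> by (intro clipped_measurable) auto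
      show "\<bar>\<zeta> i k \<omega>\<bar> \<le> \<kappa>" for \<omega>
        using \<kappa>(1) by (auto simp: \<zeta>_def)
    qed auto
    then have "prob_bound (\<epsilon>/2) \<epsilon> (\<lambda>\<omega>. \<Sum>i\<in>Basis. \<Sum>k<n. \<zeta> i k \<omega> * ((dX \<tau> k \<omega>) \<bullet> i))"
      by (rule prob_bound_mono) (use e \<open>\<epsilon> > 0\<close> in \<open>auto simp: algebra_simps\<close>)
    then have "prob_bound (\<epsilon>/2 + \<epsilon>/2) \<epsilon> (\<lambda>\<omega>. \<Sum>i<n. \<eta> i \<omega> \<bullet> (dX \<tau> i \<omega>))"
    proof (rule prob_bound_localize[OF _ A])
      fix \<omega> assume \<omega>: "\<omega> \<in> space M" "\<omega> \<notin> A"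
      have \<zeta>: "\<zeta> i k \<omega> = \<eta> k \<omega> \<bullet> i" if "i \<in> Basis" "k < n" for i k
        using Basis_le_norm[OF that(1), of "\<eta> k \<omega>"] bd that(2) \<omega> by (force simp: \<zeta>_def)
      have "(\<Sum>k<n. \<eta> k \<omega> \<bullet> (dX \<tau> k \<omega>)) =
          (\<Sum>k<n. \<Sum>i\<in>Basis. (\<eta> k \<omega> \<bullet> i) * ((dX \<tau> k \<omega>) \<bullet> i))"
        by (subst euclidean_inner) simp
      also have "\<dots> = (\<Sum>i\<in>Basis. \<Sum>k<n. (\<eta> k \<omega> \<bullet> i) * ((dX \<tau> k \<omega>) \<bullet> i))"
        by (rule sum.swap)
      also have "\<dots> = (\<Sum>i\<in>Basis. \<Sum>k<n. \<zeta> i k \<omega> * ((dX \<tau> k \<omega>) \<bullet> i))"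
        using \<zeta> by (intro sum.cong refl) auto
      finally show "\<bar>\<Sum>i<n. \<eta> i \<omega> \<bullet> (dX \<tau> i \<omega>)\<bar> \<le>
          \<bar>\<Sum>i\<in>Basis. \<Sum>k<n. \<zeta> i k \<omega> * ((dX \<tau> k \<omega>) \<bullet> i)\<bar>"
        by simp
    qed
    then show ?thesis by simp
  qed
  then show ?thesis
    using \<kappa>(1) by blast
qed

text \<open>On the common refinement two Riemann sums differ by a sum whose weight on cell
  \<open>k\<close> is the difference of \<open>h\<close> at two coarse points. Neither point exceeds
  \<open>\<rho> k\<close>, so the weight is adapted, and the modulus of continuity of
  \<open>h\<close> makes it small.\<close>

theorem fwd_integrable_continuous:
  assumes h: "\<And>t. t \<in> {0..1} \<Longrightarrow> h t \<in> borel_measurable (F t)"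
    and cont: "AE \<omega> in M. continuous_on {0..1} (\<lambda>t. h t \<omega>)"
    and uv: "0 \<le> u" "u \<le> v" "v \<le> 1"
  shows "fwd_integrable (\<bullet>) M h X u v"
  unfolding fwd_integrable_def has_fwd_integral_def
proof (rule mesh_limit_Cauchy[OF uv(2)])
  fix n \<tau> assume \<tau>: "partition_on_interval u v n \<tau>"
  show "left_sum (\<bullet>) h X n \<tau> \<in> borel_measurable M"
    unfolding left_sum_def
  proof (intro borel_measurable_sum borel_measurable_inner borel_measurable_diff)
    fix i assume "i \<in> {..<n}"
    then have "\<tau> i \<in> {0..1}" "\<tau> (Suc i) \<in> {0..1}"
      using partition_in_interval[OF \<tau>, of i] partition_in_interval[OF \<tau>, of "Suc i"] uv by auto
    then show "h (\<tau> i) \<in> borel_measurable M" "X (\<tau> i) \<in> borel_measurable M" "X (\<tau> (Suc i)) \<in> borel_measurable M"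
      using F_measurable_M[OF h] X_measurable by auto
  qed
next
  fix \<epsilon> :: real assume "\<epsilon> > 0"
  then obtain \<kappa> where \<kappa>: "\<kappa> > 0" "\<And>n \<tau> \<eta> A. partition_on_interval u v n \<tau> \<Longrightarrow>
    (\<forall>i<n. \<eta> i \<in> borel_measurable (F (\<tau> i))) \<Longrightarrow> A \<in> events \<Longrightarrow> prob A < \<epsilon> / 2 \<Longrightarrow>
    (\<forall>i<n. \<forall>\<omega>\<in>space M - A. norm (\<eta> i \<omega>) \<le> \<kappa>) \<Longrightarrow>
    prob_bound \<epsilon> \<epsilon> (\<lambda>\<omega>. \<Sum>i<n. \<eta> i \<omega> \<bullet> (dX \<tau> i \<omega>))"
    using sum_against_increments_small[of \<epsilon>] uv by blast
  obtain \<delta> A where \<delta>: "\<delta> > 0" and A: "A \<in> events" "prob A < \<epsilon> / 2"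
    "\<forall>\<omega>\<in>space M - A. \<forall>s\<in>{0..1}. \<forall>t\<in>{0..1}. \<bar>s - t\<bar> < \<delta> \<longrightarrow> dist (h s \<omega>) (h t \<omega>) \<le> \<kappa>"
    using process_modulus[OF F_measurable_M[OF h] cont, of "\<epsilon> / 2" \<kappa>] \<open>\<epsilon> > 0\<close> \<kappa>(1) by auto
  have "prob_bound \<epsilon> \<epsilon> (\<lambda>\<omega>. dist (left_sum (\<bullet>) h X n \<tau> \<omega>) (left_sum (\<bullet>) h X n' \<tau>' \<omega>))"
    if \<tau>: "fine_partition u v \<delta> n \<tau>" and \<tau>': "fine_partition u v \<delta> n' \<tau>'" for n \<tau> n' \<tau>'
  proof -
    obtain m \<rho> c c' where \<rho>: "partition_on_interval u v m \<rho>"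
      and c: "\<forall>k<m. c k < n \<and> \<tau> (c k) \<le> \<rho> k \<and> \<rho> k < \<tau> (c k) + \<delta>"
      and c': "\<forall>k<m. c' k < n' \<and> \<tau>' (c' k) \<le> \<rho> k \<and> \<rho> k < \<tau>' (c' k) + \<delta>"
      and S: "\<forall>h x. (\<Sum>i<n. h (\<tau> i) \<bullet> (x (\<tau> (Suc i)) - x (\<tau> i))) =
        (\<Sum>k<m. h (\<tau> (c k)) \<bullet> (x (\<rho> (Suc k)) - (x (\<rho> k) :: 'v)))"
      and S': "\<forall>h x. (\<Sum>i<n'. h (\<tau>' i) \<bullet> (x (\<tau>' (Suc i)) - x (\<tau>' i))) =
        (\<Sum>k<m. h (\<tau>' (c' k)) \<bullet> (x (\<rho> (Suc k)) - (x (\<rho> k) :: 'v)))"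
      using common_refinement[OF \<tau> \<tau>', where 'v='v] by blast
    have t01: "\<tau> (c k) \<in> {0..1}" "\<tau>' (c' k) \<in> {0..1}" if "k < m" for k
      using partition_in_interval[of u v n \<tau> "c k"] partition_in_interval[of u v n' \<tau>' "c' k"]
        c c' that \<tau> \<tau>' uv by (auto simp: fine_partition_def)
    have "prob_bound \<epsilon> \<epsilon> (\<lambda>\<omega>. \<Sum>k<m. (h (\<tau> (c k)) \<omega> - h (\<tau>' (c' k)) \<omega>) \<bullet> (dX \<rho> k \<omega>))"
    proof (rule \<kappa>(2)[OF \<rho> _ A(1,2)])
      show "\<forall>k<m. (\<lambda>\<omega>. h (\<tau> (c k)) \<omega> - h (\<tau>' (c' k)) \<omega>) \<in> borel_measurable (F (\<rho> k))"
        using F_measurable_mono[OF h] t01 c c' by auto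
      show "\<forall>k<m. \<forall>\<omega>\<in>space M - A. norm (h (\<tau> (c k)) \<omega> - h (\<tau>' (c' k)) \<omega>) \<le> \<kappa>"
      proof (intro allI impI ballI)
        fix k \<omega> assume k: "k < m" and \<omega>: "\<omega> \<in> space M - A"
        \<comment> \<open>Both coarse points lie at distance less than \<open>\<delta>\<close> to
          the left of \<open>\<rho> k\<close>, possibly at \<open>\<rho> k\<close> itself.\<close>
        have "\<bar>\<tau> (c k) - \<tau>' (c' k)\<bar> < \<delta>"
          using c[rule_format, OF k] c'[rule_format, OF k] by linarith
        then show "norm (h (\<tau> (c k)) \<omega> - h (\<tau>' (c' k)) \<omega>) \<le> \<kappa>"
          using A(3) \<omega> t01[OF k] by (auto simp: dist_norm)
      qed
    qed
    moreover have "dist (left_sum (\<bullet>) h X n \<tau> \<omega>) (left_sum (\<bullet>) h X n' \<tau>' \<omega>) =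
      \<bar>\<Sum>k<m. (h (\<tau> (c k)) \<omega> - h (\<tau>' (c' k)) \<omega>) \<bullet> (dX \<rho> k \<omega>)\<bar>" for \<omega>
      unfolding left_sum_def dist_real_def
      using S[rule_format, of "\<lambda>t. h t \<omega>" "\<lambda>t. X t \<omega>"] S'[rule_format, of "\<lambda>t. h t \<omega>" "\<lambda>t. X t \<omega>"]
      by (simp add: inner_diff_left sum_subtractf)
    ultimately show ?thesis
      unfolding prob_bound_def by simp
  qed
  then show "\<exists>\<delta>>0. \<forall>n \<tau> n' \<tau>'. fine_partition u v \<delta> n \<tau> \<longrightarrow> fine_partition u v \<delta> n' \<tau>' \<longrightarrow>
      prob_bound \<epsilon> \<epsilon> (\<lambda>\<omega>. dist (left_sum (\<bullet>) h X n \<tau> \<omega>) (left_sum (\<bullet>) h X n' \<tau>' \<omega>))"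
    using \<delta> by blast
qed

end

section \<open>Quadratic covariation\<close>

lemma sum_squares_le_square_sum:
  fixes x :: "nat \<Rightarrow> real"
  assumes "\<And>i. i < n \<Longrightarrow> 0 \<le> x i"
  shows "(\<Sum>i<n. (x i)\<^sup>2) \<le> (\<Sum>i<n. x i)\<^sup>2"
proof -
  have "(\<Sum>i<n. x i * x i) \<le> (\<Sum>i<n. x i * (\<Sum>j<n. x j))"
    using assms by (intro sum_mono mult_left_mono member_le_sum) auto
  then show ?thesis
    by (simp add: power2_eq_square sum_distrib_right)
qed

lemma norm_square_Basis: "(norm (x::'c::euclidean_space))\<^sup>2 = (\<Sum>e\<in>Basis. (x \<bullet> e)\<^sup>2)"
  by (subst power2_norm_eq_inner, subst euclidean_inner) (simp add: power2_eq_square)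

lemma Riemann_sum_error:
  fixes f :: "real \<Rightarrow> real"
  assumes f: "continuous_on {0..1} f" and uv: "0 \<le> u" "v \<le> 1"
    and mod: "\<And>s t. s \<in> {0..1} \<Longrightarrow> t \<in> {0..1} \<Longrightarrow> \<bar>s - t\<bar> < \<delta> \<Longrightarrow> dist (f s) (f t) \<le> \<kappa>"
    and \<tau>: "fine_partition u v \<delta> n \<tau>" and "\<kappa> \<ge> 0"
  shows "\<bar>(\<Sum>i<n. f (\<tau> i) * (\<tau> (Suc i) - \<tau> i)) - (LINT s:{u..v}|lborel. f s)\<bar> \<le> \<kappa>"
proof -
  have part: "partition_on_interval u v n \<tau>"
    using \<tau> by (simp add: fine_partition_def)
  have uv': "u \<le> v" by (rule partition_le[OF part])
  have fi: "f integrable_on {s..t}" if "u \<le> s" "t \<le> v" for s t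
    by (intro integrable_continuous_real continuous_on_subset[OF f]) (use that uv in auto)
  define g where "g t = integral {u..t} f" for t
  have \<tau>uv: "\<tau> i \<in> {u..v}" if "i \<le> n" for i
    by (rule partition_in_interval[OF part that])
  have step: "\<bar>f (\<tau> i) * (\<tau> (Suc i) - \<tau> i) - (g (\<tau> (Suc i)) - g (\<tau> i))\<bar> \<le> \<kappa> * (\<tau> (Suc i) - \<tau> i)" if "i < n" for i
  proof -
    have le: "\<tau> i \<le> \<tau> (Suc i)" "\<tau> (Suc i) - \<tau> i < \<delta>"
      using that \<tau> part by (auto simp: partition_on_interval_def fine_partition_def)
    have bds: "\<tau> i \<in> {u..v}" "\<tau> (Suc i) \<in> {u..v}"
      using \<tau>uv that by auto
    have "g (\<tau> (Suc i)) - g (\<tau> i) = integral {\<tau> i..\<tau> (Suc i)} f"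
      unfolding g_def using Henstock_Kurzweil_Integration.integral_combine[of u "\<tau> i" "\<tau> (Suc i)" f] bds le(1) fi[of u "\<tau> (Suc i)"]
      by auto
    then have "f (\<tau> i) * (\<tau> (Suc i) - \<tau> i) - (g (\<tau> (Suc i)) - g (\<tau> i)) = integral {\<tau> i..\<tau> (Suc i)} (\<lambda>s. f (\<tau> i) - f s)"
      using fi[of "\<tau> i" "\<tau> (Suc i)"] bds le(1) by (subst Henstock_Kurzweil_Integration.integral_diff) auto
    also have "norm \<dots> \<le> \<kappa> * (\<tau> (Suc i) - \<tau> i)"
    proof (rule integral_bound[OF le(1)])
      show "continuous_on {\<tau> i..\<tau> (Suc i)} (\<lambda>s. f (\<tau> i) - f s)"
        by (intro continuous_intros continuous_on_subset[OF f]) (use bds uv in auto)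
      show "norm (f (\<tau> i) - f s) \<le> \<kappa>" if "s \<in> {\<tau> i..\<tau> (Suc i)}" for s
        using mod[of "\<tau> i" s] that bds le uv by (auto simp: dist_real_def)
    qed
    finally show ?thesis by simp
  qed
  have "(LINT s:{u..v}|lborel. f s) = integral {u..v} f"
    by (rule set_borel_integral_eq_integral(2)[OF borel_integrable_atLeastAtMost'])
       (intro continuous_on_subset[OF f], use uv in auto)
  also have "\<dots> = (\<Sum>i<n. g (\<tau> (Suc i)) - g (\<tau> i))"
    using sum_partition_telescope[OF part, of g] by (simp add: g_def)
  finally have "\<bar>(\<Sum>i<n. f (\<tau> i) * (\<tau> (Suc i) - \<tau> i)) - (LINT s:{u..v}|lborel. f s)\<bar> =
      \<bar>\<Sum>i<n. f (\<tau> i) * (\<tau> (Suc i) - \<tau> i) - (g (\<tau> (Suc i)) - g (\<tau> i))\<bar>"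
    by (simp add: sum_subtractf)
  also have "\<dots> \<le> (\<Sum>i<n. \<kappa> * (\<tau> (Suc i) - \<tau> i))"
    by (intro order_trans[OF sum_abs] sum_mono step) auto
  also have "\<dots> = \<kappa> * (v - u)"
    using sum_partition_telescope[OF part, of "\<lambda>x. x"] by (simp add: sum_distrib_left[symmetric])
  also have "\<dots> \<le> \<kappa> * 1"
    using uv \<open>\<kappa> \<ge> 0\<close> by (intro mult_left_mono) auto
  finally show ?thesis by simp
qed

section \<open>Square sums of the noise, the drift and their remainder\<close>

context ito
begin

text \<open>The diffusion coefficient is frozen at the left endpoint; what remains is the drift and
  the error of freezing, both negligible in square sum.\<close>

definition residual :: "(nat \<Rightarrow> real) \<Rightarrow> nat \<Rightarrow> 'w \<Rightarrow> 'v" where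
  "residual \<tau> i \<omega> = dX \<tau> i \<omega> - \<sigma> (\<tau> i) *\<^sub>R dW \<tau> i \<omega>"

text \<open>The error is again a weighted sum of Brownian increments, with coefficients
  \<open>\<sigma> (\<pi> j) - \<sigma> s\<close> of size at most \<open>\<kappa>\<close>.\<close>

lemma noise_error_square:
  assumes \<pi>: "partition_on_interval s t N \<pi>" "0 \<le> s" "t \<le> 1"
    and \<kappa>: "\<And>r. r \<in> {s..t} \<Longrightarrow> \<bar>\<sigma> r - \<sigma> s\<bar> \<le> \<kappa>"
  shows "integrable M (\<lambda>\<omega>. (norm (noise_sum N \<pi> \<omega> - \<sigma> s *\<^sub>R (W t \<omega> - W s \<omega>)))\<^sup>2)"
    and "expectation (\<lambda>\<omega>. (norm (noise_sum N \<pi> \<omega> - \<sigma> s *\<^sub>R (W t \<omega> - W s \<omega>)))\<^sup>2) \<le> real DIM('v) * (\<kappa>\<^sup>2 * (t - s))"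
proof -
  let ?E = "\<lambda>e \<omega>. \<Sum>j<N. (\<sigma> (\<pi> j) - \<sigma> s) * ((W (\<pi> (Suc j)) \<omega> - W (\<pi> j) \<omega>) \<bullet> e)"
  have "\<bar>\<sigma> (\<pi> j) - \<sigma> s\<bar> \<le> \<kappa>" if "j < N" for j
    using \<kappa> partition_in_interval[OF \<pi>(1), of j] that by auto
  then have md: "mart_diff (F s) (?E e) (\<kappa>\<^sup>2 * (t - s))" if "e \<in> Basis" for e
    using W_sum_mart_diff(1)[OF \<pi> that, of "\<lambda>j. \<sigma> (\<pi> j) - \<sigma> s" \<kappa>] by simp
  \<comment> \<open>Testing \<open>mart_diff\<close> with the constant 1 turns the conditional
    moment bound into an unconditional one.\<close>
  have one: "(\<lambda>_. 1::real) \<in> borel_measurable (F s)" "integrable M (\<lambda>_. 1::real)" "\<And>\<omega>::'w. 0 \<le> (1::real)"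
    by simp_all
  have E: "integrable M (\<lambda>\<omega>. (?E e \<omega>)\<^sup>2)" "expectation (\<lambda>\<omega>. (?E e \<omega>)\<^sup>2) \<le> \<kappa>\<^sup>2 * (t - s)" if "e \<in> Basis" for e
    using mart_diffD(5,6)[OF md[OF that] one]
    by (simp_all only: mult_1 lebesgue_integral_const prob_space scaleR_one mult_1_right)
  have "(noise_sum N \<pi> \<omega> - \<sigma> s *\<^sub>R (W t \<omega> - W s \<omega>)) \<bullet> e = ?E e \<omega>" for \<omega> e
  proof -
    have tel: "(W t \<omega> - W s \<omega>) \<bullet> e = (\<Sum>j<N. (W (\<pi> (Suc j)) \<omega> - W (\<pi> j) \<omega>) \<bullet> e)"
      unfolding sum_partition_telescope[OF \<pi>(1), of "\<lambda>r. W r \<omega>", symmetric] by (rule inner_sum_left)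
    have "(noise_sum N \<pi> \<omega> - \<sigma> s *\<^sub>R (W t \<omega> - W s \<omega>)) \<bullet> e = noise_sum N \<pi> \<omega> \<bullet> e - \<sigma> s * ((W t \<omega> - W s \<omega>) \<bullet> e)"
      by (simp add: inner_diff_left)
    then show ?thesis
      unfolding tel noise_sum_inner by (simp only: sum_distrib_left sum_subtractf[symmetric] left_diff_distrib)
  qed
  then have eq: "(norm (noise_sum N \<pi> \<omega> - \<sigma> s *\<^sub>R (W t \<omega> - W s \<omega>)))\<^sup>2 = (\<Sum>e\<in>Basis. (?E e \<omega>)\<^sup>2)" for \<omega>
    by (simp add: norm_square_Basis)
  show "integrable M (\<lambda>\<omega>. (norm (noise_sum N \<pi> \<omega> - \<sigma> s *\<^sub>R (W t \<omega> - W s \<omega>)))\<^sup>2)"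
    unfolding eq using E(1) by (intro Bochner_Integration.integrable_sum) auto
  have "expectation (\<lambda>\<omega>. \<Sum>e\<in>Basis. (?E e \<omega>)\<^sup>2) = (\<Sum>e\<in>Basis. expectation (\<lambda>\<omega>. (?E e \<omega>)\<^sup>2))"
    using E(1) by (intro Bochner_Integration.integral_sum) auto
  also have "\<dots> \<le> (\<Sum>e\<in>(Basis::'v set). \<kappa>\<^sup>2 * (t - s))"
    using E(2) by (intro sum_mono) auto
  finally show "expectation (\<lambda>\<omega>. (norm (noise_sum N \<pi> \<omega> - \<sigma> s *\<^sub>R (W t \<omega> - W s \<omega>)))\<^sup>2) \<le> real DIM('v) * (\<kappa>\<^sup>2 * (t - s))"
    unfolding eq by simp
qed

text \<open>A sum of squares is at most the largest term times the total variation; the largest term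
  is small by the modulus of continuity of \<open>drift_variation\<close>.\<close>

lemma drift_square_small:
  assumes uv: "0 \<le> u" "v \<le> 1"
  shows "mesh_small u v (\<lambda>n \<tau> \<omega>. \<Sum>i<n. (norm (dB \<tau> i \<omega>))\<^sup>2)"
  unfolding mesh_small_def
proof (intro allI impI)
  fix \<epsilon> :: real assume "\<epsilon> > 0"
  obtain L where L: "L > 0" "prob_bound (\<epsilon> / 2) L (drift_variation 1)"
    using random_variable_tight[OF drift_variation_measurable, of 1 "\<epsilon> / 2"] \<open>\<epsilon> > 0\<close> by auto
  define \<kappa> where "\<kappa> = \<epsilon> / L"
  have \<kappa>: "\<kappa> > 0" "\<kappa> * L = \<epsilon>"
    using L(1) \<open>\<epsilon> > 0\<close> by (auto simp: \<kappa>_def)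
  have cont: "AE \<omega> in M. continuous_on {0..1} (\<lambda>t. drift_variation t \<omega>)"
    using drift_bounds by eventually_elim auto
  obtain \<delta> A where \<delta>: "\<delta> > 0" and A: "A \<in> events" "prob A < \<epsilon> / 2"
    "\<forall>\<omega>\<in>space M - A. \<forall>s\<in>{0..1}. \<forall>t\<in>{0..1}. \<bar>s - t\<bar> < \<delta> \<longrightarrow> dist (drift_variation s \<omega>) (drift_variation t \<omega>) \<le> \<kappa>"
    using process_modulus[OF drift_variation_measurable cont, of "\<epsilon> / 2" \<kappa>] \<open>\<epsilon> > 0\<close> \<kappa>(1) by auto
  obtain A' where A': "A' \<in> events" "prob A' = 0" "\<And>\<omega>. \<omega> \<in> space M \<Longrightarrow> \<omega> \<notin> A' \<Longrightarrow>
    (\<forall>s t. 0 \<le> s \<longrightarrow> s \<le> t \<longrightarrow> t \<le> 1 \<longrightarrow> norm (LINT r:{s..t}|lborel. b r \<omega>) \<le> drift_variation t \<omega> - drift_variation s \<omega>)"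
    using AE_null_eventE[OF drift_bounds] by metis
  have AA': "A \<union> A' \<in> events" "prob (A \<union> A') < \<epsilon> / 2"
    using A(1,2) A'(1,2) measure_Un_le[of A M A'] by auto
  have "prob_bound (\<epsilon> / 2 + \<epsilon> / 2) (\<kappa> * L) (\<lambda>\<omega>. \<Sum>i<n. (norm (dB \<tau> i \<omega>))\<^sup>2)" if fp: "fine_partition u v \<delta> n \<tau>" for n \<tau>
  proof (rule prob_bound_localize[OF _ AA'])
    show "prob_bound (\<epsilon> / 2) (\<kappa> * L) (\<lambda>\<omega>. \<kappa> * drift_variation 1 \<omega>)"
    proof -
      obtain C where C: "C \<in> events" "prob C < \<epsilon> / 2" "\<And>\<omega>. \<omega> \<in> space M \<Longrightarrow> \<omega> \<notin> C \<Longrightarrow> \<bar>drift_variation 1 \<omega>\<bar> \<le> L"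
        using prob_boundE[OF L(2)] by blast
      show ?thesis
        by (rule prob_boundI[OF C(1)]) (use C(2,3) \<kappa>(1) in \<open>auto simp: abs_mult\<close>)
    qed
    fix \<omega> assume \<omega>: "\<omega> \<in> space M" "\<omega> \<notin> A \<union> A'"
    have part: "partition_on_interval u v n \<tau>"
      using fp by (simp add: fine_partition_def)
    have bd: "norm (LINT r:{s..t}|lborel. b r \<omega>) \<le> drift_variation t \<omega> - drift_variation s \<omega>"
      if "0 \<le> s" "s \<le> t" "t \<le> 1" for s t
      using A'(3)[of \<omega>] \<omega> that by auto
    have "norm (dB \<tau> i \<omega>) \<le> \<kappa>" if "i < n" for i
    proof -
      note le = fine_partition_unit[OF fp uv that]
      then have "dist (drift_variation (\<tau> (Suc i)) \<omega>) (drift_variation (\<tau> i) \<omega>) \<le> \<kappa>"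
        using A(3) \<omega> by auto
      then show ?thesis
        using bd[of "\<tau> i" "\<tau> (Suc i)"] le unfolding dist_real_def by auto
    qed
    then have "(\<Sum>i<n. (norm (dB \<tau> i \<omega>))\<^sup>2) \<le> (\<Sum>i<n. \<kappa> * norm (dB \<tau> i \<omega>))"
      unfolding power2_eq_square by (intro sum_mono mult_right_mono) auto
    also have "\<dots> \<le> \<kappa> * drift_variation 1 \<omega>"
      unfolding sum_distrib_left[symmetric]
      using drift_sum_bound[OF part uv bd] \<kappa>(1) by (intro mult_left_mono) auto
    finally show "\<bar>\<Sum>i<n. (norm (dB \<tau> i \<omega>))\<^sup>2\<bar> \<le> \<bar>\<kappa> * drift_variation 1 \<omega>\<bar>"
      by (simp add: sum_nonneg)
  qed
  then show "\<exists>\<delta>>0. \<forall>n \<tau>. fine_partition u v \<delta> n \<tau> \<longrightarrow>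
      prob_bound \<epsilon> \<epsilon> (\<lambda>\<omega>. \<Sum>i<n. (norm (dB \<tau> i \<omega>))\<^sup>2)"
    using \<delta> \<kappa>(2) by auto
qed

text \<open>Once the drift is removed, the residual splits into the freezing error \<open>Q\<close>,
  small in expectation by uniform continuity of \<open>\<sigma>\<close>, and the approximation error
  \<open>R\<close>, whose sum of squares is below the square of its sum.\<close>

lemma residual_square_small:
  assumes uv: "0 \<le> u" "v \<le> 1"
  shows "mesh_small u v (\<lambda>n \<tau> \<omega>. \<Sum>i<n. (norm (residual \<tau> i \<omega>))\<^sup>2)"
proof -
  have noise: "mesh_small u v (\<lambda>n \<tau> \<omega>. \<Sum>i<n. (norm (residual \<tau> i \<omega> - dB \<tau> i \<omega>))\<^sup>2)"
    unfolding mesh_small_def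
  proof (intro allI impI)
    fix \<epsilon> :: real assume "\<epsilon> > 0"
    \<comment> \<open>The cap at 1 allows the estimate \<open>e\<^sup>2 \<le> e\<close> for the
      square sum of \<open>R\<close>.\<close>
    define e where "e = min 1 (\<epsilon> / 4)"
    have e: "e > 0" "e \<le> 1" "e \<le> \<epsilon> / 4"
      using \<open>\<epsilon> > 0\<close> min.cobounded2[of 1 "\<epsilon> / 4"] by (simp_all add: e_def)
    \<comment> \<open>Chosen for Markov's inequality: the expected square sum of \<open>Q\<close> is
      at most \<open>DIM('v) * q\<close>, half of the admissible
      \<open>(\<epsilon> / 4) * (\<epsilon> / 4)\<close>.\<close>
    define q where "q = (\<epsilon> / 4) * (\<epsilon> / 4) / (2 * real DIM('v))"
    have q: "q > 0" "real DIM('v) * q < (\<epsilon> / 4) * (\<epsilon> / 4)"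
      using \<open>\<epsilon> > 0\<close> by (auto simp: q_def)
    define \<kappa> where "\<kappa> = sqrt q"
    have \<kappa>: "\<kappa> > 0" "\<kappa>\<^sup>2 = q"
      using q(1) by (auto simp: \<kappa>_def)
    have "uniformly_continuous_on {0..1} \<sigma>"
      by (intro compact_uniformly_continuous \<sigma>_continuous) auto
    then obtain \<delta> where \<delta>: "\<delta> > 0" "\<And>s t. s \<in> {0..1} \<Longrightarrow> t \<in> {0..1} \<Longrightarrow> dist t s < \<delta> \<Longrightarrow> dist (\<sigma> t) (\<sigma> s) < \<kappa>"
      using \<kappa>(1) unfolding uniformly_continuous_on_def by meson
    have "prob_bound \<epsilon> \<epsilon> (\<lambda>\<omega>. \<Sum>i<n. (norm (residual \<tau> i \<omega> - dB \<tau> i \<omega>))\<^sup>2)" if fp: "fine_partition u v \<delta> n \<tau>" for n \<tau>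
    proof -
      have part: "partition_on_interval u v n \<tau>"
        using fp by (simp add: fine_partition_def)
      obtain N \<pi> where N: "\<forall>i<n. partition_on_interval (\<tau> i) (\<tau> (Suc i)) (N i) (\<pi> i)"
        "prob_bound e e (\<lambda>\<omega>. \<Sum>i<n. norm (dX \<tau> i \<omega> - dB \<tau> i \<omega> - noise_sum (N i) (\<pi> i) \<omega>))"
        using increment_approx[OF part uv e(1)] by blast
      define R where "R i \<omega> = norm (dX \<tau> i \<omega> - dB \<tau> i \<omega> - noise_sum (N i) (\<pi> i) \<omega>)" for i \<omega>
      define Q where "Q i \<omega> = norm (noise_sum (N i) (\<pi> i) \<omega> - \<sigma> (\<tau> i) *\<^sub>R dW \<tau> i \<omega>)" for i \<omega>
      note le = fine_partition_unit[OF fp uv]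
      have Qi: "integrable M (\<lambda>\<omega>. (Q i \<omega>)\<^sup>2)" "expectation (\<lambda>\<omega>. (Q i \<omega>)\<^sup>2) \<le> real DIM('v) * (\<kappa>\<^sup>2 * (\<tau> (Suc i) - \<tau> i))"
        if "i < n" for i
      proof -
        have "\<bar>\<sigma> r - \<sigma> (\<tau> i)\<bar> \<le> \<kappa>" if "r \<in> {\<tau> i..\<tau> (Suc i)}" for r
          using \<delta>(2)[of "\<tau> i" r] le[OF \<open>i < n\<close>] that by (auto simp: dist_real_def)
        then show "integrable M (\<lambda>\<omega>. (Q i \<omega>)\<^sup>2)" "expectation (\<lambda>\<omega>. (Q i \<omega>)\<^sup>2) \<le> real DIM('v) * (\<kappa>\<^sup>2 * (\<tau> (Suc i) - \<tau> i))"
          unfolding Q_def using noise_error_square[of "\<tau> i" "\<tau> (Suc i)" "N i" "\<pi> i" \<kappa>] N(1) le[OF that] that by auto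
      qed
      have Q_small: "prob_bound (\<epsilon> / 4) (\<epsilon> / 4) (\<lambda>\<omega>. \<Sum>i<n. (Q i \<omega>)\<^sup>2)"
      proof (rule prob_bound_first_moment)
        show int: "integrable M (\<lambda>\<omega>. \<Sum>i<n. (Q i \<omega>)\<^sup>2)"
          using Qi(1) by (intro Bochner_Integration.integrable_sum) auto
        then show "(\<lambda>\<omega>. \<Sum>i<n. (Q i \<omega>)\<^sup>2) \<in> borel_measurable M"
          by (rule borel_measurable_integrable)
        have "expectation (\<lambda>\<omega>. \<Sum>i<n. (Q i \<omega>)\<^sup>2) = (\<Sum>i<n. expectation (\<lambda>\<omega>. (Q i \<omega>)\<^sup>2))"
          using Qi(1) by (intro Bochner_Integration.integral_sum) auto
        also have "\<dots> \<le> (\<Sum>i<n. real DIM('v) * (\<kappa>\<^sup>2 * (\<tau> (Suc i) - \<tau> i)))"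
          using Qi(2) by (intro sum_mono) auto
        also have "\<dots> = real DIM('v) * (\<kappa>\<^sup>2 * (v - u))"
          using sum_partition_telescope[OF part, of "\<lambda>x. x"] by (simp add: sum_distrib_left[symmetric])
        also have "\<dots> \<le> real DIM('v) * (\<kappa>\<^sup>2 * 1)"
          using uv by (intro mult_left_mono) auto
        also have "\<dots> < (\<epsilon> / 4) * (\<epsilon> / 4)"
          using q(2) \<kappa>(2) by simp
        finally show "expectation (\<lambda>\<omega>. \<Sum>i<n. (Q i \<omega>)\<^sup>2) < (\<epsilon> / 4) * (\<epsilon> / 4)" .
      qed (use \<open>\<epsilon> > 0\<close> in \<open>auto simp: sum_nonneg\<close>)
      have R_small: "prob_bound (\<epsilon> / 4) (\<epsilon> / 4) (\<lambda>\<omega>. \<Sum>i<n. (R i \<omega>)\<^sup>2)"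
      proof -
        obtain A where A: "A \<in> events" "prob A < e" "\<And>\<omega>. \<omega> \<in> space M \<Longrightarrow> \<omega> \<notin> A \<Longrightarrow> \<bar>\<Sum>i<n. R i \<omega>\<bar> \<le> e"
          using prob_boundE[OF N(2)[folded R_def]] by blast
        show ?thesis
        proof (rule prob_boundI[OF A(1)])
          fix \<omega> assume \<omega>: "\<omega> \<in> space M" "\<omega> \<notin> A"
          have "(\<Sum>i<n. (R i \<omega>)\<^sup>2) \<le> (\<Sum>i<n. R i \<omega>)\<^sup>2"
            by (rule sum_squares_le_square_sum) (simp add: R_def)
          also have "\<dots> \<le> e\<^sup>2"
            using power_mono[OF A(3)[OF \<omega>], of 2] by simp
          also have "\<dots> \<le> e * 1"
            unfolding power2_eq_square using e by (intro mult_left_mono) auto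
          also have "\<dots> \<le> \<epsilon> / 4"
            using e(3) by simp
          finally show "\<bar>\<Sum>i<n. (R i \<omega>)\<^sup>2\<bar> \<le> \<epsilon> / 4"
            by (simp add: sum_nonneg)
        qed (use A(2) e(3) in simp)
      qed
      have le2: "\<bar>\<Sum>i<n. (norm (residual \<tau> i \<omega> - dB \<tau> i \<omega>))\<^sup>2\<bar> \<le>
          \<bar>((\<Sum>i<n. (Q i \<omega>)\<^sup>2) + (\<Sum>i<n. (R i \<omega>)\<^sup>2)) + ((\<Sum>i<n. (Q i \<omega>)\<^sup>2) + (\<Sum>i<n. (R i \<omega>)\<^sup>2))\<bar>" for \<omega>
      proof -
        have "(norm (residual \<tau> i \<omega> - dB \<tau> i \<omega>))\<^sup>2 \<le> 2 * (Q i \<omega>)\<^sup>2 + 2 * (R i \<omega>)\<^sup>2" for i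
        proof -
          have "residual \<tau> i \<omega> - dB \<tau> i \<omega> = (noise_sum (N i) (\<pi> i) \<omega> - \<sigma> (\<tau> i) *\<^sub>R dW \<tau> i \<omega>) +
              (dX \<tau> i \<omega> - dB \<tau> i \<omega> - noise_sum (N i) (\<pi> i) \<omega>)"
            by (simp add: residual_def)
          then have "norm (residual \<tau> i \<omega> - dB \<tau> i \<omega>) \<le> Q i \<omega> + R i \<omega>"
            unfolding Q_def R_def by (metis norm_triangle_ineq)
          then have "(norm (residual \<tau> i \<omega> - dB \<tau> i \<omega>))\<^sup>2 \<le> (Q i \<omega> + R i \<omega>)\<^sup>2"
            by (intro power_mono) auto
          also have "\<dots> \<le> 2 * (Q i \<omega>)\<^sup>2 + 2 * (R i \<omega>)\<^sup>2"
            using sum_squares_bound[of "Q i \<omega>" "R i \<omega>"] by (simp add: power2_sum)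
          finally show ?thesis .
        qed
        then have "(\<Sum>i<n. (norm (residual \<tau> i \<omega> - dB \<tau> i \<omega>))\<^sup>2) \<le> (\<Sum>i<n. 2 * (Q i \<omega>)\<^sup>2 + 2 * (R i \<omega>)\<^sup>2)"
          by (intro sum_mono)
        also have "\<dots> = ((\<Sum>i<n. (Q i \<omega>)\<^sup>2) + (\<Sum>i<n. (R i \<omega>)\<^sup>2)) + ((\<Sum>i<n. (Q i \<omega>)\<^sup>2) + (\<Sum>i<n. (R i \<omega>)\<^sup>2))"
          by (simp add: sum.distrib sum_distrib_left[symmetric])
        finally show ?thesis
          by (simp add: sum_nonneg)
      qed
      have "prob_bound (\<epsilon>/4 + \<epsilon>/4 + (\<epsilon>/4 + \<epsilon>/4)) (\<epsilon>/4 + \<epsilon>/4 + (\<epsilon>/4 + \<epsilon>/4))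
        (\<lambda>\<omega>. ((\<Sum>i<n. (Q i \<omega>)\<^sup>2) + (\<Sum>i<n. (R i \<omega>)\<^sup>2)) + ((\<Sum>i<n. (Q i \<omega>)\<^sup>2) + (\<Sum>i<n. (R i \<omega>)\<^sup>2)))"
        by (intro prob_bound_add Q_small R_small)
      then show ?thesis
        by (rule prob_bound_AE_mono) (use le2 in auto)
    qed
    then show "\<exists>\<delta>>0. \<forall>n \<tau>. fine_partition u v \<delta> n \<tau> \<longrightarrow>
        prob_bound \<epsilon> \<epsilon> (\<lambda>\<omega>. \<Sum>i<n. (norm (residual \<tau> i \<omega> - dB \<tau> i \<omega>))\<^sup>2)"
      using \<delta>(1) by blast
  qed
  have "mesh_small u v (\<lambda>n \<tau> \<omega>. 2 * ((\<Sum>i<n. (norm (residual \<tau> i \<omega> - dB \<tau> i \<omega>))\<^sup>2) + (\<Sum>i<n. (norm (dB \<tau> i \<omega>))\<^sup>2)))"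
    using drift_square_small[OF uv] noise by (intro mesh_small_scale mesh_small_add)
  then show ?thesis
  proof (rule mesh_small_mono)
    fix n \<tau> \<omega>
    have "(norm (residual \<tau> i \<omega>))\<^sup>2 \<le> 2 * ((norm (residual \<tau> i \<omega> - dB \<tau> i \<omega>))\<^sup>2 + (norm (dB \<tau> i \<omega>))\<^sup>2)" for i
    proof -
      have "(norm (residual \<tau> i \<omega>))\<^sup>2 \<le> (norm (residual \<tau> i \<omega> - dB \<tau> i \<omega>) + norm (dB \<tau> i \<omega>))\<^sup>2"
        by (intro power_mono) (auto simp: norm_triangle_sub add.commute)
      then show ?thesis
        using sum_squares_bound[of "norm (residual \<tau> i \<omega> - dB \<tau> i \<omega>)" "norm (dB \<tau> i \<omega>)"] by (simp add: power2_sum)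
    qed
    then have "(\<Sum>i<n. (norm (residual \<tau> i \<omega>))\<^sup>2) \<le> 2 * ((\<Sum>i<n. (norm (residual \<tau> i \<omega> - dB \<tau> i \<omega>))\<^sup>2) + (\<Sum>i<n. (norm (dB \<tau> i \<omega>))\<^sup>2))"
      unfolding sum.distrib[symmetric] sum_distrib_left by (intro sum_mono) (simp add: distrib_left)
    then show "\<bar>\<Sum>i<n. (norm (residual \<tau> i \<omega>))\<^sup>2\<bar> \<le> \<bar>2 * ((\<Sum>i<n. (norm (residual \<tau> i \<omega> - dB \<tau> i \<omega>))\<^sup>2) + (\<Sum>i<n. (norm (dB \<tau> i \<omega>))\<^sup>2))\<bar>"
      by (simp add: sum_nonneg)
  qed
qed

lemma W_square_sum_tight:
  assumes uv: "0 \<le> u" "v \<le> 1"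
  shows "mesh_tight u v (\<lambda>n \<tau> \<omega>. \<Sum>i<n. (norm (dW \<tau> i \<omega>))\<^sup>2)"
  unfolding mesh_tight_def
proof (intro allI impI)
  fix \<epsilon> :: real assume "\<epsilon> > 0"
  \<comment> \<open>The expected square sum is at most the dimension for every partition, so the
    mesh 1 is an arbitrary witness; the added 1 makes the inequality for Markov's bound
    strict.\<close>
  have "prob_bound \<epsilon> ((real DIM('v) + 1) / \<epsilon>) (\<lambda>\<omega>. \<Sum>i<n. (norm (dW \<tau> i \<omega>))\<^sup>2)" if fp: "fine_partition u v 1 n \<tau>" for n \<tau>
  proof (rule prob_bound_first_moment)
    have part: "partition_on_interval u v n \<tau>"
      using fp by (simp add: fine_partition_def)
    have sq: "integrable M (\<lambda>\<omega>. (dW \<tau> i \<omega> \<bullet> e)\<^sup>2)" "expectation (\<lambda>\<omega>. (dW \<tau> i \<omega> \<bullet> e)\<^sup>2) = \<tau> (Suc i) - \<tau> i"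
      if "i < n" "e \<in> Basis" for i e
    proof -
      from W_increment_square[OF partition_unit[OF part uv that(1)] that(2)]
      show "integrable M (\<lambda>\<omega>. (dW \<tau> i \<omega> \<bullet> e)\<^sup>2)" "expectation (\<lambda>\<omega>. (dW \<tau> i \<omega> \<bullet> e)\<^sup>2) = \<tau> (Suc i) - \<tau> i" .
    qed
    show int: "integrable M (\<lambda>\<omega>. \<Sum>i<n. (norm (dW \<tau> i \<omega>))\<^sup>2)"
      unfolding norm_square_Basis using sq(1) by (intro Bochner_Integration.integrable_sum) auto
    then show "(\<lambda>\<omega>. \<Sum>i<n. (norm (dW \<tau> i \<omega>))\<^sup>2) \<in> borel_measurable M"
      by (rule borel_measurable_integrable)
    have "expectation (\<lambda>\<omega>. \<Sum>i<n. (norm (dW \<tau> i \<omega>))\<^sup>2) = (\<Sum>i<n. \<Sum>e\<in>Basis. expectation (\<lambda>\<omega>. (dW \<tau> i \<omega> \<bullet> e)\<^sup>2))"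
      unfolding norm_square_Basis using sq(1)
      by (subst Bochner_Integration.integral_sum, force intro: Bochner_Integration.integrable_sum)
         (intro sum.cong refl Bochner_Integration.integral_sum, auto)
    also have "\<dots> = (\<Sum>i<n. real DIM('v) * (\<tau> (Suc i) - \<tau> i))"
      by (intro sum.cong refl) (simp add: sq(2))
    also have "\<dots> = real DIM('v) * (v - u)"
      using sum_partition_telescope[OF part, of "\<lambda>x. x"] by (simp add: sum_distrib_left[symmetric])
    also have "\<dots> \<le> real DIM('v) * 1"
      using uv by (intro mult_left_mono) auto
    also have "\<dots> < \<epsilon> * ((real DIM('v) + 1) / \<epsilon>)"
      using \<open>\<epsilon> > 0\<close> by simp
    finally show "expectation (\<lambda>\<omega>. \<Sum>i<n. (norm (dW \<tau> i \<omega>))\<^sup>2) < \<epsilon> * ((real DIM('v) + 1) / \<epsilon>)" .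
  qed (use \<open>\<epsilon> > 0\<close> in \<open>auto simp: sum_nonneg add_pos_pos\<close>)
  then show "\<exists>K>0. \<exists>\<delta>>0. \<forall>n \<tau>. fine_partition u v \<delta> n \<tau> \<longrightarrow> prob_bound \<epsilon> K (\<lambda>\<omega>. \<Sum>i<n. (norm (dW \<tau> i \<omega>))\<^sup>2)"
    using \<open>\<epsilon> > 0\<close> by (intro exI[of _ "(real DIM('v) + 1) / \<epsilon>"] exI[of _ 1]) (auto intro: add_pos_pos divide_pos_pos)
qed

text \<open>The compensated products are martingale differences with variance at most
  \<open>8 * (\<tau> (Suc i) - \<tau> i)\<^sup>2\<close>, and these add up to at most
  \<open>8 * \<delta>\<close>. The weights are first cut off at a level \<open>K\<close>, because
  the second moment estimate asks for bounded weights.\<close>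

lemma W_weighted_quadratic_variation:
  assumes uv: "0 \<le> u" "v \<le> 1" and e: "e \<in> Basis" "e' \<in> Basis"
    and \<zeta>: "\<And>t. t \<in> {0..1} \<Longrightarrow> \<zeta> t \<in> borel_measurable (F t)" "AE \<omega> in M. continuous_on {0..1} (\<lambda>t. \<zeta> t \<omega> :: real)"
  shows "mesh_small u v (\<lambda>n \<tau> \<omega>. \<Sum>i<n. \<zeta> (\<tau> i) \<omega> *
    ((dW \<tau> i \<omega> \<bullet> e) * (dW \<tau> i \<omega> \<bullet> e') - (if e = e' then \<tau> (Suc i) - \<tau> i else 0)))"
proof (rule mesh_small_localize)
  fix \<epsilon>' :: real assume "\<epsilon>' > 0"
  obtain K A where K: "K > 0" and A: "A \<in> events" "prob A < \<epsilon>'" "\<forall>\<omega>\<in>space M - A. \<forall>t\<in>{0..1}. norm (\<zeta> t \<omega>) \<le> K"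
    using process_tight[OF F_measurable_M[OF \<zeta>(1)] \<zeta>(2) \<open>\<epsilon>' > 0\<close>] by auto
  define \<eta> where "\<eta> t \<omega> = max (- K) (min K (\<zeta> t \<omega>))" for t \<omega>
  let ?\<Theta> = "\<lambda>\<tau> i \<omega>. (dW \<tau> i \<omega> \<bullet> e) * (dW \<tau> i \<omega> \<bullet> e') - (if e = e' then \<tau> (Suc i) - \<tau> i else 0)"
  have small: "mesh_small u v (\<lambda>n \<tau> \<omega>. \<Sum>i<n. \<eta> (\<tau> i) \<omega> * ?\<Theta> \<tau> i \<omega>)"
    unfolding mesh_small_def
  proof (intro allI impI)
    fix \<epsilon> :: real assume "\<epsilon> > 0"
    \<comment> \<open>With 16 in place of 8 the second moment is at most half of what Chebyshev
      admits.\<close>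
    define \<delta> where "\<delta> = \<epsilon> * \<epsilon>\<^sup>2 / (16 * K\<^sup>2)"
    have \<delta>: "\<delta> > 0" "K\<^sup>2 * (8 * \<delta>) < \<epsilon> * \<epsilon>\<^sup>2"
      using \<open>\<epsilon> > 0\<close> K by (auto simp: \<delta>_def)
    have "prob_bound \<epsilon> \<epsilon> (\<lambda>\<omega>. \<Sum>i<n. \<eta> (\<tau> i) \<omega> * ?\<Theta> \<tau> i \<omega>)" if fp: "fine_partition u v \<delta> n \<tau>" for n \<tau>
    proof -
      have part: "partition_on_interval u v n \<tau>"
        using fp by (simp add: fine_partition_def)
      note le = fine_partition_unit[OF fp uv]
      have md: "mart_diff (F (\<tau> i)) (?\<Theta> \<tau> i) (8 * (\<tau> (Suc i) - \<tau> i)\<^sup>2)" if "i < n" for i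
        by (rule W_increment_product_mart_diff[OF le(1-3)[OF that] e])
      have m1: "?\<Theta> \<tau> i \<in> borel_measurable (F (\<tau> (Suc i)))" if "i < n" for i
        using W_adapted[OF le(2)[OF that]] F_measurable_mono[OF W_adapted[OF le(1)[OF that]] le(3)[OF that]] by simp
      have m2: "\<eta> (\<tau> i) \<in> borel_measurable (F (\<tau> i))" if "i < n" for i
        unfolding \<eta>_def using \<zeta>(1)[OF le(1)[OF that]] by (rule clipped_measurable)
      have bd: "\<bar>\<eta> (\<tau> i) \<omega>\<bar> \<le> K" for i \<omega>
        using K by (auto simp: \<eta>_def)
      note m = martingale_transform_second_moment[where \<zeta>="\<lambda>i. \<eta> (\<tau> i)" and K=K, OF part uv m1 md m2 bd]
      have "(\<Sum>i<n. 8 * (\<tau> (Suc i) - \<tau> i)\<^sup>2) \<le> (\<Sum>i<n. 8 * \<delta> * (\<tau> (Suc i) - \<tau> i))"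
        unfolding power2_eq_square mult.assoc[symmetric]
        by (intro sum_mono mult_right_mono mult_left_mono) (use le in \<open>auto intro: less_imp_le\<close>)
      also have "\<dots> = 8 * \<delta> * (v - u)"
        using sum_partition_telescope[OF part, of "\<lambda>x. x"] by (simp add: sum_distrib_left[symmetric])
      also have "\<dots> \<le> 8 * \<delta> * 1"
        using uv \<delta>(1) by (intro mult_left_mono) auto
      finally have "K\<^sup>2 * (\<Sum>i<n. 8 * (\<tau> (Suc i) - \<tau> i)\<^sup>2) \<le> K\<^sup>2 * (8 * \<delta>)"
        by (intro mult_left_mono) auto
      then have "K\<^sup>2 * (\<Sum>i<n. 8 * (\<tau> (Suc i) - \<tau> i)\<^sup>2) < \<epsilon> * \<epsilon>\<^sup>2"
        using \<delta>(2) by linarith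
      then show ?thesis
        by (intro prob_bound_second_moment \<open>\<epsilon> > 0\<close> m(1,2) le_less_trans[OF m(3)]) auto
    qed
    then show "\<exists>\<delta>>0. \<forall>n \<tau>. fine_partition u v \<delta> n \<tau> \<longrightarrow> prob_bound \<epsilon> \<epsilon> (\<lambda>\<omega>. \<Sum>i<n. \<eta> (\<tau> i) \<omega> * ?\<Theta> \<tau> i \<omega>)"
      using \<delta>(1) by blast
  qed
  show "\<exists>A\<in>events. \<exists>Z'. prob A < \<epsilon>' \<and> mesh_small u v Z' \<and>
    (\<forall>n \<tau>. partition_on_interval u v n \<tau> \<longrightarrow> (\<forall>\<omega>\<in>space M - A. \<bar>\<Sum>i<n. \<zeta> (\<tau> i) \<omega> * ?\<Theta> \<tau> i \<omega>\<bar> \<le> \<bar>Z' n \<tau> \<omega>\<bar>))"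
  proof (intro bexI[OF _ A(1)] exI[of _ "\<lambda>n \<tau> \<omega>. \<Sum>i<n. \<eta> (\<tau> i) \<omega> * ?\<Theta> \<tau> i \<omega>"] conjI A(2) small allI impI ballI)
    fix n \<tau> \<omega> assume part: "partition_on_interval u v n \<tau>" and \<omega>: "\<omega> \<in> space M - A"
    have "\<zeta> (\<tau> i) \<omega> = \<eta> (\<tau> i) \<omega>" if "i < n" for i
    proof -
      have "\<tau> i \<in> {0..1}"
        using that partition_in_interval[OF part, of i] uv by auto
      then have "\<bar>\<zeta> (\<tau> i) \<omega>\<bar> \<le> K"
        using A(3) \<omega> by auto
      then show ?thesis
        by (auto simp: \<eta>_def)
    qed
    then have "(\<Sum>i<n. \<zeta> (\<tau> i) \<omega> * ?\<Theta> \<tau> i \<omega>) = (\<Sum>i<n. \<eta> (\<tau> i) \<omega> * ?\<Theta> \<tau> i \<omega>)"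
      by (intro sum.cong refl) simp
    then show "\<bar>\<Sum>i<n. \<zeta> (\<tau> i) \<omega> * ?\<Theta> \<tau> i \<omega>\<bar> \<le> \<bar>\<Sum>i<n. \<eta> (\<tau> i) \<omega> * ?\<Theta> \<tau> i \<omega>\<bar>"
      by simp
  qed
qed

end

section \<open>Deterministic estimates for fields and linear maps\<close>

lemma uniform_on_bounded:
  fixes h :: "real \<Rightarrow> 'v::euclidean_space \<Rightarrow> 'c::metric_space"
  assumes h: "continuous_on ({0..1} \<times> UNIV) (\<lambda>(t, x). h t x)" and "\<kappa> > 0"
  shows "\<exists>\<delta>>0. \<forall>s\<in>{0..1}. \<forall>t\<in>{0..1}. \<forall>x\<in>cball 0 K. \<forall>y\<in>cball 0 K.
    \<bar>s - t\<bar> < \<delta> \<longrightarrow> dist x y < \<delta> \<longrightarrow> dist (h s x) (h t y) \<le> \<kappa>"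
proof -
  have "uniformly_continuous_on ({0..1} \<times> cball 0 K) (\<lambda>(t, x). h t x)"
    by (intro compact_uniformly_continuous continuous_on_subset[OF h] compact_Times) auto
  then obtain d where d: "d > 0" "\<And>p q. p \<in> {0..1} \<times> cball 0 K \<Longrightarrow> q \<in> {0..1} \<times> cball 0 K \<Longrightarrow> dist q p < d \<Longrightarrow>
      dist (case q of (t, x) \<Rightarrow> h t x) (case p of (t, x) \<Rightarrow> h t x) < \<kappa>"
    using \<open>\<kappa> > 0\<close> unfolding uniformly_continuous_on_def by meson
  have "dist (h s x) (h t y) \<le> \<kappa>"
    if "s \<in> {0..1}" "t \<in> {0..1}" "x \<in> cball 0 K" "y \<in> cball 0 K" "\<bar>s - t\<bar> < d / 2" "dist x y < d / 2" for s t x y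
  proof -
    \<comment> \<open>The product metric is at most the sum of the two distances, hence the radius
      \<open>d / 2\<close> in each variable.\<close>
    have "dist (s, x) (t, y) \<le> \<bar>dist s t\<bar> + \<bar>dist x y\<bar>"
      unfolding dist_Pair_Pair by (rule sqrt_sum_squares_le_sum_abs)
    also have "\<dots> < d"
      using that(5,6) by (simp add: dist_real_def)
    finally show ?thesis
      using d(2)[of "(t, y)" "(s, x)"] that(1-4) by simp
  qed
  then show ?thesis
    using d(1) by (intro exI[of _ "d / 2"]) auto
qed

lemma continuous_on_time_slice:
  assumes h: "continuous_on ({0..1::real} \<times> UNIV) (\<lambda>(t, x). h t x)" and t: "t \<in> {0..1}"
  shows "continuous_on UNIV (h t)"
proof -
  have "continuous_on UNIV (\<lambda>x. case (t, x) of (t, x) \<Rightarrow> h t x)"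
    by (rule continuous_on_compose2[OF h continuous_on_Pair[OF continuous_on_const continuous_on_id]])
       (use t in auto)
  then show ?thesis by simp
qed

text \<open>With vector values a single intermediate point need not exist, but the increment is only
  ever paired with a fixed vector, and the scalar mean value theorem along the segment
  suffices.\<close>

lemma mvt_inner:
  fixes G :: "'v::euclidean_space \<Rightarrow> 'v"
  assumes "\<And>x. G differentiable (at x)"
  shows "\<exists>\<xi>\<in>closed_segment x y. (G y - G x) \<bullet> w = frechet_derivative G (at \<xi>) (y - x) \<bullet> w"
proof -
  have der: "((\<lambda>\<theta>. G (x + \<theta> *\<^sub>R (y - x)) \<bullet> w) has_derivative
      (\<lambda>h. frechet_derivative G (at (x + \<theta> *\<^sub>R (y - x))) (h *\<^sub>R (y - x)) \<bullet> w)) (at \<theta>)" for \<theta> :: real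
  proof -
    have "((\<lambda>\<theta>. x + \<theta> *\<^sub>R (y - x)) has_derivative (\<lambda>h. h *\<^sub>R (y - x))) (at \<theta>)"
      by (auto intro!: derivative_eq_intros)
    moreover have "(G has_derivative frechet_derivative G (at (x + \<theta> *\<^sub>R (y - x)))) (at (x + \<theta> *\<^sub>R (y - x)))"
      using assms frechet_derivative_works by blast
    ultimately have "((\<lambda>\<theta>. G (x + \<theta> *\<^sub>R (y - x))) has_derivative
        (\<lambda>h. frechet_derivative G (at (x + \<theta> *\<^sub>R (y - x))) (h *\<^sub>R (y - x)))) (at \<theta>)"
      by (rule has_derivative_compose)
    then show ?thesis
      by (rule has_derivative_inner_left)
  qed
  have "continuous_on {0..1::real} (\<lambda>\<theta>. G (x + \<theta> *\<^sub>R (y - x)) \<bullet> w)"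
    using der has_derivative_continuous by (blast intro: continuous_at_imp_continuous_on)
  then obtain \<theta> :: real where \<theta>: "\<theta> \<in> {0<..<1}"
    "G (x + 1 *\<^sub>R (y - x)) \<bullet> w - G (x + 0 *\<^sub>R (y - x)) \<bullet> w =
      frechet_derivative G (at (x + \<theta> *\<^sub>R (y - x))) ((1 - 0) *\<^sub>R (y - x)) \<bullet> w"
    using mvt[of 0 1 "\<lambda>\<theta>. G (x + \<theta> *\<^sub>R (y - x)) \<bullet> w", OF _ _ der] by auto
  have "x + \<theta> *\<^sub>R (y - x) \<in> closed_segment x y"
    unfolding in_segment using \<theta>(1) by (intro exI[of _ \<theta>]) (auto simp: algebra_simps)
  then show ?thesis
    using \<theta>(2) by (auto simp: inner_diff_left intro!: bexI[of _ "x + \<theta> *\<^sub>R (y - x)"])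
qed

text \<open>\<open>regular_drift\<close> gives continuity of the derivative one direction at a time;
  control on the basis vectors recovers an operator bound at the cost of the dimension.\<close>

lemma linear_diff_bound:
  fixes A B :: "'v::euclidean_space \<Rightarrow> 'c::euclidean_space"
  assumes "linear A" "linear B" "\<And>e. e \<in> Basis \<Longrightarrow> norm (A e - B e) \<le> c" "c \<ge> 0"
  shows "norm (A w - B w) \<le> real DIM('v) * c * norm w"
proof -
  have lin: "linear (\<lambda>w. A w - B w)"
    by (rule linear_compose_sub[OF assms(1,2)])
  have "A w - B w = (\<Sum>e\<in>Basis. (w \<bullet> e) *\<^sub>R (A e - B e))"
    using linear_sum[OF lin, of "\<lambda>e. (w \<bullet> e) *\<^sub>R e" Basis] linear_cmul[OF lin]
    by (simp add: euclidean_representation)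
  also have "norm \<dots> \<le> (\<Sum>e\<in>(Basis::'v set). norm w * c)"
  proof (intro sum_norm_le)
    fix e :: 'v assume e: "e \<in> Basis"
    show "norm ((w \<bullet> e) *\<^sub>R (A e - B e)) \<le> norm w * c"
      unfolding norm_scaleR using Basis_le_norm[OF e] assms(3)[OF e] by (intro mult_mono) auto
  qed
  finally show ?thesis
    by (simp add: mult_ac)
qed

lemma linear_inner_expand:
  fixes A :: "'v::euclidean_space \<Rightarrow> 'v"
  assumes "linear A"
  shows "A w \<bullet> w = (\<Sum>e'\<in>Basis. \<Sum>e\<in>Basis. (A e' \<bullet> e) * ((w \<bullet> e') * (w \<bullet> e)))"
proof -
  have "A w = (\<Sum>e\<in>Basis. (w \<bullet> e) *\<^sub>R A e)"
    using linear_sum[OF assms, of "\<lambda>e. (w \<bullet> e) *\<^sub>R e" Basis] linear_cmul[OF assms]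
    by (simp add: euclidean_representation)
  then have "A w \<bullet> w = (\<Sum>e'\<in>Basis. (w \<bullet> e') * (A e' \<bullet> w))"
    by (simp add: inner_sum_left)
  also have "\<dots> = (\<Sum>e'\<in>Basis. (w \<bullet> e') * (\<Sum>e\<in>Basis. (A e' \<bullet> e) * (w \<bullet> e)))"
    by (intro sum.cong refl) (subst euclidean_inner, simp)
  finally show ?thesis
    by (simp add: sum_distrib_left algebra_simps)
qed

section \<open>Weighted covariation of an Ito process\<close>

context ito
begin

lemma compose_adapted:
  assumes h: "continuous_on ({0..1} \<times> UNIV) (\<lambda>(t, x). h t x)" and t: "t \<in> {0..1}"
  shows "(\<lambda>\<omega>. h t (X t \<omega>) :: 'c::euclidean_space) \<in> borel_measurable (F t)"
  using borel_measurable_continuous_onI[OF continuous_on_time_slice[OF assms]] measurable_compose[OF X_adapted[OF t]]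
  by blast

lemma compose_continuous:
  assumes h: "continuous_on ({0..1} \<times> UNIV) (\<lambda>(t, x). h t x)"
  shows "AE \<omega> in M. continuous_on {0..1} (\<lambda>t. h t (X t \<omega>))"
  using X_continuous
proof eventually_elim
  case (elim \<omega>)
  have "continuous_on {0..1} (\<lambda>t. case (t, X t \<omega>) of (t, x) \<Rightarrow> h t x)"
    by (rule continuous_on_compose2[OF h continuous_on_Pair[OF continuous_on_id elim]]) auto
  then show ?case by simp
qed

text \<open>Young's inequality with weight \<open>\<kappa>\<close> splits each product into a small
  multiple of a term of a tight sum and a large multiple of a term of a negligible one.\<close>

lemma cross_sum_small:
  assumes uv: "0 \<le> u" "v \<le> 1"
  shows "mesh_small u v (\<lambda>n \<tau> \<omega>. \<Sum>i<n. norm (dW \<tau> i \<omega>) * norm (residual \<tau> i \<omega>))"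
  unfolding mesh_small_def
proof (intro allI impI)
  fix \<epsilon> :: real assume "\<epsilon> > 0"
  then have "\<epsilon> / 2 > 0" by simp
  obtain L d1 where L: "L > 0" "d1 > 0" "\<And>n \<tau>. fine_partition u v d1 n \<tau> \<Longrightarrow> prob_bound (\<epsilon> / 2) L (\<lambda>\<omega>. \<Sum>i<n. (norm (dW \<tau> i \<omega>))\<^sup>2)"
    using W_square_sum_tight[OF uv] \<open>\<epsilon> / 2 > 0\<close> unfolding mesh_tight_def by meson
  define \<kappa> where "\<kappa> = \<epsilon> / (2 * L)"
  have \<kappa>: "\<kappa> > 0" "\<kappa> * L = \<epsilon> / 2"
    using L(1) \<open>\<epsilon> > 0\<close> by (auto simp: \<kappa>_def)
  obtain d2 where d2: "d2 > 0" "\<And>n \<tau>. fine_partition u v d2 n \<tau> \<Longrightarrow>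
      prob_bound (\<epsilon> / 2) (\<epsilon> / 2) (\<lambda>\<omega>. (1 / \<kappa>) * (\<Sum>i<n. (norm (residual \<tau> i \<omega>))\<^sup>2))"
    using mesh_small_scale[OF residual_square_small[OF uv], of "1 / \<kappa>"] \<open>\<epsilon> / 2 > 0\<close> unfolding mesh_small_def by meson
  have "prob_bound \<epsilon> \<epsilon> (\<lambda>\<omega>. \<Sum>i<n. norm (dW \<tau> i \<omega>) * norm (residual \<tau> i \<omega>))"
    if fp: "fine_partition u v (min d1 d2) n \<tau>" for n \<tau>
  proof -
    obtain A where A: "A \<in> events" "prob A < \<epsilon> / 2" "\<And>\<omega>. \<omega> \<in> space M \<Longrightarrow> \<omega> \<notin> A \<Longrightarrow> \<bar>\<Sum>i<n. (norm (dW \<tau> i \<omega>))\<^sup>2\<bar> \<le> L"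
      using prob_boundE[OF L(3)] fine_partition_mono[OF fp, of d1] by auto
    have "prob_bound (\<epsilon> / 2) (\<epsilon> / 2) (\<lambda>\<omega>. \<kappa> * (\<Sum>i<n. (norm (dW \<tau> i \<omega>))\<^sup>2))"
      unfolding \<kappa>(2)[symmetric]
      by (rule prob_boundI[OF A(1)]) (use A(2,3) \<kappa> in \<open>auto simp: abs_mult intro: mult_left_mono\<close>)
    from prob_bound_add[OF this d2(2)[of n \<tau>]]
    have "prob_bound (\<epsilon> / 2 + \<epsilon> / 2) (\<epsilon> / 2 + \<epsilon> / 2)
      (\<lambda>\<omega>. \<kappa> * (\<Sum>i<n. (norm (dW \<tau> i \<omega>))\<^sup>2) + (1 / \<kappa>) * (\<Sum>i<n. (norm (residual \<tau> i \<omega>))\<^sup>2))"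
      using fine_partition_mono[OF fp, of d2] by simp
    then show ?thesis
    proof (rule prob_bound_AE_mono)
      have young: "a * c \<le> \<kappa> * a\<^sup>2 + (1 / \<kappa>) * c\<^sup>2" if "a \<ge> 0" "c \<ge> 0" for a c :: real
      proof -
        have "2 * (sqrt \<kappa> * a) * (c / sqrt \<kappa>) \<le> (sqrt \<kappa> * a)\<^sup>2 + (c / sqrt \<kappa>)\<^sup>2"
          by (rule sum_squares_bound)
        moreover have "(sqrt \<kappa> * a) * (c / sqrt \<kappa>) = a * c"
          using \<kappa>(1) by simp
        moreover have "(sqrt \<kappa> * a)\<^sup>2 + (c / sqrt \<kappa>)\<^sup>2 = \<kappa> * a\<^sup>2 + (1 / \<kappa>) * c\<^sup>2"
          using \<kappa>(1) by (simp add: power_mult_distrib power_divide)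
        moreover have "a * c \<ge> 0"
          using that by simp
        ultimately show ?thesis by linarith
      qed
      have "(\<Sum>i<n. norm (dW \<tau> i \<omega>) * norm (residual \<tau> i \<omega>)) \<le>
          \<kappa> * (\<Sum>i<n. (norm (dW \<tau> i \<omega>))\<^sup>2) + (1 / \<kappa>) * (\<Sum>i<n. (norm (residual \<tau> i \<omega>))\<^sup>2)" for \<omega>
        unfolding sum_distrib_left sum.distrib[symmetric] by (intro sum_mono young) auto
      then show "AE \<omega> in M. \<bar>\<Sum>i<n. norm (dW \<tau> i \<omega>) * norm (residual \<tau> i \<omega>)\<bar> \<le>
          \<bar>\<kappa> * (\<Sum>i<n. (norm (dW \<tau> i \<omega>))\<^sup>2) + (1 / \<kappa>) * (\<Sum>i<n. (norm (residual \<tau> i \<omega>))\<^sup>2)\<bar>"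
        by (intro AE_I2) (smt (verit, best) mult_nonneg_nonneg norm_ge_zero sum_nonneg)
    qed auto
  qed
  then show "\<exists>\<delta>>0. \<forall>n \<tau>. fine_partition u v \<delta> n \<tau> \<longrightarrow> prob_bound \<epsilon> \<epsilon> (\<lambda>\<omega>. \<Sum>i<n. norm (dW \<tau> i \<omega>) * norm (residual \<tau> i \<omega>))"
    using L(2) d2(1) by (intro exI[of _ "min d1 d2"]) auto
qed

text \<open>Each increment is \<open>\<sigma> (\<tau> i)\<close> times the Brownian increment plus
  the residual. Multiplying out leaves the Brownian product and terms dominated by \<open>P\<close>,
  whose coefficient \<open>2 * C\<close> comes from the two mixed products.\<close>

lemma weighted_covariation:
  assumes uv: "0 \<le> u" "v \<le> 1" and e: "e \<in> Basis" "e' \<in> Basis"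
    and \<zeta>: "\<And>t. t \<in> {0..1} \<Longrightarrow> \<zeta> t \<in> borel_measurable (F t)" "AE \<omega> in M. continuous_on {0..1} (\<lambda>t. \<zeta> t \<omega> :: real)"
  shows "mesh_small u v (\<lambda>n \<tau> \<omega>. \<Sum>i<n. \<zeta> (\<tau> i) \<omega> *
    ((dX \<tau> i \<omega> \<bullet> e) * (dX \<tau> i \<omega> \<bullet> e') - (if e = e' then (\<sigma> (\<tau> i))\<^sup>2 * (\<tau> (Suc i) - \<tau> i) else 0)))"
proof -
  obtain C where C: "C > 0" "\<And>t. t \<in> {0..1} \<Longrightarrow> \<bar>\<sigma> t\<bar> \<le> C"
    using \<sigma>_bounded by blast
  define P where "P n \<tau> \<omega> = 2 * C * (\<Sum>i<n. norm (dW \<tau> i \<omega>) * norm (residual \<tau> i \<omega>)) + (\<Sum>i<n. (norm (residual \<tau> i \<omega>))\<^sup>2)" for n \<tau> \<omega>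
  have P: "mesh_small u v P"
    unfolding P_def by (intro mesh_small_add mesh_small_scale cross_sum_small residual_square_small uv)
  have approx: "mesh_small u v (\<lambda>n \<tau> \<omega>. \<Sum>i<n. \<zeta> (\<tau> i) \<omega> *
    ((dX \<tau> i \<omega> \<bullet> e) * (dX \<tau> i \<omega> \<bullet> e') - (\<sigma> (\<tau> i))\<^sup>2 * ((dW \<tau> i \<omega> \<bullet> e) * (dW \<tau> i \<omega> \<bullet> e'))))"
  proof (rule mesh_small_localize)
    fix \<epsilon> :: real assume "\<epsilon> > 0"
    obtain K A where K: "K > 0" and A: "A \<in> events" "prob A < \<epsilon>" "\<forall>\<omega>\<in>space M - A. \<forall>t\<in>{0..1}. norm (\<zeta> t \<omega>) \<le> K"
      using process_tight[OF F_measurable_M[OF \<zeta>(1)] \<zeta>(2) \<open>\<epsilon> > 0\<close>] by auto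
    show "\<exists>A\<in>events. \<exists>Z'. prob A < \<epsilon> \<and> mesh_small u v Z' \<and>
      (\<forall>n \<tau>. partition_on_interval u v n \<tau> \<longrightarrow> (\<forall>\<omega>\<in>space M - A. \<bar>\<Sum>i<n. \<zeta> (\<tau> i) \<omega> *
        ((dX \<tau> i \<omega> \<bullet> e) * (dX \<tau> i \<omega> \<bullet> e') - (\<sigma> (\<tau> i))\<^sup>2 * ((dW \<tau> i \<omega> \<bullet> e) * (dW \<tau> i \<omega> \<bullet> e')))\<bar> \<le> \<bar>Z' n \<tau> \<omega>\<bar>))"
    proof (intro bexI[OF _ A(1)] exI[of _ "\<lambda>n \<tau> \<omega>. K * P n \<tau> \<omega>"] conjI A(2) mesh_small_scale P allI impI ballI)
      fix n \<tau> \<omega> assume part: "partition_on_interval u v n \<tau>" and \<omega>: "\<omega> \<in> space M - A"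
      have "\<bar>\<zeta> (\<tau> i) \<omega> * ((dX \<tau> i \<omega> \<bullet> e) * (dX \<tau> i \<omega> \<bullet> e') - (\<sigma> (\<tau> i))\<^sup>2 * ((dW \<tau> i \<omega> \<bullet> e) * (dW \<tau> i \<omega> \<bullet> e')))\<bar>
        \<le> K * (2 * C * (norm (dW \<tau> i \<omega>) * norm (residual \<tau> i \<omega>)) + (norm (residual \<tau> i \<omega>))\<^sup>2)" if "i < n" for i
      proof -
        have \<tau>i: "\<tau> i \<in> {0..1}"
          using that partition_in_interval[OF part, of i] uv by auto
        define s w r where "s = \<sigma> (\<tau> i)" "w = dW \<tau> i \<omega>" "r = residual \<tau> i \<omega>"
        have dX: "dX \<tau> i \<omega> = s *\<^sub>R w + r"
          by (simp add: s_w_r_def residual_def)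
        have s: "\<bar>s\<bar> \<le> C"
          unfolding s_w_r_def by (rule C(2)[OF \<tau>i])
        have b: "\<bar>w \<bullet> e\<bar> \<le> norm w" "\<bar>w \<bullet> e'\<bar> \<le> norm w" "\<bar>r \<bullet> e\<bar> \<le> norm r" "\<bar>r \<bullet> e'\<bar> \<le> norm r"
          using e Basis_le_norm by auto
        have "(dX \<tau> i \<omega> \<bullet> e) * (dX \<tau> i \<omega> \<bullet> e') - s\<^sup>2 * ((w \<bullet> e) * (w \<bullet> e')) =
            s * ((w \<bullet> e) * (r \<bullet> e')) + s * ((w \<bullet> e') * (r \<bullet> e)) + (r \<bullet> e) * (r \<bullet> e')"
          unfolding dX by (simp add: inner_add_left power2_eq_square algebra_simps)
        also have "\<bar>\<dots>\<bar> \<le> C * (norm w * norm r) + C * (norm w * norm r) + norm r * norm r"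
        proof (intro order_trans[OF abs_triangle_ineq] add_mono)
          show "\<bar>s * ((w \<bullet> e) * (r \<bullet> e'))\<bar> \<le> C * (norm w * norm r)" "\<bar>s * ((w \<bullet> e') * (r \<bullet> e))\<bar> \<le> C * (norm w * norm r)"
            "\<bar>(r \<bullet> e) * (r \<bullet> e')\<bar> \<le> norm r * norm r"
            unfolding abs_mult using s b C(1) by (auto intro!: mult_mono)
        qed
        also have "\<dots> = 2 * C * (norm w * norm r) + (norm r)\<^sup>2"
          by (simp add: power2_eq_square)
        finally have main: "\<bar>(dX \<tau> i \<omega> \<bullet> e) * (dX \<tau> i \<omega> \<bullet> e') - s\<^sup>2 * ((w \<bullet> e) * (w \<bullet> e'))\<bar> \<le>
          2 * C * (norm w * norm r) + (norm r)\<^sup>2" .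
        have "\<bar>\<zeta> (\<tau> i) \<omega>\<bar> \<le> K"
          using A(3) \<omega> \<tau>i by auto
        then show ?thesis
          unfolding abs_mult[of "\<zeta> (\<tau> i) \<omega>"] using main K unfolding s_w_r_def by (intro mult_mono) auto
      qed
      then have "\<bar>\<Sum>i<n. \<zeta> (\<tau> i) \<omega> * ((dX \<tau> i \<omega> \<bullet> e) * (dX \<tau> i \<omega> \<bullet> e') - (\<sigma> (\<tau> i))\<^sup>2 * ((dW \<tau> i \<omega> \<bullet> e) * (dW \<tau> i \<omega> \<bullet> e')))\<bar>
        \<le> (\<Sum>i<n. K * (2 * C * (norm (dW \<tau> i \<omega>) * norm (residual \<tau> i \<omega>)) + (norm (residual \<tau> i \<omega>))\<^sup>2))"
        by (intro order_trans[OF sum_abs] sum_mono) auto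
      also have "\<dots> = K * P n \<tau> \<omega>"
        unfolding P_def sum_distrib_left[of "2 * C"] sum.distrib[symmetric] by (rule sum_distrib_left[symmetric])
      finally show "\<bar>\<Sum>i<n. \<zeta> (\<tau> i) \<omega> * ((dX \<tau> i \<omega> \<bullet> e) * (dX \<tau> i \<omega> \<bullet> e') - (\<sigma> (\<tau> i))\<^sup>2 * ((dW \<tau> i \<omega> \<bullet> e) * (dW \<tau> i \<omega> \<bullet> e')))\<bar>
        \<le> \<bar>K * P n \<tau> \<omega>\<bar>" by simp
    qed
  qed
  \<comment> \<open>The squared diffusion coefficient joins the weight, which stays adapted and
    continuous, so the Brownian result applies.\<close>
  have W: "mesh_small u v (\<lambda>n \<tau> \<omega>. \<Sum>i<n. ((\<sigma> (\<tau> i))\<^sup>2 * \<zeta> (\<tau> i) \<omega>) *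
    ((dW \<tau> i \<omega> \<bullet> e) * (dW \<tau> i \<omega> \<bullet> e') - (if e = e' then \<tau> (Suc i) - \<tau> i else 0)))"
  proof (rule W_weighted_quadratic_variation[OF uv e])
    show "(\<lambda>\<omega>. (\<sigma> t)\<^sup>2 * \<zeta> t \<omega>) \<in> borel_measurable (F t)" if "t \<in> {0..1}" for t
      using \<zeta>(1)[OF that] by simp
    show "AE \<omega> in M. continuous_on {0..1} (\<lambda>t. (\<sigma> t)\<^sup>2 * \<zeta> t \<omega>)"
      using \<zeta>(2) by eventually_elim (intro continuous_intros \<sigma>_continuous)
  qed
  have "(\<lambda>n \<tau> \<omega>. \<Sum>i<n. \<zeta> (\<tau> i) \<omega> *
    ((dX \<tau> i \<omega> \<bullet> e) * (dX \<tau> i \<omega> \<bullet> e') - (if e = e' then (\<sigma> (\<tau> i))\<^sup>2 * (\<tau> (Suc i) - \<tau> i) else 0))) =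
    (\<lambda>n \<tau> \<omega>. (\<Sum>i<n. \<zeta> (\<tau> i) \<omega> *
    ((dX \<tau> i \<omega> \<bullet> e) * (dX \<tau> i \<omega> \<bullet> e') - (\<sigma> (\<tau> i))\<^sup>2 * ((dW \<tau> i \<omega> \<bullet> e) * (dW \<tau> i \<omega> \<bullet> e')))) +
    (\<Sum>i<n. ((\<sigma> (\<tau> i))\<^sup>2 * \<zeta> (\<tau> i) \<omega>) *
    ((dW \<tau> i \<omega> \<bullet> e) * (dW \<tau> i \<omega> \<bullet> e') - (if e = e' then \<tau> (Suc i) - \<tau> i else 0))))"
    unfolding sum.distrib[symmetric] by (intro ext sum.cong refl) (simp add: algebra_simps)
  then show ?thesis
    using mesh_small_add[OF approx W] by simp
qed

lemma Riemann_sum_small: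
  assumes uv: "0 \<le> u" "v \<le> 1"
    and \<psi>: "\<And>t. t \<in> {0..1} \<Longrightarrow> \<psi> t \<in> borel_measurable M" "AE \<omega> in M. continuous_on {0..1} (\<lambda>t. \<psi> t \<omega> :: real)"
  shows "mesh_small u v (\<lambda>n \<tau> \<omega>. (\<Sum>i<n. \<psi> (\<tau> i) \<omega> * (\<tau> (Suc i) - \<tau> i)) - (LINT s:{u..v}|lborel. \<psi> s \<omega>))"
  unfolding mesh_small_def
proof (intro allI impI)
  fix \<epsilon> :: real assume "\<epsilon> > 0"
  obtain \<delta> A where \<delta>: "\<delta> > 0" and A: "A \<in> events" "prob A < \<epsilon>"
    "\<forall>\<omega>\<in>space M - A. \<forall>s\<in>{0..1}. \<forall>t\<in>{0..1}. \<bar>s - t\<bar> < \<delta> \<longrightarrow> dist (\<psi> s \<omega>) (\<psi> t \<omega>) \<le> \<epsilon>"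
    using process_modulus[OF \<psi> \<open>\<epsilon> > 0\<close> \<open>\<epsilon> > 0\<close>] by auto
  obtain A' where A': "A' \<in> events" "prob A' = 0"
    "\<And>\<omega>. \<omega> \<in> space M \<Longrightarrow> \<omega> \<notin> A' \<Longrightarrow> continuous_on {0..1} (\<lambda>t. \<psi> t \<omega>)"
    using AE_null_eventE[OF \<psi>(2)] by blast
  have "prob_bound \<epsilon> \<epsilon> (\<lambda>\<omega>. (\<Sum>i<n. \<psi> (\<tau> i) \<omega> * (\<tau> (Suc i) - \<tau> i)) - (LINT s:{u..v}|lborel. \<psi> s \<omega>))"
    if "fine_partition u v \<delta> n \<tau>" for n \<tau>
  proof (rule prob_boundI[of "A \<union> A'"])
    show "prob (A \<union> A') < \<epsilon>"
      using A(1,2) A'(1,2) measure_Un_le[of A M A'] by auto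
    fix \<omega> assume "\<omega> \<in> space M" "\<omega> \<notin> A \<union> A'"
    then show "\<bar>(\<Sum>i<n. \<psi> (\<tau> i) \<omega> * (\<tau> (Suc i) - \<tau> i)) - (LINT s:{u..v}|lborel. \<psi> s \<omega>)\<bar> \<le> \<epsilon>"
      using A(3) A'(3) \<open>\<epsilon> > 0\<close> by (intro Riemann_sum_error[OF _ uv _ that]) auto
  qed (use A(1) A'(1) in auto)
  then show "\<exists>\<delta>>0. \<forall>n \<tau>. fine_partition u v \<delta> n \<tau> \<longrightarrow>
      prob_bound \<epsilon> \<epsilon> (\<lambda>\<omega>. (\<Sum>i<n. \<psi> (\<tau> i) \<omega> * (\<tau> (Suc i) - \<tau> i)) - (LINT s:{u..v}|lborel. \<psi> s \<omega>))"
    using \<delta> by blast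
qed

lemma X_square_sum_tight:
  assumes uv: "0 \<le> u" "v \<le> 1"
  shows "mesh_tight u v (\<lambda>n \<tau> \<omega>. \<Sum>i<n. (norm (dX \<tau> i \<omega>))\<^sup>2)"
proof -
  obtain C where C: "C > 0" "\<And>t. t \<in> {0..1} \<Longrightarrow> \<bar>\<sigma> t\<bar> \<le> C"
    using \<sigma>_bounded by blast
  have "mesh_tight u v (\<lambda>n \<tau> \<omega>. (\<Sum>i<n. (norm (dW \<tau> i \<omega>))\<^sup>2) + (\<Sum>i<n. (norm (residual \<tau> i \<omega>))\<^sup>2))"
    by (intro mesh_tight_add W_square_sum_tight mesh_small_imp_tight residual_square_small uv)
  then show ?thesis
  \<comment> \<open>From \<open>(a + b)\<^sup>2 \<le> 2 * a\<^sup>2 + 2 * b\<^sup>2\<close>, with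
    one common factor for the noise and the residual.\<close>
  proof (rule mesh_tight_mono[where c="2 * C\<^sup>2 + 2"])
    fix n \<tau> \<omega> assume part: "partition_on_interval u v n \<tau>"
    have "(norm (dX \<tau> i \<omega>))\<^sup>2 \<le> (2 * C\<^sup>2 + 2) * ((norm (dW \<tau> i \<omega>))\<^sup>2 + (norm (residual \<tau> i \<omega>))\<^sup>2)" if "i < n" for i
    proof -
      have "\<bar>\<sigma> (\<tau> i)\<bar> \<le> C"
        using that partition_in_interval[OF part, of i] uv C(2) by auto
      have "dX \<tau> i \<omega> = \<sigma> (\<tau> i) *\<^sub>R dW \<tau> i \<omega> + residual \<tau> i \<omega>"
        by (simp add: residual_def)
      then have "norm (dX \<tau> i \<omega>) \<le> \<bar>\<sigma> (\<tau> i)\<bar> * norm (dW \<tau> i \<omega>) + norm (residual \<tau> i \<omega>)"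
        by (metis norm_triangle_ineq norm_scaleR)
      also have "\<dots> \<le> C * norm (dW \<tau> i \<omega>) + norm (residual \<tau> i \<omega>)"
        using \<open>\<bar>\<sigma> (\<tau> i)\<bar> \<le> C\<close> by (intro add_mono mult_right_mono) auto
      finally have "(norm (dX \<tau> i \<omega>))\<^sup>2 \<le> (C * norm (dW \<tau> i \<omega>) + norm (residual \<tau> i \<omega>))\<^sup>2"
        by (intro power_mono) auto
      also have "\<dots> \<le> 2 * (C * norm (dW \<tau> i \<omega>))\<^sup>2 + 2 * (norm (residual \<tau> i \<omega>))\<^sup>2"
        using sum_squares_bound[of "C * norm (dW \<tau> i \<omega>)" "norm (residual \<tau> i \<omega>)"] by (simp add: power2_sum)
      also have "\<dots> \<le> (2 * C\<^sup>2 + 2) * (norm (dW \<tau> i \<omega>))\<^sup>2 + (2 * C\<^sup>2 + 2) * (norm (residual \<tau> i \<omega>))\<^sup>2"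
        unfolding power_mult_distrib mult.assoc[symmetric] by (intro add_mono mult_right_mono) auto
      finally show ?thesis
        by (simp add: distrib_left)
    qed
    then have "(\<Sum>i<n. (norm (dX \<tau> i \<omega>))\<^sup>2) \<le> (\<Sum>i<n. (2 * C\<^sup>2 + 2) * ((norm (dW \<tau> i \<omega>))\<^sup>2 + (norm (residual \<tau> i \<omega>))\<^sup>2))"
      by (intro sum_mono) auto
    also have "\<dots> = (2 * C\<^sup>2 + 2) * ((\<Sum>i<n. (norm (dW \<tau> i \<omega>))\<^sup>2) + (\<Sum>i<n. (norm (residual \<tau> i \<omega>))\<^sup>2))"
      by (simp only: sum_distrib_left[symmetric] sum.distrib)
    finally show "\<bar>\<Sum>i<n. (norm (dX \<tau> i \<omega>))\<^sup>2\<bar> \<le> (2 * C\<^sup>2 + 2) * \<bar>(\<Sum>i<n. (norm (dW \<tau> i \<omega>))\<^sup>2) + (\<Sum>i<n. (norm (residual \<tau> i \<omega>))\<^sup>2)\<bar>"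
      by (simp add: sum_nonneg)
  qed (simp add: add_nonneg_pos)
qed

section \<open>Increments of a regular field along the process\<close>

context
  fixes g :: "real \<Rightarrow> 'v \<Rightarrow> 'v"
  assumes g: "regular_drift g"
begin

abbreviation "Dg t x \<equiv> frechet_derivative (g t) (at x)"

lemma g_continuous: "continuous_on ({0..1} \<times> UNIV) (\<lambda>(t, x). g t x)"
  and g_differentiable: "t \<in> {0..1} \<Longrightarrow> g t differentiable (at x)"
  and Dg_continuous: "continuous_on ({0..1} \<times> UNIV) (\<lambda>(t, x). Dg t x w)"
  using g by (auto simp: regular_drift_def)

lemma Dg_linear: "t \<in> {0..1} \<Longrightarrow> linear (Dg t x)"
  by (rule linear_frechet_derivative[OF g_differentiable])

lemma time_increment_small:
  assumes uv: "0 \<le> u" "v \<le> 1"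
  shows "mesh_small u v (\<lambda>n \<tau> \<omega>. \<Sum>i<n. (g (\<tau> (Suc i)) (X (\<tau> i) \<omega>) - g (\<tau> i) (X (\<tau> i) \<omega>)) \<bullet> dX \<tau> i \<omega>)"
  unfolding mesh_small_def
proof (intro allI impI)
  fix \<epsilon> :: real assume "\<epsilon> > 0"
  then obtain \<kappa> where \<kappa>: "\<kappa> > 0" "\<And>n \<tau> \<eta> A. partition_on_interval u v n \<tau> \<Longrightarrow>
    (\<forall>i<n. \<eta> i \<in> borel_measurable (F (\<tau> i))) \<Longrightarrow> A \<in> events \<Longrightarrow> prob A < \<epsilon> / 2 \<Longrightarrow>
    (\<forall>i<n. \<forall>\<omega>\<in>space M - A. norm (\<eta> i \<omega>) \<le> \<kappa>) \<Longrightarrow> prob_bound \<epsilon> \<epsilon> (\<lambda>\<omega>. \<Sum>i<n. \<eta> i \<omega> \<bullet> dX \<tau> i \<omega>)"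
    using sum_against_increments_small[of \<epsilon>] uv by blast
  \<comment> \<open>\<open>g\<close> is uniformly continuous on bounded sets only, which is why the
    path is first confined to a ball.\<close>
  obtain K A where K: "K > 0" and A: "A \<in> events" "prob A < \<epsilon> / 2" "\<forall>\<omega>\<in>space M - A. \<forall>t\<in>{0..1}. norm (X t \<omega>) \<le> K"
    using process_tight[OF X_measurable X_continuous, of "\<epsilon> / 2"] \<open>\<epsilon> > 0\<close> by auto
  obtain \<delta> where \<delta>: "\<delta> > 0" "\<forall>s\<in>{0..1}. \<forall>t\<in>{0..1}. \<forall>x\<in>cball 0 K. \<forall>y\<in>cball 0 K.
    \<bar>s - t\<bar> < \<delta> \<longrightarrow> dist x y < \<delta> \<longrightarrow> dist (g s x) (g t y) \<le> \<kappa>"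
    using uniform_on_bounded[OF g_continuous \<kappa>(1)] by blast
  have "prob_bound \<epsilon> \<epsilon> (\<lambda>\<omega>. \<Sum>i<n. (g (\<tau> (Suc i)) (X (\<tau> i) \<omega>) - g (\<tau> i) (X (\<tau> i) \<omega>)) \<bullet> dX \<tau> i \<omega>)"
    if fp: "fine_partition u v \<delta> n \<tau>" for n \<tau>
  proof -
    have part: "partition_on_interval u v n \<tau>"
      using fp by (simp add: fine_partition_def)
    note le = fine_partition_unit[OF fp uv]
    show ?thesis
    proof (rule \<kappa>(2)[OF part _ A(1,2)])
      show "\<forall>i<n. (\<lambda>\<omega>. g (\<tau> (Suc i)) (X (\<tau> i) \<omega>) - g (\<tau> i) (X (\<tau> i) \<omega>)) \<in> borel_measurable (F (\<tau> i))"
      proof (intro allI impI borel_measurable_diff)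
        fix i assume "i < n"
        \<comment> \<open>The later time is deterministic: only the position is random, so the
          weight is still known at time \<open>\<tau> i\<close>.\<close>
        have "continuous_on UNIV (g (\<tau> (Suc i)))"
          by (rule continuous_on_time_slice[OF g_continuous le(2)[OF \<open>i < n\<close>]])
        then show "(\<lambda>\<omega>. g (\<tau> (Suc i)) (X (\<tau> i) \<omega>)) \<in> borel_measurable (F (\<tau> i))"
          using borel_measurable_continuous_onI measurable_compose[OF X_adapted[OF le(1)[OF \<open>i < n\<close>]]] by blast
        show "(\<lambda>\<omega>. g (\<tau> i) (X (\<tau> i) \<omega>)) \<in> borel_measurable (F (\<tau> i))"
          by (rule compose_adapted[OF g_continuous le(1)[OF \<open>i < n\<close>]])
      qed
      show "\<forall>i<n. \<forall>\<omega>\<in>space M - A. norm (g (\<tau> (Suc i)) (X (\<tau> i) \<omega>) - g (\<tau> i) (X (\<tau> i) \<omega>)) \<le> \<kappa>"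
        using A(3) le \<delta> by (auto simp: dist_norm[symmetric])
    qed
  qed
  then show "\<exists>\<delta>>0. \<forall>n \<tau>. fine_partition u v \<delta> n \<tau> \<longrightarrow>
      prob_bound \<epsilon> \<epsilon> (\<lambda>\<omega>. \<Sum>i<n. (g (\<tau> (Suc i)) (X (\<tau> i) \<omega>) - g (\<tau> i) (X (\<tau> i) \<omega>)) \<bullet> dX \<tau> i \<omega>)"
    using \<delta>(1) by blast
qed

text \<open>The mean value point \<open>\<xi>\<close> and the later time are both replaced by the
  left endpoint. Continuity of the derivative makes the error on a cell a small multiple of the
  squared increment, and the square sums are tight; no second derivative enters.\<close>

lemma space_increment_expansion:
  assumes uv: "0 \<le> u" "v \<le> 1"
  shows "mesh_small u v (\<lambda>n \<tau> \<omega>. \<Sum>i<n. (g (\<tau> (Suc i)) (X (\<tau> (Suc i)) \<omega>) - g (\<tau> (Suc i)) (X (\<tau> i) \<omega>)) \<bullet> dX \<tau> i \<omega>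
    - Dg (\<tau> i) (X (\<tau> i) \<omega>) (dX \<tau> i \<omega>) \<bullet> dX \<tau> i \<omega>)"
  unfolding mesh_small_def
proof (intro allI impI)
  fix \<epsilon> :: real assume "\<epsilon> > 0"
  then have \<epsilon>3: "\<epsilon> / 3 > 0" by simp
  let ?d = "real DIM('v)"
  obtain L d1 where L: "L > 0" "d1 > 0" "\<And>n \<tau>. fine_partition u v d1 n \<tau> \<Longrightarrow> prob_bound (\<epsilon> / 3) L (\<lambda>\<omega>. \<Sum>i<n. (norm (dX \<tau> i \<omega>))\<^sup>2)"
    using X_square_sum_tight[OF uv] \<epsilon>3 unfolding mesh_tight_def by meson
  \<comment> \<open>\<open>L\<close> bounds the square sum and the dimension comes from
    \<open>linear_diff_bound\<close>, so the total error is at most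
    \<open>\<epsilon>\<close>.\<close>
  define \<kappa> where "\<kappa> = \<epsilon> / (L * ?d)"
  have \<kappa>: "\<kappa> > 0" "?d * \<kappa> * L = \<epsilon>"
    using L(1) \<open>\<epsilon> > 0\<close> by (auto simp: \<kappa>_def)
  obtain K A1 where K: "K > 0" and A1: "A1 \<in> events" "prob A1 < \<epsilon> / 3" "\<forall>\<omega>\<in>space M - A1. \<forall>t\<in>{0..1}. norm (X t \<omega>) \<le> K"
    using process_tight[OF X_measurable X_continuous \<epsilon>3] by auto
  have "\<forall>e\<in>Basis. \<exists>\<delta>>0. \<forall>s\<in>{0..1}. \<forall>t\<in>{0..1}. \<forall>x\<in>cball 0 K. \<forall>y\<in>cball 0 K.
    \<bar>s - t\<bar> < \<delta> \<longrightarrow> dist x y < \<delta> \<longrightarrow> dist (Dg s x e) (Dg t y e) \<le> \<kappa>"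
    using uniform_on_bounded[OF Dg_continuous \<kappa>(1)] by blast
  then obtain \<delta>B where \<delta>B: "\<And>e. e \<in> Basis \<Longrightarrow> \<delta>B e > 0" "\<And>e s t x y. e \<in> Basis \<Longrightarrow> s \<in> {0..1} \<Longrightarrow> t \<in> {0..1} \<Longrightarrow>
    x \<in> cball 0 K \<Longrightarrow> y \<in> cball 0 K \<Longrightarrow> \<bar>s - t\<bar> < \<delta>B e \<Longrightarrow> dist x y < \<delta>B e \<Longrightarrow> dist (Dg s x e) (Dg t y e) \<le> \<kappa>"
    by metis
  \<comment> \<open>A common radius for all basis vectors, since continuity is given direction by
    direction.\<close>
  define \<delta>0 where "\<delta>0 = Min (\<delta>B ` Basis)"
  have \<delta>0: "\<delta>0 > 0" "\<And>e. e \<in> Basis \<Longrightarrow> \<delta>0 \<le> \<delta>B e"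
    using \<delta>B(1) by (auto simp: \<delta>0_def)
  \<comment> \<open>The path modulus yields a weak inequality while the derivative estimate wants a
    strict one, hence half the radius.\<close>
  have \<delta>02: "\<delta>0 / 2 > 0" using \<delta>0(1) by simp
  obtain d2 A2 where d2: "d2 > 0" and A2: "A2 \<in> events" "prob A2 < \<epsilon> / 3"
    "\<forall>\<omega>\<in>space M - A2. \<forall>s\<in>{0..1}. \<forall>t\<in>{0..1}. \<bar>s - t\<bar> < d2 \<longrightarrow> dist (X s \<omega>) (X t \<omega>) \<le> \<delta>0 / 2"
    using process_modulus[OF X_measurable X_continuous \<epsilon>3 \<delta>02] by auto
  define \<delta> where "\<delta> = min d1 (min d2 \<delta>0)"
  have \<delta>: "\<delta> > 0" "\<delta> \<le> d1" "\<delta> \<le> d2" "\<delta> \<le> \<delta>0"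
    using L(2) d2 \<delta>0(1) by (auto simp: \<delta>_def)
  let ?T = "\<lambda>\<tau> i \<omega>. (g (\<tau> (Suc i)) (X (\<tau> (Suc i)) \<omega>) - g (\<tau> (Suc i)) (X (\<tau> i) \<omega>)) \<bullet> dX \<tau> i \<omega>
    - Dg (\<tau> i) (X (\<tau> i) \<omega>) (dX \<tau> i \<omega>) \<bullet> dX \<tau> i \<omega>"
  have "prob_bound \<epsilon> \<epsilon> (\<lambda>\<omega>. \<Sum>i<n. ?T \<tau> i \<omega>)" if fp: "fine_partition u v \<delta> n \<tau>" for n \<tau>
  proof -
    have part: "partition_on_interval u v n \<tau>"
      using fp by (simp add: fine_partition_def)
    note le = fine_partition_unit[OF fp uv]
    obtain A3 where A3: "A3 \<in> events" "prob A3 < \<epsilon> / 3" "\<And>\<omega>. \<omega> \<in> space M \<Longrightarrow> \<omega> \<notin> A3 \<Longrightarrow> \<bar>\<Sum>i<n. (norm (dX \<tau> i \<omega>))\<^sup>2\<bar> \<le> L"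
      using prob_boundE[OF L(3)[OF fine_partition_mono[OF fp \<delta>(2)]]] by blast
    show ?thesis
    proof (rule prob_boundI[of "A1 \<union> A2 \<union> A3"])
      show "prob (A1 \<union> A2 \<union> A3) < \<epsilon>"
        using prob_union_less[of "A1 \<union> A2" A3 "\<epsilon>/3 + \<epsilon>/3" "\<epsilon>/3"] prob_union_less[of A1 A2 "\<epsilon>/3" "\<epsilon>/3"] A1 A2 A3
        by auto
      fix \<omega> assume "\<omega> \<in> space M" "\<omega> \<notin> A1 \<union> A2 \<union> A3"
      then have \<omega>: "\<omega> \<in> space M - A1" "\<omega> \<in> space M - A2" "\<omega> \<in> space M" "\<omega> \<notin> A3"
        by auto
      have "\<bar>?T \<tau> i \<omega>\<bar> \<le> ?d * \<kappa> * (norm (dX \<tau> i \<omega>))\<^sup>2" if "i < n" for i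
      proof -
        define s t x y where "s = \<tau> (Suc i)" "t = \<tau> i" "x = X (\<tau> i) \<omega>" "y = X (\<tau> (Suc i)) \<omega>"
        note defs = s_t_x_y_def
        have st: "s \<in> {0..1}" "t \<in> {0..1}" "\<bar>s - t\<bar> < \<delta>"
          using le[OF that] by (auto simp: defs)
        have xy: "x \<in> cball 0 K" "y \<in> cball 0 K"
          using A1(3) \<omega>(1) le[OF that] by (auto simp: defs)
        have dxy: "dist x y \<le> \<delta>0 / 2"
          using A2(3) \<omega>(2) st \<delta>(3) by (auto simp: defs dist_commute)
        obtain \<xi> where \<xi>: "\<xi> \<in> closed_segment x y" "(g s y - g s x) \<bullet> (y - x) = Dg s \<xi> (y - x) \<bullet> (y - x)"
          using mvt_inner[OF g_differentiable[OF st(1)], of x y "y - x"] by blast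
        have \<xi>K: "\<xi> \<in> cball 0 K"
          using \<xi>(1) xy closed_segment_subset[OF xy] by auto
        have "dist \<xi> x \<le> dist x y"
          using \<xi>(1) dist_in_closed_segment[OF \<xi>(1)] by (simp add: dist_commute)
        then have d\<xi>: "dist \<xi> x < \<delta>0"
          using dxy \<delta>0(1) by linarith
        have "norm (Dg s \<xi> e - Dg t x e) \<le> \<kappa>" if "e \<in> Basis" for e
          using \<delta>B(2)[OF that st(1,2) \<xi>K xy(1)] st(3) \<delta>(4) \<delta>0(2)[OF that] d\<xi> by (simp add: dist_norm)
        then have "norm (Dg s \<xi> (y - x) - Dg t x (y - x)) \<le> ?d * \<kappa> * norm (y - x)"
          using \<kappa>(1) by (intro linear_diff_bound Dg_linear st) auto
        then have "\<bar>(Dg s \<xi> (y - x) - Dg t x (y - x)) \<bullet> (y - x)\<bar> \<le> ?d * \<kappa> * norm (y - x) * norm (y - x)"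
          by (intro order_trans[OF Cauchy_Schwarz_ineq2] mult_right_mono) auto
        moreover have "?T \<tau> i \<omega> = (Dg s \<xi> (y - x) - Dg t x (y - x)) \<bullet> (y - x)"
          unfolding inner_diff_left[of "Dg s \<xi> (y - x)"] \<xi>(2)[symmetric] by (simp only: defs)
        ultimately show ?thesis
          by (simp add: defs power2_eq_square mult.assoc)
      qed
      then have "\<bar>\<Sum>i<n. ?T \<tau> i \<omega>\<bar> \<le> (\<Sum>i<n. ?d * \<kappa> * (norm (dX \<tau> i \<omega>))\<^sup>2)"
        by (intro order_trans[OF sum_abs] sum_mono) auto
      also have "\<dots> = ?d * \<kappa> * (\<Sum>i<n. (norm (dX \<tau> i \<omega>))\<^sup>2)"
        by (rule sum_distrib_left[symmetric])
      also have "\<dots> \<le> ?d * \<kappa> * L"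
        using A3(3)[OF \<omega>(3,4)] \<kappa>(1) by (intro mult_left_mono) auto
      finally show "\<bar>\<Sum>i<n. ?T \<tau> i \<omega>\<bar> \<le> \<epsilon>"
        using \<kappa>(2) by simp
    qed (use A1 A2 A3 in auto)
  qed
  then show "\<exists>\<delta>>0. \<forall>n \<tau>. fine_partition u v \<delta> n \<tau> \<longrightarrow> prob_bound \<epsilon> \<epsilon> (\<lambda>\<omega>. \<Sum>i<n. ?T \<tau> i \<omega>)"
    using \<delta>(1) by blast
qed

text \<open>The error is exactly \<open>?T1 + ?T2 + ?T3 + ?T4\<close>: moving the time, linearising
  in space, replacing products of increments by their compensators, and the Riemann sum error of the
  time integral.\<close>

lemma covariation_small:
  assumes uv: "0 \<le> u" "v \<le> 1"
  shows "mesh_small u v (\<lambda>n \<tau> \<omega>. right_sum (\<bullet>) (\<lambda>s \<omega>. g s (X s \<omega>)) X n \<tau> \<omega> - left_sum (\<bullet>) (\<lambda>s \<omega>. g s (X s \<omega>)) X n \<tau> \<omega>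
    - (LINT s:{u..v}|lborel. (\<sigma> s)\<^sup>2 * divergence (g s) (X s \<omega>)))"
proof -
  let ?T1 = "\<lambda>n \<tau> \<omega>. \<Sum>i<n. (g (\<tau> (Suc i)) (X (\<tau> i) \<omega>) - g (\<tau> i) (X (\<tau> i) \<omega>)) \<bullet> dX \<tau> i \<omega>"
  let ?T2 = "\<lambda>n \<tau> \<omega>. \<Sum>i<n. (g (\<tau> (Suc i)) (X (\<tau> (Suc i)) \<omega>) - g (\<tau> (Suc i)) (X (\<tau> i) \<omega>)) \<bullet> dX \<tau> i \<omega>
    - Dg (\<tau> i) (X (\<tau> i) \<omega>) (dX \<tau> i \<omega>) \<bullet> dX \<tau> i \<omega>"
  let ?a = "\<lambda>e' e t \<omega>. Dg t (X t \<omega>) e' \<bullet> e"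
  let ?c = "\<lambda>e' e \<tau> i. if e' = e then (\<sigma> (\<tau> i))\<^sup>2 * (\<tau> (Suc i) - \<tau> i) else 0"
  let ?T3 = "\<lambda>n \<tau> \<omega>. \<Sum>e'\<in>Basis. \<Sum>e\<in>Basis. \<Sum>i<n. ?a e' e (\<tau> i) \<omega> * ((dX \<tau> i \<omega> \<bullet> e') * (dX \<tau> i \<omega> \<bullet> e) - ?c e' e \<tau> i)"
  define \<psi> where "\<psi> t \<omega> = (\<sigma> t)\<^sup>2 * divergence (g t) (X t \<omega>)" for t \<omega>
  let ?T4 = "\<lambda>n \<tau> \<omega>. (\<Sum>i<n. \<psi> (\<tau> i) \<omega> * (\<tau> (Suc i) - \<tau> i)) - (LINT s:{u..v}|lborel. \<psi> s \<omega>)"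
  have a_cont: "continuous_on ({0..1} \<times> UNIV) (\<lambda>(t, x). Dg t x e' \<bullet> e)" for e e'
    using Dg_continuous[of e'] unfolding case_prod_beta' by (intro continuous_intros)
  have T3: "mesh_small u v ?T3"
    by (intro mesh_small_sum finite_Basis weighted_covariation uv compose_adapted[OF a_cont] compose_continuous[OF a_cont])
  have div_cont: "continuous_on ({0..1} \<times> UNIV) (\<lambda>(t, x). (\<sigma> t)\<^sup>2 * divergence (g t) x)"
  proof -
    have "continuous_on ({0..1} \<times> UNIV) (\<lambda>p::real \<times> 'v. \<sigma> (fst p))"
      by (rule continuous_on_compose2[OF \<sigma>_continuous]) (auto intro!: continuous_intros)
    then show ?thesis
      unfolding divergence_def case_prod_beta'
      using a_cont unfolding case_prod_beta' by (intro continuous_on_mult continuous_on_power continuous_on_sum)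
  qed
  have T4: "mesh_small u v ?T4"
    unfolding \<psi>_def using F_measurable_M[OF compose_adapted[OF div_cont]] compose_continuous[OF div_cont]
    by (intro Riemann_sum_small uv)
  have "mesh_small u v (\<lambda>n \<tau> \<omega>. ?T1 n \<tau> \<omega> + ?T2 n \<tau> \<omega> + ?T3 n \<tau> \<omega> + ?T4 n \<tau> \<omega>)"
    by (intro mesh_small_add time_increment_small space_increment_expansion T3 T4 uv)
  then show ?thesis
  proof (rule mesh_small_mono)
    fix n \<tau> \<omega> assume part: "partition_on_interval u v n \<tau>"
    have lin: "linear (Dg (\<tau> i) (X (\<tau> i) \<omega>))" if "i < n" for i
      using partition_in_interval[OF part, of i] that uv by (intro Dg_linear) auto
    have T3_eq: "?T3 n \<tau> \<omega> = (\<Sum>i<n. Dg (\<tau> i) (X (\<tau> i) \<omega>) (dX \<tau> i \<omega>) \<bullet> dX \<tau> i \<omega>) - (\<Sum>i<n. \<psi> (\<tau> i) \<omega> * (\<tau> (Suc i) - \<tau> i))"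
    proof -
      have "?T3 n \<tau> \<omega> = (\<Sum>e'\<in>Basis. \<Sum>i<n. \<Sum>e\<in>Basis. ?a e' e (\<tau> i) \<omega> * ((dX \<tau> i \<omega> \<bullet> e') * (dX \<tau> i \<omega> \<bullet> e) - ?c e' e \<tau> i))"
        by (intro sum.cong refl sum.swap)
      also have "\<dots> = (\<Sum>i<n. \<Sum>e'\<in>Basis. \<Sum>e\<in>Basis. ?a e' e (\<tau> i) \<omega> * ((dX \<tau> i \<omega> \<bullet> e') * (dX \<tau> i \<omega> \<bullet> e) - ?c e' e \<tau> i))"
        by (rule sum.swap)
      also have "\<dots> = (\<Sum>i<n. Dg (\<tau> i) (X (\<tau> i) \<omega>) (dX \<tau> i \<omega>) \<bullet> dX \<tau> i \<omega> - \<psi> (\<tau> i) \<omega> * (\<tau> (Suc i) - \<tau> i))"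
      proof (intro sum.cong refl)
        fix i assume "i \<in> {..<n}"
        then have exp: "Dg (\<tau> i) (X (\<tau> i) \<omega>) (dX \<tau> i \<omega>) \<bullet> dX \<tau> i \<omega> =
            (\<Sum>e'\<in>Basis. \<Sum>e\<in>Basis. ?a e' e (\<tau> i) \<omega> * ((dX \<tau> i \<omega> \<bullet> e') * (dX \<tau> i \<omega> \<bullet> e)))"
          by (intro linear_inner_expand lin) simp
        \<comment> \<open>Compensators vanish off the diagonal, so only the trace of the derivative
          survives, which is the divergence.\<close>
        have "(\<Sum>e'\<in>Basis. \<Sum>e\<in>Basis. ?a e' e (\<tau> i) \<omega> * ?c e' e \<tau> i) =
            (\<Sum>e'\<in>Basis. ?a e' e' (\<tau> i) \<omega> * ((\<sigma> (\<tau> i))\<^sup>2 * (\<tau> (Suc i) - \<tau> i)))"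
        proof (intro sum.cong refl)
          fix e' :: 'v assume "e' \<in> Basis"
          have "(\<Sum>e\<in>Basis. ?a e' e (\<tau> i) \<omega> * ?c e' e \<tau> i) =
              (\<Sum>e\<in>Basis. if e' = e then ?a e' e (\<tau> i) \<omega> * ((\<sigma> (\<tau> i))\<^sup>2 * (\<tau> (Suc i) - \<tau> i)) else 0)"
            by (intro sum.cong) auto
          then show "(\<Sum>e\<in>Basis. ?a e' e (\<tau> i) \<omega> * ?c e' e \<tau> i) = ?a e' e' (\<tau> i) \<omega> * ((\<sigma> (\<tau> i))\<^sup>2 * (\<tau> (Suc i) - \<tau> i))"
            using \<open>e' \<in> Basis\<close> by simp
        qed
        also have "\<dots> = \<psi> (\<tau> i) \<omega> * (\<tau> (Suc i) - \<tau> i)"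
          unfolding sum_distrib_right[symmetric] \<psi>_def divergence_def by (simp only: mult_ac)
        finally show "(\<Sum>e'\<in>Basis. \<Sum>e\<in>Basis. ?a e' e (\<tau> i) \<omega> * ((dX \<tau> i \<omega> \<bullet> e') * (dX \<tau> i \<omega> \<bullet> e) - ?c e' e \<tau> i)) =
            Dg (\<tau> i) (X (\<tau> i) \<omega>) (dX \<tau> i \<omega>) \<bullet> dX \<tau> i \<omega> - \<psi> (\<tau> i) \<omega> * (\<tau> (Suc i) - \<tau> i)"
          unfolding exp right_diff_distrib sum_subtractf by simp
      qed
      finally show ?thesis
        by (simp only: sum_subtractf)
    qed
    have "right_sum (\<bullet>) (\<lambda>s \<omega>. g s (X s \<omega>)) X n \<tau> \<omega> - left_sum (\<bullet>) (\<lambda>s \<omega>. g s (X s \<omega>)) X n \<tau> \<omega> =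
        ?T1 n \<tau> \<omega> + (\<Sum>i<n. (g (\<tau> (Suc i)) (X (\<tau> (Suc i)) \<omega>) - g (\<tau> (Suc i)) (X (\<tau> i) \<omega>)) \<bullet> dX \<tau> i \<omega>)"
      unfolding right_sum_def left_sum_def sum_subtractf[symmetric] sum.distrib[symmetric]
      by (intro sum.cong refl) (simp only: inner_diff_left[symmetric] inner_add_left[symmetric], simp)
    then have "right_sum (\<bullet>) (\<lambda>s \<omega>. g s (X s \<omega>)) X n \<tau> \<omega> - left_sum (\<bullet>) (\<lambda>s \<omega>. g s (X s \<omega>)) X n \<tau> \<omega>
        - (LINT s:{u..v}|lborel. \<psi> s \<omega>) = ?T1 n \<tau> \<omega> + ?T2 n \<tau> \<omega> + ?T3 n \<tau> \<omega> + ?T4 n \<tau> \<omega>"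
      unfolding T3_eq by (simp only: sum_subtractf)
    then show "\<bar>right_sum (\<bullet>) (\<lambda>s \<omega>. g s (X s \<omega>)) X n \<tau> \<omega> - left_sum (\<bullet>) (\<lambda>s \<omega>. g s (X s \<omega>)) X n \<tau> \<omega>
        - (LINT s:{u..v}|lborel. (\<sigma> s)\<^sup>2 * divergence (g s) (X s \<omega>))\<bar> \<le> \<bar>?T1 n \<tau> \<omega> + ?T2 n \<tau> \<omega> + ?T3 n \<tau> \<omega> + ?T4 n \<tau> \<omega>\<bar>"
      unfolding \<psi>_def by simp
  qed
qed

end

text \<open>The time integral is formed path by path, so the limit is stated as a measurable version
  that agrees with it almost surely.\<close>

theorem covariation_limit:
  assumes g: "regular_drift g" and uv: "0 \<le> u" "u \<le> v" "v \<le> 1"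
  shows "\<exists>I. mesh_limit_in_prob M u v
      (\<lambda>n \<tau> \<omega>. right_sum (\<bullet>) (\<lambda>s \<omega>. g s (X s \<omega>)) X n \<tau> \<omega> - left_sum (\<bullet>) (\<lambda>s \<omega>. g s (X s \<omega>)) X n \<tau> \<omega>) I \<and>
    (AE \<omega> in M. I \<omega> = (LINT s:{u..v}|lborel. (\<sigma> s)\<^sup>2 * divergence (g s) (X s \<omega>)))"
proof (rule mesh_limit_version[OF uv(2)])
  fix n \<tau> assume part: "partition_on_interval u v n \<tau>"
  have m: "(\<lambda>\<omega>. g (\<tau> i) (X (\<tau> i) \<omega>)) \<in> borel_measurable M" "X (\<tau> i) \<in> borel_measurable M" if "i \<le> n" for i
    using partition_in_interval[OF part that] uv F_measurable_M[OF compose_adapted[OF g_continuous[OF g]]] X_measurable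
    by auto
  show "(\<lambda>\<omega>. right_sum (\<bullet>) (\<lambda>s \<omega>. g s (X s \<omega>)) X n \<tau> \<omega> - left_sum (\<bullet>) (\<lambda>s \<omega>. g s (X s \<omega>)) X n \<tau> \<omega>) \<in> borel_measurable M"
    unfolding right_sum_def left_sum_def
    by (intro borel_measurable_diff borel_measurable_sum borel_measurable_inner m) auto
next
  show "mesh_small u v (\<lambda>n \<tau> \<omega>. dist
      (right_sum (\<bullet>) (\<lambda>s \<omega>. g s (X s \<omega>)) X n \<tau> \<omega> - left_sum (\<bullet>) (\<lambda>s \<omega>. g s (X s \<omega>)) X n \<tau> \<omega>)
      (LINT s:{u..v}|lborel. (\<sigma> s)\<^sup>2 * divergence (g s) (X s \<omega>)))"
    by (rule mesh_small_mono[OF covariation_small[OF g uv(1,3)]]) (simp add: dist_real_def)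
qed

end

section \<open>Time reversal\<close>

lemma LINT_reflect:
  fixes k :: "real \<Rightarrow> 'c::euclidean_space"
  shows "(LINT r:{s..t}|lborel. k (1 - r)) = (LINT r:{1 - t..1 - s}|lborel. k r)"
proof -
  have "(LINT r:{1 - t..1 - s}|lborel. k r) =
      \<bar>-1\<bar> *\<^sub>R (LINT r|lborel. indicator {1 - t..1 - s} (1 + -1 * r) *\<^sub>R k (1 + -1 * r))"
    unfolding set_lebesgue_integral_def by (rule lborel_integral_real_affine) simp
  also have "\<dots> = (LINT r|lborel. indicator {s..t} r *\<^sub>R k (1 - r))"
    by (auto intro!: Bochner_Integration.integral_cong split: split_indicator)
  finally show ?thesis
    by (simp add: set_lebesgue_integral_def)
qed

lemma set_integrable_reflect:
  fixes k :: "real \<Rightarrow> 'c::euclidean_space"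
  assumes "set_integrable lborel {0..1} k"
  shows "set_integrable lborel {0..1} (\<lambda>r. k (1 - r))"
proof -
  have "integrable lborel (\<lambda>r. indicator {0..1} (1 + -1 * r) *\<^sub>R k (1 + -1 * r))"
    using assms unfolding set_integrable_def by (intro lborel_integrable_real_affine) auto
  also have "(\<lambda>r. indicator {0..1} (1 + -1 * r) *\<^sub>R k (1 + -1 * r)) = (\<lambda>r::real. indicator {0..1} r *\<^sub>R k (1 - r))"
    by (auto split: split_indicator)
  finally show ?thesis
    by (simp add: set_integrable_def)
qed

text \<open>Reflection turns right endpoints into left ones and reverses each increment, which
  accounts for the sign. Oddness of \<open>B\<close> in the increment is an assumption because both
  the inner product and scalar multiplication are needed.\<close>

lemma left_sum_reverse:
  assumes "\<And>x y. B x (- y) = - B x y"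
  shows "left_sum B (\<lambda>s. H (1 - s)) (\<lambda>s. Y (1 - s)) n (\<lambda>j. 1 - \<tau> (n - j)) \<omega> = - right_sum B H Y n \<tau> \<omega>"
proof -
  have "left_sum B (\<lambda>s. H (1 - s)) (\<lambda>s. Y (1 - s)) n (\<lambda>j. 1 - \<tau> (n - j)) \<omega> =
      (\<Sum>i<n. - B (H (\<tau> (Suc (n - Suc i))) \<omega>) (Y (\<tau> (Suc (n - Suc i))) \<omega> - Y (\<tau> (n - Suc i)) \<omega>))"
    unfolding left_sum_def
    by (intro sum.cong refl) (simp add: assms[symmetric] Suc_diff_Suc)
  also have "\<dots> = - right_sum B H Y n \<tau> \<omega>"
    unfolding right_sum_def sum_negf
    using sum.nat_diff_reindex[of "\<lambda>k. B (H (\<tau> (Suc k)) \<omega>) (Y (\<tau> (Suc k)) \<omega> - Y (\<tau> k) \<omega>)" n] by simp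
  finally show ?thesis .
qed

lemma right_sum_reverse:
  assumes "\<And>x y. B x (- y) = - B x y"
  shows "right_sum B (\<lambda>s. H (1 - s)) (\<lambda>s. Y (1 - s)) n (\<lambda>j. 1 - \<tau> (n - j)) \<omega> = - left_sum B H Y n \<tau> \<omega>"
proof -
  have "right_sum B (\<lambda>s. H (1 - s)) (\<lambda>s. Y (1 - s)) n (\<lambda>j. 1 - \<tau> (n - j)) \<omega> =
      (\<Sum>i<n. - B (H (\<tau> (n - Suc i)) \<omega>) (Y (\<tau> (Suc (n - Suc i))) \<omega> - Y (\<tau> (n - Suc i)) \<omega>))"
    unfolding right_sum_def
    by (intro sum.cong refl) (simp add: assms[symmetric] Suc_diff_Suc)
  also have "\<dots> = - left_sum B H Y n \<tau> \<omega>"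
    unfolding left_sum_def sum_negf
    using sum.nat_diff_reindex[of "\<lambda>k. B (H (\<tau> k) \<omega>) (Y (\<tau> (Suc k)) \<omega> - Y (\<tau> k) \<omega>)" n] by simp
  finally show ?thesis .
qed

lemma mesh_limit_uminus:
  assumes "mesh_limit_in_prob M a b S I"
  shows "mesh_limit_in_prob M a b (\<lambda>n \<tau> \<omega>. - S n \<tau> \<omega>) (\<lambda>\<omega>. - I \<omega>)"
  using assms unfolding mesh_limit_in_prob_def dist_minus by simp

lemma (in prob_space) has_bwd_integral_reverse:
  assumes "has_bwd_integral B M H Y a b I" "\<And>x y. B x (- y) = - B x y"
  shows "has_fwd_integral B M (\<lambda>s. H (1 - s)) (\<lambda>s. Y (1 - s)) (1 - b) (1 - a) (\<lambda>\<omega>. - I \<omega>)"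
  unfolding has_fwd_integral_def
proof (rule mesh_limit_cong)
  show "mesh_limit_in_prob M (1 - b) (1 - a) (\<lambda>n \<tau> \<omega>. - right_sum B H Y n (\<lambda>j. 1 - \<tau> (n - j)) \<omega>) (\<lambda>\<omega>. - I \<omega>)"
    using mesh_limit_uminus[OF mesh_limit_reverse[OF assms(1)[unfolded has_bwd_integral_def]]] .
  show "left_sum B (\<lambda>s. H (1 - s)) (\<lambda>s. Y (1 - s)) n \<tau> \<omega> = - right_sum B H Y n (\<lambda>j. 1 - \<tau> (n - j)) \<omega>" for n \<tau> \<omega>
    using right_sum_reverse[of B "\<lambda>s. H (1 - s)" "\<lambda>s. Y (1 - s)" n \<tau> \<omega>, OF assms(2)] by simp
qed

lemma (in prob_space) has_fwd_integral_reverse: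
  assumes "has_fwd_integral B M (\<lambda>s. H (1 - s)) (\<lambda>s. Y (1 - s)) a b I" "\<And>x y. B x (- y) = - B x y"
  shows "has_bwd_integral B M H Y (1 - b) (1 - a) (\<lambda>\<omega>. - I \<omega>)"
  unfolding has_bwd_integral_def
proof (rule mesh_limit_cong)
  show "mesh_limit_in_prob M (1 - b) (1 - a)
      (\<lambda>n \<tau> \<omega>. - left_sum B (\<lambda>s. H (1 - s)) (\<lambda>s. Y (1 - s)) n (\<lambda>j. 1 - \<tau> (n - j)) \<omega>) (\<lambda>\<omega>. - I \<omega>)"
    using mesh_limit_uminus[OF mesh_limit_reverse[OF assms(1)[unfolded has_fwd_integral_def]]] .
  show "right_sum B H Y n \<tau> \<omega> = - left_sum B (\<lambda>s. H (1 - s)) (\<lambda>s. Y (1 - s)) n (\<lambda>j. 1 - \<tau> (n - j)) \<omega>" for n \<tau> \<omega>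
    using left_sum_reverse[of B H Y n \<tau> \<omega>, OF assms(2)] by simp
qed

text \<open>The drift changes sign because the Lebesgue integral is unoriented while the increments
  reverse. In the noise term the increments of the driving motion reverse as well, so the diffusion
  coefficient keeps its sign.\<close>

lemma backward_ito_process_reverse:
  assumes Y: "backward_ito_process M G W b \<sigma> Y"
  shows "ito_process M (\<lambda>t. G (1 - t)) (\<lambda>t. W (1 - t)) (\<lambda>t \<omega>. - b (1 - t) \<omega>) (\<lambda>t. \<sigma> (1 - t)) (\<lambda>t. Y (1 - t))"
proof -
  have bm: "brownian_motion M (\<lambda>t. G (1 - t)) (\<lambda>t. W (1 - t))"
    using Y by (simp add: backward_ito_process_def backward_brownian_motion_def)
  then interpret prob_space M
    by (simp add: brownian_motion_def)
  show ?thesis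
    unfolding ito_process_def
  proof (intro conjI ballI impI bm)
    show "Y (1 - t) \<in> borel_measurable (G (1 - t))" if "t \<in> {0..1}" for t
      using Y that by (auto simp: backward_ito_process_def)
    have "AE \<omega> in M. continuous_on {0..1} (\<lambda>t. Y t \<omega>)"
      using Y by (simp add: backward_ito_process_def)
    then show "AE \<omega> in M. continuous_on {0..1} (\<lambda>t. Y (1 - t) \<omega>)"
      by eventually_elim (rule continuous_on_compose2, auto intro!: continuous_intros)
    show "prog_measurable (\<lambda>t. G (1 - t)) (\<lambda>t \<omega>. - b (1 - t) \<omega>)"
      using Y unfolding backward_ito_process_def prog_measurable_def case_prod_beta'
      by (auto intro: borel_measurable_uminus)
    have "AE \<omega> in M. set_integrable lborel {0..1} (\<lambda>s. b s \<omega>)"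
      using Y by (simp add: backward_ito_process_def)
    then show "AE \<omega> in M. set_integrable lborel {0..1} (\<lambda>s. - b (1 - s) \<omega>)"
    proof eventually_elim
      case (elim \<omega>)
      then show ?case
        using set_integrable_reflect[OF elim] by (simp add: set_integrable_def)
    qed
    fix s t :: real assume st: "s \<in> {0..1}" "t \<in> {0..1}" "s \<le> t"
    then have st': "1 - t \<in> {0..1}" "1 - s \<in> {0..1}" "1 - t \<le> 1 - s"
      by auto
    obtain I where I: "has_bwd_integral (*\<^sub>R) M (\<lambda>r _. \<sigma> r) W (1 - t) (1 - s) I"
      "AE \<omega> in M. Y (1 - s) \<omega> - Y (1 - t) \<omega> = (LINT r:{1 - t..1 - s}|lborel. b r \<omega>) + I \<omega>"
      using Y st' unfolding backward_ito_process_def by blast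
    have "has_fwd_integral (*\<^sub>R) M (\<lambda>r _. \<sigma> (1 - r)) (\<lambda>r. W (1 - r)) s t (\<lambda>\<omega>. - I \<omega>)"
      using has_bwd_integral_reverse[OF I(1)] by simp
    moreover have "AE \<omega> in M. Y (1 - t) \<omega> - Y (1 - s) \<omega> = (LINT r:{s..t}|lborel. - b (1 - r) \<omega>) + - I \<omega>"
      using I(2)
    proof eventually_elim
      case (elim \<omega>)
      have "(LINT r:{s..t}|lborel. - b (1 - r) \<omega>) = - (LINT r:{1 - t..1 - s}|lborel. b r \<omega>)"
        using LINT_reflect[of s t "\<lambda>r. b r \<omega>"] by (simp add: set_lebesgue_integral_def)
      then show ?case
        using elim by (simp add: algebra_simps)
    qed
    ultimately show "\<exists>I. has_fwd_integral (*\<^sub>R) M (\<lambda>r _. \<sigma> (1 - r)) (\<lambda>r. W (1 - r)) s t I \<and>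
        (AE \<omega> in M. Y (1 - t) \<omega> - Y (1 - s) \<omega> = (LINT r:{s..t}|lborel. - b (1 - r) \<omega>) + I \<omega>)"
      by blast
  qed
qed

section \<open>Vector fields along a path\<close>

lemma continuous_on_reverse:
  assumes "continuous_on ({0..1::real} \<times> UNIV) (\<lambda>(t, x). h t x)"
  shows "continuous_on ({0..1} \<times> UNIV) (\<lambda>(t, x). h (1 - t) x)"
proof -
  have "continuous_on ({0..1} \<times> UNIV) (\<lambda>p. case (1 - fst p, snd p) of (t, x) \<Rightarrow> h t x)"
    by (rule continuous_on_compose2[OF assms]) (auto intro!: continuous_intros)
  then show ?thesis
    by (simp add: case_prod_beta')
qed

lemma regular_drift_reverse: "regular_drift g \<Longrightarrow> regular_drift (\<lambda>t. g (1 - t))"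
  unfolding regular_drift_def
  using continuous_on_reverse[of g] continuous_on_reverse[of "\<lambda>t x. frechet_derivative (g t) (at x) v" for v]
  by auto

lemma frechet_derivative_scaleR:
  assumes "f differentiable (at x)"
  shows "frechet_derivative (\<lambda>x. c *\<^sub>R f x) (at x) = (\<lambda>w. c *\<^sub>R frechet_derivative f (at x) w)"
proof -
  have "(f has_derivative frechet_derivative f (at x)) (at x)"
    using assms frechet_derivative_works by blast
  then have "((\<lambda>x. c *\<^sub>R f x) has_derivative (\<lambda>w. c *\<^sub>R frechet_derivative f (at x) w)) (at x)"
    by (rule has_derivative_scaleR_right)
  then show ?thesis
    by (rule frechet_derivative_at[symmetric])
qed

lemma divergence_scaleR: "f differentiable (at x) \<Longrightarrow> divergence (\<lambda>x. c *\<^sub>R f x) x = c * divergence f x"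
  by (simp add: divergence_def frechet_derivative_scaleR sum_distrib_left)

lemma continuous_on_scale_time:
  assumes "continuous_on {0..1::real} c" "continuous_on ({0..1} \<times> UNIV) (\<lambda>(t, x). h t x)"
  shows "continuous_on ({0..1} \<times> UNIV) (\<lambda>(t, x). c t *\<^sub>R (h t x :: 'c::real_normed_vector))"
proof -
  have "continuous_on ({0..1} \<times> UNIV) (\<lambda>p::real \<times> 'a. c (fst p))"
    by (rule continuous_on_compose2[OF assms(1)]) (auto intro!: continuous_intros)
  then show ?thesis
    using assms(2) unfolding case_prod_beta' by (rule continuous_on_scaleR)
qed

lemma regular_drift_scaleR:
  assumes c: "continuous_on {0..1} c" and f: "regular_drift f"
  shows "regular_drift (\<lambda>t x. c t *\<^sub>R f t x)"
  unfolding regular_drift_def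
proof (intro conjI allI ballI)
  show "continuous_on ({0..1} \<times> UNIV) (\<lambda>(t, x). c t *\<^sub>R f t x)"
    using f by (intro continuous_on_scale_time[OF c]) (simp add: regular_drift_def)
  show "(\<lambda>x. c t *\<^sub>R f t x) differentiable at x" if "t \<in> {0..1}" for t x
    using f that by (intro differentiable_scaleR differentiable_const) (simp add: regular_drift_def)
  show "continuous_on ({0..1} \<times> UNIV) (\<lambda>(t, x). frechet_derivative (\<lambda>x. c t *\<^sub>R f t x) (at x) v)" for v
  proof (rule continuous_on_eq)
    show "continuous_on ({0..1} \<times> UNIV) (\<lambda>(t, x). c t *\<^sub>R frechet_derivative (f t) (at x) v)"
      using f by (intro continuous_on_scale_time[OF c]) (simp add: regular_drift_def)
    show "(case p of (t, x) \<Rightarrow> c t *\<^sub>R frechet_derivative (f t) (at x) v) =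
        (case p of (t, x) \<Rightarrow> frechet_derivative (\<lambda>x. c t *\<^sub>R f t x) (at x) v)" if "p \<in> {0..1} \<times> UNIV" for p
      using f that by (auto simp: regular_drift_def frechet_derivative_scaleR)
  qed
qed

lemma continuous_on_divergence:
  assumes "regular_drift f"
  shows "continuous_on ({0..1} \<times> UNIV) (\<lambda>(t, x). divergence (f t) x)"
proof -
  have "continuous_on ({0..1} \<times> UNIV) (\<lambda>p. frechet_derivative (f (fst p)) (at (snd p)) e \<bullet> e)" for e
    using assms unfolding regular_drift_def case_prod_beta' by (auto intro!: continuous_on_inner)
  then show ?thesis
    unfolding divergence_def case_prod_beta' by (intro continuous_on_sum)
qed

lemma continuous_on_along_path:
  assumes h: "continuous_on ({0..1::real} \<times> UNIV) (\<lambda>(t, x). h t x)" and y: "continuous_on {0..1} y" and "0 \<le> t"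
  shows "continuous_on {t..1} (\<lambda>s. h s (y s))"
proof -
  have "continuous_on {0..1} (\<lambda>s. case (s, y s) of (t, x) \<Rightarrow> h t x)"
    by (rule continuous_on_compose2[OF h continuous_on_Pair[OF continuous_on_id y]]) auto
  then have "continuous_on {0..1} (\<lambda>s. h s (y s))"
    by simp
  then show ?thesis
    by (rule continuous_on_subset) (use \<open>0 \<le> t\<close> in auto)
qed

section \<open>Stochastic integrals along backward Ito processes\<close>

locale backward_ito =
  fixes N :: "'w measure" and H V b Y and \<sigma> :: "real \<Rightarrow> real"
  assumes backward_ito: "backward_ito_process N H V b \<sigma> (Y :: real \<Rightarrow> 'w \<Rightarrow> 'v::euclidean_space)"
    and \<sigma>_cont: "continuous_on {0..1} \<sigma>"

text \<open>Everything proved for an adapted Ito process becomes available, with prefix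
  \<open>reversed\<close>, for the process run down from time 1.\<close>

sublocale backward_ito \<subseteq> reversed: ito N "\<lambda>t. H (1 - t)" "\<lambda>t. V (1 - t)" "\<lambda>t \<omega>. - b (1 - t) \<omega>" "\<lambda>t. Y (1 - t)" "\<lambda>t. \<sigma> (1 - t)"
proof -
  have ip: "ito_process N (\<lambda>t. H (1 - t)) (\<lambda>t. V (1 - t)) (\<lambda>t \<omega>. - b (1 - t) \<omega>) (\<lambda>t. \<sigma> (1 - t)) (\<lambda>t. Y (1 - t))"
    by (rule backward_ito_process_reverse[OF backward_ito])
  then have bm: "brownian_motion N (\<lambda>t. H (1 - t)) (\<lambda>t. V (1 - t))"
    by (simp add: ito_process_def)
  then have "prob_space N"
    by (simp add: brownian_motion_def)
  moreover have "continuous_on {0..1} (\<lambda>t. \<sigma> (1 - t))"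
    by (rule continuous_on_compose2[OF \<sigma>_cont]) (auto intro!: continuous_intros)
  ultimately show "ito N (\<lambda>t. H (1 - t)) (\<lambda>t. V (1 - t)) (\<lambda>t \<omega>. - b (1 - t) \<omega>) (\<lambda>t. Y (1 - t)) (\<lambda>t. \<sigma> (1 - t))"
    using bm ip by (simp add: ito_def brownian_def brownian_axioms_def ito_axioms_def)
qed

context backward_ito
begin

lemma Y_measurable: "t \<in> {0..1} \<Longrightarrow> Y t \<in> borel_measurable N"
  using reversed.X_measurable[of "1 - t"] by simp

lemma Y_continuous: "AE \<omega> in N. continuous_on {0..1} (\<lambda>t. Y t \<omega>)"
  using backward_ito by (simp add: backward_ito_process_def)

lemma along_Y_measurable:
  assumes "continuous_on ({0..1} \<times> UNIV) (\<lambda>(t, x). h t x)" "t \<in> {0..1}"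
  shows "(\<lambda>\<omega>. h t (Y t \<omega>) :: 'c::euclidean_space) \<in> borel_measurable N"
  using borel_measurable_continuous_onI[OF continuous_on_time_slice[OF assms]] measurable_compose[OF Y_measurable[OF assms(2)]]
  by blast

text \<open>Only continuity of the field is required, so this applies to the score as well as to the
  scaled drift.\<close>

lemma bwd_integrable_along:
  assumes h: "continuous_on ({0..1} \<times> UNIV) (\<lambda>(t, x). h t x)" and t: "t \<in> {0..1}"
  shows "bwd_integrable (\<bullet>) N (\<lambda>s \<omega>. h s (Y s \<omega>)) Y t 1"
proof -
  note h' = continuous_on_reverse[OF h]
  have "fwd_integrable (\<bullet>) N (\<lambda>s \<omega>. h (1 - s) (Y (1 - s) \<omega>)) (\<lambda>s. Y (1 - s)) 0 (1 - t)"
    using t by (intro reversed.fwd_integrable_continuous reversed.compose_adapted[OF h'] reversed.compose_continuous[OF h']) auto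
  then obtain I where "has_fwd_integral (\<bullet>) N (\<lambda>s \<omega>. h (1 - s) (Y (1 - s) \<omega>)) (\<lambda>s. Y (1 - s)) 0 (1 - t) I"
    by (auto simp: fwd_integrable_def)
  from reversed.has_fwd_integral_reverse[of "(\<bullet>)" "\<lambda>s \<omega>. h s (Y s \<omega>)", OF this]
  have "has_bwd_integral (\<bullet>) N (\<lambda>s \<omega>. h s (Y s \<omega>)) Y t 1 (\<lambda>\<omega>. - I \<omega>)"
    by simp
  then show ?thesis
    by (auto simp: bwd_integrable_def)
qed

text \<open>Reversal exchanges right and left sums and changes the sign of both, so their difference
  is preserved.\<close>

lemma bwd_minus_fwd_limit:
  assumes g: "regular_drift g" and t: "t \<in> {0..1}"
  shows "\<exists>I. mesh_limit_in_prob N t 1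
      (\<lambda>n \<tau> \<omega>. right_sum (\<bullet>) (\<lambda>s \<omega>. g s (Y s \<omega>)) Y n \<tau> \<omega> - left_sum (\<bullet>) (\<lambda>s \<omega>. g s (Y s \<omega>)) Y n \<tau> \<omega>) I \<and>
    (AE \<omega> in N. I \<omega> = (LINT s:{t..1}|lborel. (\<sigma> s)\<^sup>2 * divergence (g s) (Y s \<omega>)))"
proof -
  let ?R = "right_sum (\<bullet>) (\<lambda>s \<omega>. g (1 - s) (Y (1 - s) \<omega>)) (\<lambda>s. Y (1 - s))"
  let ?L = "left_sum (\<bullet>) (\<lambda>s \<omega>. g (1 - s) (Y (1 - s) \<omega>)) (\<lambda>s. Y (1 - s))"
  have "0 \<le> 1 - t" "1 - t \<le> 1"
    using t by auto
  then obtain I where I: "mesh_limit_in_prob N 0 (1 - t) (\<lambda>n \<tau> \<omega>. ?R n \<tau> \<omega> - ?L n \<tau> \<omega>) I"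
    "AE \<omega> in N. I \<omega> = (LINT s:{0..1 - t}|lborel. (\<sigma> (1 - s))\<^sup>2 * divergence (g (1 - s)) (Y (1 - s) \<omega>))"
    using reversed.covariation_limit[OF regular_drift_reverse[OF g], of 0 "1 - t"] by auto
  have "mesh_limit_in_prob N t 1
      (\<lambda>n \<tau> \<omega>. right_sum (\<bullet>) (\<lambda>s \<omega>. g s (Y s \<omega>)) Y n \<tau> \<omega> - left_sum (\<bullet>) (\<lambda>s \<omega>. g s (Y s \<omega>)) Y n \<tau> \<omega>) I"
  proof (rule reversed.mesh_limit_cong)
    show "mesh_limit_in_prob N t 1 (\<lambda>n \<tau> \<omega>. ?R n (\<lambda>j. 1 - \<tau> (n - j)) \<omega> - ?L n (\<lambda>j. 1 - \<tau> (n - j)) \<omega>) I"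
      using reversed.mesh_limit_reverse[OF I(1)] by simp
    show "right_sum (\<bullet>) (\<lambda>s \<omega>. g s (Y s \<omega>)) Y n \<tau> \<omega> - left_sum (\<bullet>) (\<lambda>s \<omega>. g s (Y s \<omega>)) Y n \<tau> \<omega> =
        ?R n (\<lambda>j. 1 - \<tau> (n - j)) \<omega> - ?L n (\<lambda>j. 1 - \<tau> (n - j)) \<omega>" for n \<tau> \<omega>
      using left_sum_reverse[of "(\<bullet>)" "\<lambda>s \<omega>. g s (Y s \<omega>)" Y n \<tau> \<omega>] right_sum_reverse[of "(\<bullet>)" "\<lambda>s \<omega>. g s (Y s \<omega>)" Y n \<tau> \<omega>]
      by simp
  qed
  moreover have "(LINT s:{0..1 - t}|lborel. (\<sigma> (1 - s))\<^sup>2 * divergence (g (1 - s)) (Y (1 - s) \<omega>)) =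
      (LINT s:{t..1}|lborel. (\<sigma> s)\<^sup>2 * divergence (g s) (Y s \<omega>))" for \<omega>
    using LINT_reflect[of 0 "1 - t" "\<lambda>s. (\<sigma> s)\<^sup>2 * divergence (g s) (Y s \<omega>)"] by simp
  ultimately show ?thesis
    using I(2) by auto
qed

text \<open>\<open>bwd_integral\<close> is a choice among versions; any known version agrees with it
  almost surely by uniqueness of the limit.\<close>

lemma bwd_integral_AE_eq:
  fixes K :: "real \<Rightarrow> 'w \<Rightarrow> 'v"
  assumes "has_bwd_integral (\<bullet>) N K Y t 1 I" "t \<in> {0..1}"
  shows "AE \<omega> in N. bwd_integral (\<bullet>) N K Y t 1 \<omega> = I \<omega>"
proof -
  have "has_bwd_integral (\<bullet>) N K Y t 1 (bwd_integral (\<bullet>) N K Y t 1)"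
    unfolding bwd_integral_def using someI[of "has_bwd_integral (\<bullet>) N K Y t 1", OF assms(1)] .
  then show ?thesis
    using assms reversed.mesh_limit_unique unfolding has_bwd_integral_def by fastforce
qed

lemma fwd_integral_AE_eq:
  fixes K :: "real \<Rightarrow> 'w \<Rightarrow> 'v"
  assumes "has_fwd_integral (\<bullet>) N K Y t 1 I" "t \<in> {0..1}"
  shows "AE \<omega> in N. fwd_integral (\<bullet>) N K Y t 1 \<omega> = I \<omega>"
proof -
  have "has_fwd_integral (\<bullet>) N K Y t 1 (fwd_integral (\<bullet>) N K Y t 1)"
    unfolding fwd_integral_def using someI[of "has_fwd_integral (\<bullet>) N K Y t 1", OF assms(1)] .
  then show ?thesis
    using assms reversed.mesh_limit_unique unfolding has_fwd_integral_def by fastforce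
qed

section \<open>From the integrals to the log density ratio\<close>

lemma sums_measurable:
  assumes h: "continuous_on ({0..1} \<times> UNIV) (\<lambda>(t, x). h t x)" and t: "t \<in> {0..1}"
    and part: "partition_on_interval t 1 n \<tau>"
  shows "left_sum (\<bullet>) (\<lambda>s \<omega>. h s (Y s \<omega>)) Y n \<tau> \<in> borel_measurable N"
    and "right_sum (\<bullet>) (\<lambda>s \<omega>. h s (Y s \<omega>)) Y n \<tau> \<in> borel_measurable N"
proof -
  have m: "(\<lambda>\<omega>. h (\<tau> i) (Y (\<tau> i) \<omega>)) \<in> borel_measurable N" "Y (\<tau> i) \<in> borel_measurable N" if "i \<le> n" for i
    using partition_in_interval[OF part that] t by (auto intro!: along_Y_measurable[OF h] Y_measurable)
  show "left_sum (\<bullet>) (\<lambda>s \<omega>. h s (Y s \<omega>)) Y n \<tau> \<in> borel_measurable N"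
    "right_sum (\<bullet>) (\<lambda>s \<omega>. h s (Y s \<omega>)) Y n \<tau> \<in> borel_measurable N"
    unfolding left_sum_def right_sum_def
    by (intro borel_measurable_diff borel_measurable_sum borel_measurable_inner m; simp)+
qed

text \<open>The anticipating forward integral is realised as the backward integral \<open>IR\<close>
  of \<open>g\<close> minus the covariation limit \<open>IC\<close>. In the exponent
  \<open>IR\<close> cancels, leaving \<open>IC\<close> and the score integral
  \<open>IS\<close>.\<close>

theorem log_path_ratio:
  assumes pos: "\<forall>t\<in>{0..1}. 0 < \<sigma> t" and f: "regular_drift f"
    and score: "continuous_on ({0..1} \<times> UNIV) (\<lambda>(t, x). score p t x)" and t: "t \<in> {0..1}"
  shows "bwd_integrable (\<bullet>) N (\<lambda>s \<omega>. (1 / (\<sigma> s)\<^sup>2) *\<^sub>R reverse_drift f \<sigma> p s (Y s \<omega>)) Y t 1"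
    and "fwd_integrable (\<bullet>) N (\<lambda>s \<omega>. (1 / (\<sigma> s)\<^sup>2) *\<^sub>R f s (Y s \<omega>)) Y t 1"
    and "bwd_integrable (\<bullet>) N (\<lambda>s \<omega>. score p s (Y s \<omega>)) Y t 1"
    and "AE \<omega> in N.
      ln (path_ratio N \<sigma> f (reverse_drift f \<sigma> p) Y t \<omega>) =
        - bwd_integral (\<bullet>) N (\<lambda>s \<omega>. score p s (Y s \<omega>)) Y t 1 \<omega>
        + (LINT s:{t..1}|lborel. divergence (f s) (Y s \<omega>)
             + score p s (Y s \<omega>) \<bullet> (f s (Y s \<omega>) - ((\<sigma> s)\<^sup>2 / 2) *\<^sub>R score p s (Y s \<omega>)))"
proof -
  note \<sigma>_pos = pos[rule_format]
  define g where "g s x = (1 / (\<sigma> s)\<^sup>2) *\<^sub>R f s x" for s x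
  let ?g = "\<lambda>s \<omega>. g s (Y s \<omega>)"
  let ?s = "\<lambda>s \<omega>. score p s (Y s \<omega>)"
  let ?\<nu> = "\<lambda>s \<omega>. (1 / (\<sigma> s)\<^sup>2) *\<^sub>R reverse_drift f \<sigma> p s (Y s \<omega>)"
  have inv_cont: "continuous_on {0..1} (\<lambda>s. 1 / (\<sigma> s)\<^sup>2)"
    using \<sigma>_pos by (intro continuous_intros \<sigma>_cont) force
  have g_reg: "regular_drift g"
    using regular_drift_scaleR[OF inv_cont f] by (simp add: g_def[abs_def])
  have g_cont: "continuous_on ({0..1} \<times> UNIV) (\<lambda>(t, x). g t x)"
    using g_reg by (simp add: regular_drift_def)
  obtain IR where IR: "has_bwd_integral (\<bullet>) N ?g Y t 1 IR"
    using bwd_integrable_along[OF g_cont t] by (auto simp: bwd_integrable_def)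
  obtain IS where IS: "has_bwd_integral (\<bullet>) N ?s Y t 1 IS"
    using bwd_integrable_along[OF score t] by (auto simp: bwd_integrable_def)
  obtain IC where IC: "mesh_limit_in_prob N t 1 (\<lambda>n \<tau> \<omega>. right_sum (\<bullet>) ?g Y n \<tau> \<omega> - left_sum (\<bullet>) ?g Y n \<tau> \<omega>) IC"
    "AE \<omega> in N. IC \<omega> = (LINT s:{t..1}|lborel. (\<sigma> s)\<^sup>2 * divergence (g s) (Y s \<omega>))"
    using bwd_minus_fwd_limit[OF g_reg t] by blast
  \<comment> \<open>Positivity of \<open>\<sigma>\<close> is available on \<open>{0..1}\<close>
    only, so the identity is used at partition points, by comparing sums.\<close>
  have nu_eq: "?\<nu> s \<omega> = ?g s \<omega> - ?s s \<omega>" if "s \<in> {0..1}" for s \<omega>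
    using \<sigma>_pos[OF that] by (simp add: g_def reverse_drift_def scaleR_diff_right)
  have nu_sum: "right_sum (\<bullet>) ?\<nu> Y n \<tau> \<omega> = right_sum (\<bullet>) ?g Y n \<tau> \<omega> + (-1) * right_sum (\<bullet>) ?s Y n \<tau> \<omega>"
    if part: "partition_on_interval t 1 n \<tau>" for n \<tau> \<omega>
  proof -
    have "?\<nu> (\<tau> (Suc i)) \<omega> = ?g (\<tau> (Suc i)) \<omega> - ?s (\<tau> (Suc i)) \<omega>" if "i < n" for i
      using partition_in_interval[OF part, of "Suc i"] that t by (intro nu_eq) auto
    then have "right_sum (\<bullet>) ?\<nu> Y n \<tau> \<omega> = (\<Sum>i<n. (?g (\<tau> (Suc i)) \<omega> - ?s (\<tau> (Suc i)) \<omega>) \<bullet> (Y (\<tau> (Suc i)) \<omega> - Y (\<tau> i) \<omega>))"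
      unfolding right_sum_def by (intro sum.cong refl) simp
    then show ?thesis
      unfolding right_sum_def by (simp add: inner_diff_left[of "g _ _"] sum_subtractf)
  qed
  have has_nu: "has_bwd_integral (\<bullet>) N ?\<nu> Y t 1 (\<lambda>\<omega>. IR \<omega> + (-1) * IS \<omega>)"
    unfolding has_bwd_integral_def
  proof (rule reversed.mesh_limit_add_scale[OF IR[unfolded has_bwd_integral_def] IS[unfolded has_bwd_integral_def] _ nu_sum])
    fix n \<tau> assume part: "partition_on_interval t 1 n \<tau>"
    show "right_sum (\<bullet>) ?\<nu> Y n \<tau> \<in> borel_measurable N"
      unfolding nu_sum[OF part, THEN ext[where f="right_sum (\<bullet>) ?\<nu> Y n \<tau>"]]
      using sums_measurable(2)[OF g_cont t part] sums_measurable(2)[OF score t part] by simp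
  qed
  have has_f: "has_fwd_integral (\<bullet>) N ?g Y t 1 (\<lambda>\<omega>. IR \<omega> + (-1) * IC \<omega>)"
    unfolding has_fwd_integral_def
    by (rule reversed.mesh_limit_add_scale[OF IR[unfolded has_bwd_integral_def] IC(1)])
       (auto intro: sums_measurable[OF g_cont t])
  show "bwd_integrable (\<bullet>) N ?\<nu> Y t 1"
    using has_nu by (auto simp: bwd_integrable_def)
  show "fwd_integrable (\<bullet>) N (\<lambda>s \<omega>. (1 / (\<sigma> s)\<^sup>2) *\<^sub>R f s (Y s \<omega>)) Y t 1"
    using has_f unfolding g_def by (auto simp: fwd_integrable_def)
  show "bwd_integrable (\<bullet>) N ?s Y t 1"
    using IS by (auto simp: bwd_integrable_def)
  have f_cont: "continuous_on ({0..1} \<times> UNIV) (\<lambda>(t, x). f t x)"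
    using f by (simp add: regular_drift_def)
  show "AE \<omega> in N.
      ln (path_ratio N \<sigma> f (reverse_drift f \<sigma> p) Y t \<omega>) =
        - bwd_integral (\<bullet>) N ?s Y t 1 \<omega>
        + (LINT s:{t..1}|lborel. divergence (f s) (Y s \<omega>)
             + score p s (Y s \<omega>) \<bullet> (f s (Y s \<omega>) - ((\<sigma> s)\<^sup>2 / 2) *\<^sub>R score p s (Y s \<omega>)))"
    using bwd_integral_AE_eq[OF has_nu t] fwd_integral_AE_eq[OF has_f t] bwd_integral_AE_eq[OF IS t] IC(2) Y_continuous
  proof eventually_elim
    case (elim \<omega>)
    let ?D = "\<lambda>s. divergence (f s) (Y s \<omega>)"
    let ?E = "\<lambda>s. score p s (Y s \<omega>) \<bullet> (f s (Y s \<omega>) - ((\<sigma> s)\<^sup>2 / 2) *\<^sub>R score p s (Y s \<omega>))"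
    have "0 \<le> t" using t by simp
    note path = continuous_on_along_path[OF _ elim(5) this]
    \<comment> \<open>Continuity along the path gives the integrability that merging the two time
      integrals requires.\<close>
    have D_int: "set_integrable lborel {t..1} ?D"
      by (intro borel_integrable_atLeastAtMost' path continuous_on_divergence f)
    have "continuous_on {t..1} ?E"
      using t by (intro continuous_intros path[OF score] path[OF f_cont] continuous_on_subset[OF \<sigma>_cont]) auto
    then have E_int: "set_integrable lborel {t..1} ?E"
      by (rule borel_integrable_atLeastAtMost')
    \<comment> \<open>The factor \<open>1 / (\<sigma> s)\<^sup>2\<close> depends on time alone, so
      it comes out of the divergence and cancels.\<close>
    have C: "(LINT s:{t..1}|lborel. (\<sigma> s)\<^sup>2 * divergence (g s) (Y s \<omega>)) = (LINT s:{t..1}|lborel. ?D s)"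
    proof (rule set_lebesgue_integral_cong)
      show "\<forall>s. s \<in> {t..1} \<longrightarrow> (\<sigma> s)\<^sup>2 * divergence (g s) (Y s \<omega>) = ?D s"
      proof (intro allI impI)
        fix s assume "s \<in> {t..1}"
        then have s: "s \<in> {0..1}" using t by auto
        have "f s differentiable at (Y s \<omega>)"
          using f s by (simp add: regular_drift_def)
        then show "(\<sigma> s)\<^sup>2 * divergence (g s) (Y s \<omega>) = ?D s"
          using \<sigma>_pos[OF s] by (simp add: g_def[abs_def] divergence_scaleR)
      qed
    qed simp
    have E: "1 / 2 * (LINT s:{t..1}|lborel. 1 / (\<sigma> s)\<^sup>2 * ((norm (f s (Y s \<omega>)))\<^sup>2 - (norm (reverse_drift f \<sigma> p s (Y s \<omega>)))\<^sup>2)) =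
        (LINT s:{t..1}|lborel. ?E s)"
    proof -
      have "(LINT s:{t..1}|lborel. ?E s) =
          (LINT s:{t..1}|lborel. 1 / 2 * (1 / (\<sigma> s)\<^sup>2 * ((norm (f s (Y s \<omega>)))\<^sup>2 - (norm (reverse_drift f \<sigma> p s (Y s \<omega>)))\<^sup>2)))"
      proof (rule set_lebesgue_integral_cong)
        show "\<forall>s. s \<in> {t..1} \<longrightarrow> ?E s =
            1 / 2 * (1 / (\<sigma> s)\<^sup>2 * ((norm (f s (Y s \<omega>)))\<^sup>2 - (norm (reverse_drift f \<sigma> p s (Y s \<omega>)))\<^sup>2))"
        proof (intro allI impI)
          fix s assume "s \<in> {t..1}"
          then have "\<sigma> s > 0" using t \<sigma>_pos[of s] by auto
          define a z where "a = f s (Y s \<omega>)" "z = score p s (Y s \<omega>)"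
          have "(norm a)\<^sup>2 - (norm (a - (\<sigma> s)\<^sup>2 *\<^sub>R z))\<^sup>2 = 2 * (\<sigma> s)\<^sup>2 * (z \<bullet> (a - ((\<sigma> s)\<^sup>2 / 2) *\<^sub>R z))"
            unfolding power2_norm_eq_inner
            by (simp add: inner_diff_left inner_diff_right inner_commute algebra_simps power2_eq_square)
          then show "?E s = 1 / 2 * (1 / (\<sigma> s)\<^sup>2 * ((norm (f s (Y s \<omega>)))\<^sup>2 - (norm (reverse_drift f \<sigma> p s (Y s \<omega>)))\<^sup>2))"
            unfolding reverse_drift_def a_z_def using \<open>\<sigma> s > 0\<close> by simp
        qed
      qed simp
      then show ?thesis
        by (simp only: set_integral_mult_right)
    qed
    have "ln (path_ratio N \<sigma> f (reverse_drift f \<sigma> p) Y t \<omega>) =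
        bwd_integral (\<bullet>) N ?\<nu> Y t 1 \<omega> - fwd_integral (\<bullet>) N ?g Y t 1 \<omega> + (LINT s:{t..1}|lborel. ?E s)"
      unfolding path_ratio_def g_def ln_exp E ..
    also have "\<dots> = - IS \<omega> + ((LINT s:{t..1}|lborel. ?D s) + (LINT s:{t..1}|lborel. ?E s))"
      using elim C by simp
    also have "\<dots> = - bwd_integral (\<bullet>) N ?s Y t 1 \<omega> + (LINT s:{t..1}|lborel. ?D s + ?E s)"
      using elim(3) set_integral_add(2)[OF D_int E_int] by simp
    finally show ?case .
  qed
qed

text \<open>Both statements concern the same sample point: the densities and the ratio are positive
  and \<open>ln\<close> is injective there, so the equivalence holds wherever the log identity
  does.\<close>

theorem density_estimator_iff:
  assumes pos: "\<forall>t\<in>{0..1}. 0 < \<sigma> t" and f: "regular_drift f" and p: "regular_density p" and t: "t \<in> {0..1}"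
  shows "AE \<omega> in N.
      p t (Y t \<omega>) = p 1 (Y 1 \<omega>) * path_ratio N \<sigma> f (reverse_drift f \<sigma> p) Y t \<omega>
      \<longleftrightarrow>
      ln (p 1 (Y 1 \<omega>)) - ln (p t (Y t \<omega>)) =
        - (LINT s:{t..1}|lborel. divergence (f s) (Y s \<omega>)
             + score p s (Y s \<omega>) \<bullet> (f s (Y s \<omega>) - ((\<sigma> s)\<^sup>2 / 2) *\<^sub>R score p s (Y s \<omega>)))
        + bwd_integral (\<bullet>) N (\<lambda>s \<omega>. score p s (Y s \<omega>)) Y t 1 \<omega>"
proof -
  have score: "continuous_on ({0..1} \<times> UNIV) (\<lambda>(t, x). score p t x)" and p_pos: "0 < p t x" "0 < p 1 x" for x
    using p t by (auto simp: regular_density_def)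
  show ?thesis
    using log_path_ratio(4)[OF pos f score t]
  proof eventually_elim
    case (elim \<omega>)
    have R: "0 < path_ratio N \<sigma> f (reverse_drift f \<sigma> p) Y t \<omega>"
      by (simp add: path_ratio_def)
    have "p t (Y t \<omega>) = p 1 (Y 1 \<omega>) * path_ratio N \<sigma> f (reverse_drift f \<sigma> p) Y t \<omega> \<longleftrightarrow>
        ln (p t (Y t \<omega>)) = ln (p 1 (Y 1 \<omega>) * path_ratio N \<sigma> f (reverse_drift f \<sigma> p) Y t \<omega>)"
      using p_pos R by (subst ln_inj_iff) auto
    also have "\<dots> \<longleftrightarrow> ln (p t (Y t \<omega>)) = ln (p 1 (Y 1 \<omega>)) + ln (path_ratio N \<sigma> f (reverse_drift f \<sigma> p) Y t \<omega>)"
      using p_pos R by (subst ln_mult_pos) auto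
    finally show ?case
      unfolding elim by auto
  qed
qed

end

theorem mainTheorem8:
  fixes M :: "'a measure" and N :: "'b measure"
    and F G :: "real \<Rightarrow> 'a measure" and H :: "real \<Rightarrow> 'b measure"
    and f :: "real \<Rightarrow> 'v::euclidean_space \<Rightarrow> 'v" and \<sigma> :: "real \<Rightarrow> real"
    and p :: "real \<Rightarrow> 'v \<Rightarrow> real"
    and W W' X :: "real \<Rightarrow> 'a \<Rightarrow> 'v" and V b Y :: "real \<Rightarrow> 'b \<Rightarrow> 'v"
  assumes "continuous_on {0..1} \<sigma>" and "\<forall>t\<in>{0..1}. 0 < \<sigma> t"
    and "regular_drift f" and "regular_density p"
    and "solves_forward_sde M F W f \<sigma> X"
    and "\<forall>t\<in>{0..1}. distributed M lborel (X t) (\<lambda>x. ennreal (p t x))"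
    and "solves_backward_sde M G W' (reverse_drift f \<sigma> p) \<sigma> X"
    and "backward_ito_process N H V b \<sigma> Y"
  shows "\<forall>t\<in>{0..1}.
    bwd_integrable (\<bullet>) N (\<lambda>s \<omega>. (1 / (\<sigma> s)\<^sup>2) *\<^sub>R reverse_drift f \<sigma> p s (Y s \<omega>)) Y t 1 \<and>
    fwd_integrable (\<bullet>) N (\<lambda>s \<omega>. (1 / (\<sigma> s)\<^sup>2) *\<^sub>R f s (Y s \<omega>)) Y t 1 \<and>
    bwd_integrable (\<bullet>) N (\<lambda>s \<omega>. score p s (Y s \<omega>)) Y t 1 \<and>
    (AE \<omega> in N.
      p t (Y t \<omega>) = p 1 (Y 1 \<omega>) * path_ratio N \<sigma> f (reverse_drift f \<sigma> p) Y t \<omega>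
      \<longleftrightarrow>
      ln (p 1 (Y 1 \<omega>)) - ln (p t (Y t \<omega>)) =
        - (LINT s:{t..1}|lborel. divergence (f s) (Y s \<omega>)
             + score p s (Y s \<omega>) \<bullet> (f s (Y s \<omega>) - ((\<sigma> s)\<^sup>2 / 2) *\<^sub>R score p s (Y s \<omega>)))
        + bwd_integral (\<bullet>) N (\<lambda>s \<omega>. score p s (Y s \<omega>)) Y t 1 \<omega>) \<and>
    (AE \<omega> in N.
      ln (path_ratio N \<sigma> f (reverse_drift f \<sigma> p) Y t \<omega>) =
        - bwd_integral (\<bullet>) N (\<lambda>s \<omega>. score p s (Y s \<omega>)) Y t 1 \<omega>
        + (LINT s:{t..1}|lborel. divergence (f s) (Y s \<omega>)
             + score p s (Y s \<omega>) \<bullet> (f s (Y s \<omega>) - ((\<sigma> s)\<^sup>2 / 2) *\<^sub>R score p s (Y s \<omega>))))"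
proof -
  interpret backward_ito N H V b Y \<sigma>
    using assms(1,8) by unfold_locales
  have score: "continuous_on ({0..1} \<times> UNIV) (\<lambda>(t, x). score p t x)"
    using assms(4) by (simp add: regular_density_def)
  show ?thesis
    by (intro ballI conjI log_path_ratio[OF assms(2,3) score] density_estimator_iff[OF assms(2-4)])
qed

end
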